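(* Assume in addition that $a\in W^{1,1}_{\mathrm{loc}}(\mathbb R_+)$. Let $X$ be an $H$-valued predictable process on $[0,T]$ with integrable trajectories such that for every $t\in[0,T]$ and every $\xi\in\mathcal D(A^* )$, $$\langle X(t),\xi\rangle_H=\int_0^t\langle a(t-\tau)X(\tau),A^*\xi\rangle_H\,d\tau+\langle Z(t),\xi\rangle_H\quad P\text{-a.s.}$$ Then $X(t)=Z_{\mathcal R}(t):=\int_0^t\mathcal R(t-\tau)\,dZ(\tau)$ $P$-a.s. for every $t\in[0,T]$.
   Context: $H$ is a real separable Hilbert space with inner product $\langle\cdot,\cdot\rangle_H$; $A$ is a closed densely defined linear operator in $H$ with adjoint $A^*$, $a\in L^1_{\mathrm{loc}}(\mathbb R_+)$, and the equation $X(t)=\int_0^t a(t-\tau)AX(\tau)\,d\tau+X_0+Z(t)$ is well-posed with resolvent family $\{\mathcal R(t)\}_{t\ge0}$ of bounded operators, uniformly bounded on compact intervals, strongly continuous, $\mathcal R(0)=I$, satisfying $\mathcal R(t)x=x+\int_0^t a(t-\tau)A\mathcal R(\tau)x\,d\tau$ for $x\in\mathcal D(A)$. $Z$ is an $H$-valued Lévy process (independent stationary increments, continuous in probability, càdlàg, $Z(0)=0$) on a filtered probability space. The stochastic convolution $\int_0^t\mathcal R(t-\tau)\,dZ(\tau)$ is the limit in probability of $\sum_i\mathcal R(s_i)(Z(t-t_{i-1})-Z(t-t_i))$ over partitions $0=t_0<\dots<t_n=t$ with mesh $\to0$, $s_i\in[t_{i-1},t_i]$. *)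

theory Defs
  imports "HOL-Probability.Probability"
begin

text \<open>A (possibly unbounded) linear operator is given by its domain D and its action A
  (values outside D are irrelevant).\<close>

definition closed_densely_defined ::
  "'h::{real_inner,complete_space} set \<Rightarrow> ('h \<Rightarrow> 'h) \<Rightarrow> bool" where
  "closed_densely_defined D A \<longleftrightarrow>
     subspace D \<and>
     (\<forall>x\<in>D. \<forall>y\<in>D. A (x + y) = A x + A y) \<and>
     (\<forall>x\<in>D. \<forall>c::real. A (c *\<^sub>R x) = c *\<^sub>R A x) \<and>
     closed {(x, A x) | x. x \<in> D} \<and>
     closure D = UNIV"

definition adj_dom :: "'h::real_inner set \<Rightarrow> ('h \<Rightarrow> 'h) \<Rightarrow> 'h set" where
  "adj_dom D A = {y. \<exists>z. \<forall>x\<in>D. inner (A x) y = inner x z}"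

definition adj_op :: "'h::real_inner set \<Rightarrow> ('h \<Rightarrow> 'h) \<Rightarrow> 'h \<Rightarrow> 'h" where
  "adj_op D A y = (THE z. \<forall>x\<in>D. inner (A x) y = inner x z)"

definition locally_integrable :: "(real \<Rightarrow> real) \<Rightarrow> bool" where
  "locally_integrable a \<longleftrightarrow> (\<forall>T\<ge>0. set_integrable lborel {0..T} a)"

definition W11_loc :: "(real \<Rightarrow> real) \<Rightarrow> bool" where
  "W11_loc a \<longleftrightarrow> locally_integrable a \<and>
     (\<exists>c b. locally_integrable b \<and>
        (AE t in lborel. t \<ge> 0 \<longrightarrow> a t = c + (LINT s:{0..t}|lborel. b s)))"

definition resolvent_family ::
  "('h::{real_inner,banach,second_countable_topology}) set \<Rightarrow> ('h \<Rightarrow> 'h) \<Rightarrow> (real \<Rightarrow> real)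
     \<Rightarrow> (real \<Rightarrow> 'h \<Rightarrow> 'h) \<Rightarrow> bool" where
  "resolvent_family D A a R \<longleftrightarrow>
     (\<forall>t\<ge>0. bounded_linear (R t)) \<and>
     (\<forall>T\<ge>0. \<exists>C. \<forall>t\<in>{0..T}. \<forall>x. norm (R t x) \<le> C * norm x) \<and>
     (\<forall>x. continuous_on {0..} (\<lambda>t. R t x)) \<and>
     R 0 = id \<and>
     (\<forall>t\<ge>0. \<forall>x\<in>D. R t x \<in> D \<and> A (R t x) = R t (A x)) \<and>
     (\<forall>t\<ge>0. \<forall>x\<in>D. R t x = x + (LINT \<tau>:{0..t}|lborel. a (t - \<tau>) *\<^sub>R A (R \<tau> x)))"

definition filtration_of :: "'w measure \<Rightarrow> (real \<Rightarrow> 'w measure) \<Rightarrow> bool" where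
  "filtration_of M F \<longleftrightarrow>
     (\<forall>t. space (F t) = space M \<and> sets (F t) \<subseteq> sets M) \<and>
     (\<forall>s t. s \<le> t \<longrightarrow> sets (F s) \<subseteq> sets (F t))"

definition levy_process ::
  "'w measure \<Rightarrow> (real \<Rightarrow> 'w \<Rightarrow> 'h::{real_normed_vector,second_countable_topology}) \<Rightarrow> bool" where
  "levy_process M Z \<longleftrightarrow>
     (\<forall>t\<ge>0. Z t \<in> borel_measurable M) \<and>
     (\<forall>\<omega>\<in>space M. Z 0 \<omega> = 0) \<and>
     (\<forall>\<omega>\<in>space M. \<forall>t\<ge>0. continuous (at_right t) (\<lambda>s. Z s \<omega>) \<and>
         (t > 0 \<longrightarrow> (\<exists>l. ((\<lambda>s. Z s \<omega>) \<longlongrightarrow> l) (at_left t)))) \<and>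
     (\<forall>(n::nat) (ts::nat \<Rightarrow> real). 0 \<le> ts 0 \<and> (\<forall>i<n. ts i < ts (Suc i)) \<longrightarrow>
         prob_space.indep_vars M (\<lambda>_. borel) (\<lambda>i \<omega>. Z (ts (Suc i)) \<omega> - Z (ts i) \<omega>) {..<n}) \<and>
     (\<forall>s t. 0 \<le> s \<and> s \<le> t \<longrightarrow>
         distr M borel (\<lambda>\<omega>. Z t \<omega> - Z s \<omega>) = distr M borel (Z (t - s))) \<and>
     (\<forall>t\<ge>0. \<forall>\<epsilon>>0. ((\<lambda>s. measure M {\<omega>\<in>space M. \<epsilon> \<le> dist (Z s \<omega>) (Z t \<omega>)}) \<longlongrightarrow> 0)
         (at t within {0..}))"

definition adapted :: "(real \<Rightarrow> 'w measure) \<Rightarrow> (real \<Rightarrow> 'w \<Rightarrow> 'h::topological_space) \<Rightarrow> bool" where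
  "adapted F Z \<longleftrightarrow> (\<forall>t\<ge>0. Z t \<in> borel_measurable (F t))"

definition predictable_sigma :: "'w measure \<Rightarrow> (real \<Rightarrow> 'w measure) \<Rightarrow> real \<Rightarrow> (real \<times> 'w) measure" where
  "predictable_sigma M F T = sigma ({0..T} \<times> space M)
     ({{s<..t} \<times> A | s t A. 0 \<le> s \<and> s < t \<and> t \<le> T \<and> A \<in> sets (F s)} \<union>
      {{0} \<times> A | A. A \<in> sets (F 0)})"

definition predictable :: "'w measure \<Rightarrow> (real \<Rightarrow> 'w measure) \<Rightarrow> real \<Rightarrow> (real \<Rightarrow> 'w \<Rightarrow> 'h::topological_space) \<Rightarrow> bool" where
  "predictable M F T X \<longleftrightarrow> (\<lambda>(t, \<omega>). X t \<omega>) \<in> borel_measurable (predictable_sigma M F T)"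

definition conv_sum ::
  "(real \<Rightarrow> 'h \<Rightarrow> 'h::real_normed_vector) \<Rightarrow> (real \<Rightarrow> 'w \<Rightarrow> 'h) \<Rightarrow> real \<Rightarrow> nat \<Rightarrow> (nat \<Rightarrow> real)
     \<Rightarrow> (nat \<Rightarrow> real) \<Rightarrow> 'w \<Rightarrow> 'h" where
  "conv_sum R Z t n p s \<omega> = (\<Sum>i=1..n. R (s i) (Z (t - p (i - 1)) \<omega> - Z (t - p i) \<omega>))"

definition tagged_partition :: "real \<Rightarrow> real \<Rightarrow> nat \<Rightarrow> (nat \<Rightarrow> real) \<Rightarrow> (nat \<Rightarrow> real) \<Rightarrow> bool" where
  "tagged_partition t \<delta> n p s \<longleftrightarrow>
     p 0 = 0 \<and> p n = t \<and>
     (\<forall>i\<in>{1..n}. p (i - 1) < p i \<and> p i - p (i - 1) < \<delta> \<and> p (i - 1) \<le> s i \<and> s i \<le> p i)"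

text \<open>Y is (a version of) the stochastic convolution int_0^t R(t-tau) dZ(tau), i.e. the
  limit in probability of the sums as the mesh tends to 0.\<close>

definition stoch_conv ::
  "'w measure \<Rightarrow> (real \<Rightarrow> 'h \<Rightarrow> 'h::real_normed_vector) \<Rightarrow> (real \<Rightarrow> 'w \<Rightarrow> 'h) \<Rightarrow> real \<Rightarrow> ('w \<Rightarrow> 'h) \<Rightarrow> bool" where
  "stoch_conv M R Z t Y \<longleftrightarrow>
     (\<forall>\<epsilon>>0. \<exists>\<delta>>0. \<forall>n p s. tagged_partition t \<delta> n p s \<longrightarrow>
        measure M {\<omega>\<in>space M. \<epsilon> \<le> dist (conv_sum R Z t n p s \<omega>) (Y \<omega>)} < \<epsilon>)"

end

theory Submission
  imports Defs
begin

text \<open>Testing the weak equation with \<open>R(s)\<^sup>* \<xi>\<close> and convolving gives \<open>1 * X = R * Z\<close>. Since \<open>a\<close> is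
  absolutely continuous, \<open>R(\<cdot>)x\<close> is \<open>C\<^sup>1\<close> for \<open>x\<close> in the domain of \<open>A\<close>, and summation by parts shows that, on
  every path, the convolution sums converge to \<open>X(t)\<close> when tested against the domain of \<open>A\<^sup>*\<close>.

  Strong convergence in probability uses finite-rank orthogonal projections \<open>P\<^sub>N\<close> with range in the domain
  of \<open>A\<close>. The sums for \<open>P\<^sub>N Z\<close> converge on every path. A cadlag path has relatively compact range, so
  \<open>W = Z - P\<^sub>N Z\<close> is at most \<open>\<epsilon>\<close> on \<open>[0, t]\<close> with high probability for large \<open>N\<close>. A fourth moment estimate then
  bounds the mean and the variance of the truncated increments of \<open>W\<close> over time \<open>h\<close> by multiples of
  \<open>\<epsilon> h\<close> and \<open>\<epsilon>\<^sup>2 h\<close> (the linear growth in \<open>h\<close> comes from stationarity), so the sums for \<open>W\<close> are uniformly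
  small in probability. Their weak limit is therefore small in norm as well.\<close>

section \<open>Hilbert space preliminaries\<close>

text \<open>Write \<open>a = c + 1 * b\<close> with convolution in time. Then
  \<open>a * X = c (1 * X) + b * (1 * X)\<close>, so \<open>1 * X = R * Z\<close> yields
  \<open>a * X = K * Z\<close> for \<open>K = c R + b * R\<close>, and the weak equation becomes
  \<open>X(t) = Z(t) + A (K * Z)(t)\<close>, tested against the domain of the adjoint. The resolvent
  equation likewise becomes \<open>R(s) = 1 + A (1 * K)(s)\<close>, so summation by parts turns the
  convolution sums into approximations of the same expression. Two obstacles shape the rest. The
  weak equation holds only up to a null set that depends on the time and on the test vector; a
  countable dense set of test vectors and Fubini's theorem on time and probability space deal with
  this. More seriously, \<open>Z\<close> may have no moments, while \<open>stoch_conv\<close>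
  demands norm convergence along all partitions, with existence of the limit as part of the claim.
  So no isometry is available: moments are extracted from the smallness of the path of
  \<open>W\<close> itself, after truncation at a level that is inactive with high
  probability.\<close>

lemma parallelogram_law:
  fixes x y :: "'a::real_inner"
  shows "(norm (x + y))\<^sup>2 + (norm (x - y))\<^sup>2 = 2 * (norm x)\<^sup>2 + 2 * (norm y)\<^sup>2"
  by (simp add: power2_norm_eq_inner algebra_simps inner_commute)

text \<open>A minimising sequence is Cauchy by the parallelogram law, because midpoints stay in the
  subspace; minimality of the limit then forces orthogonality of the residual.\<close>

lemma orthogonal_projection_exists:
  fixes S :: "'a::{real_inner,complete_space} set"
  assumes S: "subspace S" "closed S"
  obtains y where "y \<in> S" "\<And>z. z \<in> S \<Longrightarrow> inner (x - y) z = 0"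
proof -
  define d where "d = (INF s\<in>S. (norm (x - s))\<^sup>2)"
  have ne: "S \<noteq> {}" using S(1) subspace_0 by auto
  have bdd: "bdd_below ((\<lambda>s. (norm (x - s))\<^sup>2) ` S)" by (auto intro!: bdd_belowI[where m=0])
  have dle: "d \<le> (norm (x - s))\<^sup>2" if "s \<in> S" for s
    unfolding d_def by (rule cINF_lower[OF bdd that])
  have "\<exists>s\<in>S. (norm (x - s))\<^sup>2 < d + 1 / Suc n" for n
    using cINF_less_iff[OF ne bdd, of "d + 1 / Suc n"] by (auto simp: d_def)
  then obtain s where s: "\<And>n. s n \<in> S" "\<And>n. (norm (x - s n))\<^sup>2 < d + 1 / Suc n" by metis
  have close: "(norm (s m - s n))\<^sup>2 \<le> 2 / Suc m + 2 / Suc n" for m n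
  proof -
    have "(1/2) *\<^sub>R (s m + s n) \<in> S" using S(1) s by (simp add: subspace_add subspace_scale)
    then have "d \<le> (norm (x - (1/2) *\<^sub>R (s m + s n)))\<^sup>2" by (rule dle)
    also have "x - (1/2) *\<^sub>R (s m + s n) = (1/2) *\<^sub>R ((x - s m) + (x - s n))"
      by (simp add: algebra_simps flip: scaleR_add_left)
    finally have "4 * d \<le> (norm ((x - s m) + (x - s n)))\<^sup>2" by (simp add: power_divide)
    moreover have "(norm ((x - s m) + (x - s n)))\<^sup>2 + (norm ((x - s m) - (x - s n)))\<^sup>2
        = 2 * (norm (x - s m))\<^sup>2 + 2 * (norm (x - s n))\<^sup>2" by (rule parallelogram_law)
    moreover have "norm ((x - s m) - (x - s n)) = norm (s m - s n)" by (simp add: norm_minus_commute)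
    ultimately show ?thesis using s(2)[of m] s(2)[of n] by simp
  qed
  have "Cauchy s"
  proof (rule metric_CauchyI)
    fix e :: real assume e: "e > 0"
    then obtain N where N: "1 / real (Suc N) < e\<^sup>2 / 4"
      using nat_approx_posE[of "e\<^sup>2/4"] by auto
    have "dist (s m) (s n) < e" if "m \<ge> N" "n \<ge> N" for m n
    proof -
      have "1 / real (Suc m) \<le> 1 / real (Suc N)" "1 / real (Suc n) \<le> 1 / real (Suc N)"
        using that by (auto intro!: frac_le)
      then have "(norm (s m - s n))\<^sup>2 < e\<^sup>2" using close[of m n] N by simp
      then show ?thesis using e by (simp add: dist_norm power_less_imp_less_base)
    qed
    then show "\<exists>N. \<forall>m\<ge>N. \<forall>n\<ge>N. dist (s m) (s n) < e" by blast
  qed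
  then obtain y where y: "s \<longlonglongrightarrow> y" using Cauchy_convergent convergent_def by blast
  have yS: "y \<in> S" using S(2) s(1) y closed_sequentially by blast
  have "(\<lambda>n. d + 1 / real (Suc n)) \<longlonglongrightarrow> d + 0"
    by (intro tendsto_add tendsto_const lim_1_over_n[THEN LIMSEQ_Suc])
  moreover have "(\<lambda>n. (norm (x - s n))\<^sup>2) \<longlonglongrightarrow> (norm (x - y))\<^sup>2" by (intro tendsto_intros y)
  ultimately have yd: "(norm (x - y))\<^sup>2 \<le> d"
    using s(2) by (intro LIMSEQ_le) (auto intro!: exI[of _ 0] less_imp_le)
  have "inner (x - y) z = 0" if z: "z \<in> S" for z
  proof (cases "z = 0")
    case False
    \<comment> \<open>This \<open>c\<close> minimises the quadratic
      \<open>(norm (x - y - c *\<^sub>R z))\<^sup>2\<close>, so moving by it would strictly decrease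
      the distance unless the inner product vanishes.\<close>
    define c where "c = inner (x - y) z / inner z z"
    have "y + c *\<^sub>R z \<in> S" using S(1) yS z by (simp add: subspace_add subspace_scale)
    from yd dle[OF this] have "(norm (x - y))\<^sup>2 \<le> (norm (x - (y + c *\<^sub>R z)))\<^sup>2"
      by (rule order_trans)
    also have "x - (y + c *\<^sub>R z) = x - y - c *\<^sub>R z" by simp
    also have "(norm (x - y - c *\<^sub>R z))\<^sup>2 = (norm (x - y))\<^sup>2 - 2 * c * inner (x - y) z + c\<^sup>2 * inner z z"
      unfolding power2_norm_eq_inner by (simp add: inner_diff inner_commute power2_eq_square algebra_simps)
    also have "\<dots> = (norm (x - y))\<^sup>2 - (inner (x - y) z)\<^sup>2 / inner z z"
      using False by (simp add: c_def power2_eq_square)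
    finally have "(inner (x - y) z)\<^sup>2 / inner z z \<le> 0" by simp
    then have "inner z z \<le> 0 \<or> inner (x - y) z = 0" by (simp add: divide_le_0_iff)
    moreover have "\<not> inner z z \<le> 0" using False by (simp add: not_le)
    ultimately show ?thesis by blast
  qed simp
  with yS that show ?thesis by blast
qed

lemma subspace_closure:
  fixes S :: "'a::real_normed_vector set"
  assumes S: "subspace S"
  shows "subspace (closure S)"
proof (rule subspaceI)
  show "0 \<in> closure S" using S closure_subset subspace_0 by blast
next
  fix x y assume "x \<in> closure S" "y \<in> closure S"
  then obtain u v where "\<And>n. u n \<in> S" "u \<longlonglongrightarrow> x" "\<And>n. v n \<in> S" "v \<longlonglongrightarrow> y"
    by (auto simp: closure_sequential)
  then show "x + y \<in> closure S" using S
    by (auto simp: closure_sequential intro!: exI[of _ "\<lambda>n. u n + v n"] tendsto_add subspace_add)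
next
  fix c x assume "x \<in> closure S"
  then obtain u where "\<And>n. u n \<in> S" "u \<longlonglongrightarrow> x" by (auto simp: closure_sequential)
  then show "c *\<^sub>R x \<in> closure S" using S
    by (auto simp: closure_sequential intro!: exI[of _ "\<lambda>n. c *\<^sub>R u n"] tendsto_scaleR subspace_scale)
qed

lemma closure_eq_UNIV_if_trivial_complement:
  fixes S :: "'a::{real_inner,complete_space} set"
  assumes "subspace S" and "\<And>z. (\<And>s. s \<in> S \<Longrightarrow> inner z s = 0) \<Longrightarrow> z = 0"
  shows "closure S = UNIV"
proof -
  have "x \<in> closure S" for x
  proof -
    obtain y where "y \<in> closure S" "\<And>z. z \<in> closure S \<Longrightarrow> inner (x - y) z = 0"
      by (rule orthogonal_projection_exists[OF subspace_closure[OF assms(1)] closed_closure, where x=x]) blast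
    with assms(2)[of "x - y"] closure_subset[of S] show ?thesis by auto
  qed
  then show ?thesis by auto
qed

text \<open>The complement of the kernel is a line spanned by \<open>w\<close>, and every
  \<open>x\<close> differs from a multiple of \<open>w\<close> by an element of the kernel.\<close>

lemma riesz_representation:
  fixes f :: "'a::{real_inner,complete_space} \<Rightarrow> real"
  assumes f: "bounded_linear f"
  obtains y where "\<And>x. f x = inner x y"
proof (cases "\<forall>x. f x = 0")
  case True
  then show ?thesis using that[of 0] by simp
next
  case False
  interpret bounded_linear f by (rule f)
  let ?S = "{x. f x = 0}"
  obtain x0 where x0: "f x0 \<noteq> 0" using False by auto
  have sub: "subspace ?S" by (auto simp: subspace_def add scale zero)
  have cl: "closed ?S" by (intro closed_Collect_eq continuous_on continuous_on_id continuous_on_const)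
  obtain p where p: "p \<in> ?S" "\<And>z. z \<in> ?S \<Longrightarrow> inner (x0 - p) z = 0"
    by (rule orthogonal_projection_exists[OF sub cl, where x=x0]) blast
  define w where "w = x0 - p"
  have fw: "f w \<noteq> 0" using x0 p(1) by (simp add: w_def diff)
  then have w0: "w \<noteq> 0" by auto
  show ?thesis
  proof (rule that[of "(f w / inner w w) *\<^sub>R w"])
    fix x
    have "f (x - (f x / f w) *\<^sub>R w) = 0" using fw by (simp add: diff scaleR)
    then have "inner w (x - (f x / f w) *\<^sub>R w) = 0" using p(2) by (simp add: w_def)
    then have "inner x w = f x / f w * inner w w" by (simp add: inner_diff inner_commute)
    then show "f x = inner x ((f w / inner w w) *\<^sub>R w)" using fw w0 by simp
  qed
qed

lemma inner_left_eq_if_dense: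
  fixes x y :: "'a::real_inner"
  assumes "closure S = UNIV" and "\<And>s. s \<in> S \<Longrightarrow> inner x s = inner y s"
  shows "x = y"
proof -
  have "closed {s. inner x s = inner y s}" by (intro closed_Collect_eq continuous_intros)
  then have "closure S \<subseteq> {s. inner x s = inner y s}" using assms(2) by (intro closure_minimal) auto
  then have "inner x (x - y) = inner y (x - y)" using assms(1) by auto
  then have "inner (x - y) (x - y) = 0" by (simp add: inner_diff_left)
  then show ?thesis by simp
qed

section \<open>Adjoint operators and finite-rank approximation\<close>

lemma adj_op_inner:
  assumes A: "closed_densely_defined D A" and "\<xi> \<in> adj_dom D A" "x \<in> D"
  shows "inner (A x) \<xi> = inner x (adj_op D A \<xi>)"
proof -
  obtain z where z: "\<forall>x\<in>D. inner (A x) \<xi> = inner x z" using assms(2) by (auto simp: adj_dom_def)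
  \<comment> \<open>Density of \<open>D\<close> determines \<open>z\<close> uniquely, which makes
    the description operator in \<open>adj_op\<close> meaningful.\<close>
  have "adj_op D A \<xi> = z" unfolding adj_op_def
  proof (rule the_equality)
    show "\<forall>x\<in>D. inner (A x) \<xi> = inner x z" by (rule z)
    fix z' assume "\<forall>x\<in>D. inner (A x) \<xi> = inner x z'"
    then show "z' = z" using z A
      by (intro inner_left_eq_if_dense[of D]) (auto simp: closed_densely_defined_def inner_commute)
  qed
  with z assms(3) show ?thesis by simp
qed

lemma adj_op_unique:
  assumes A: "closed_densely_defined D A" and z: "\<And>x. x \<in> D \<Longrightarrow> inner (A x) \<xi> = inner x z"
  shows "\<xi> \<in> adj_dom D A" "adj_op D A \<xi> = z"
proof -
  show \<xi>: "\<xi> \<in> adj_dom D A" using z by (auto simp: adj_dom_def)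
  show "adj_op D A \<xi> = z" using A adj_op_inner[OF A \<xi>] z
    by (intro inner_left_eq_if_dense[of D]) (auto simp: closed_densely_defined_def inner_commute)
qed

text \<open>Von Neumann's graph argument. For \<open>z\<close> orthogonal to the domain of the
  adjoint, project \<open>(0, z)\<close> onto the closed graph. The residual
  \<open>(-x, z - A x)\<close> is orthogonal to the graph, which says exactly that
  \<open>z - A x\<close> lies in the domain of the adjoint with image \<open>x\<close>.
  Orthogonality of \<open>z\<close> to it makes \<open>(norm (z - A x))\<^sup>2\<close> equal to
  \<open>- (norm x)\<^sup>2\<close>, hence \<open>x = 0\<close> and \<open>z = 0\<close>.\<close>

lemma adj_dom_dense:
  fixes A :: "'h::{real_inner,complete_space} \<Rightarrow> 'h"
  assumes A: "closed_densely_defined D A"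
  shows "closure (adj_dom D A) = UNIV"
proof (rule closure_eq_UNIV_if_trivial_complement)
  show "subspace (adj_dom D A)"
  proof (rule subspaceI)
    show "0 \<in> adj_dom D A" by (auto simp: adj_dom_def intro!: exI[of _ 0])
    fix x y c assume "x \<in> adj_dom D A" "y \<in> adj_dom D A"
    then obtain u v where "\<forall>w\<in>D. inner (A w) x = inner w u" "\<forall>w\<in>D. inner (A w) y = inner w v"
      by (auto simp: adj_dom_def)
    then show "x + y \<in> adj_dom D A" "c *\<^sub>R x \<in> adj_dom D A"
      by (auto simp: adj_dom_def inner_add_right intro: exI[of _ "u + v"] exI[of _ "c *\<^sub>R u"])
  qed
  fix z assume z: "\<And>s. s \<in> adj_dom D A \<Longrightarrow> inner z s = 0"
  let ?G = "{(x, A x) | x. x \<in> D}"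
  have D: "subspace D" and add: "\<And>x y. x \<in> D \<Longrightarrow> y \<in> D \<Longrightarrow> A (x + y) = A x + A y"
    and scl: "\<And>c x. x \<in> D \<Longrightarrow> A (c *\<^sub>R x) = c *\<^sub>R A x" and cl: "closed ?G"
    using A by (auto simp: closed_densely_defined_def)
  have A0: "A 0 = 0" using scl[OF subspace_0[OF D], of 0] by simp
  have G: "subspace ?G"
    using D by (auto simp: subspace_def zero_prod_def A0 add scl intro!: exI)
  obtain g where g: "g \<in> ?G" "\<And>w. w \<in> ?G \<Longrightarrow> inner ((0, z) - g) w = 0"
    by (rule orthogonal_projection_exists[OF G cl, where x="(0, z)"]) blast
  then obtain x where x: "x \<in> D" "g = (x, A x)" by auto
  have orth: "inner (A w) (z - A x) = inner w x" if "w \<in> D" for w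
    using g(2)[of "(w, A w)"] that x by (simp add: inner_commute)
  then have "z - A x \<in> adj_dom D A" using adj_op_unique[OF A] by blast
  from z[OF this] have 1: "inner z z = inner z (A x)" by (simp add: inner_diff)
  have "inner (A x) z = inner x x + inner (A x) (A x)" using orth[OF x(1)] by (simp add: inner_diff algebra_simps)
  with 1 have 2: "inner z z = inner x x + inner (A x) (A x)" by (simp add: inner_commute)
  have "inner (z - A x) (z - A x) = inner (A x) (A x) - inner z z"
    using 1 by (simp add: inner_diff inner_commute)
  then have "inner x x \<le> 0" using 2 inner_ge_zero[of "z - A x"] by simp
  then have "x = 0" using inner_eq_zero_iff[of x] inner_ge_zero[of x] by simp
  then show "z = 0" using 2 A0 by simp
qed


text \<open>Gram-Schmidt orthogonalisation of a countable dense subset of \<open>D\<close>. Finite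
  rank with range in \<open>D\<close> is what makes \<open>A\<close> composed with
  \<open>P N\<close> bounded although \<open>A\<close> may be unbounded; nested ranges give monotone
  residuals, from which one index will serve a whole path.\<close>

lemma orthogonal_approximations:
  fixes D :: "'h::{real_inner,complete_space,second_countable_topology} set"
  assumes A: "closed_densely_defined D A"
  obtains P where "\<And>N. bounded_linear (P N)" "\<And>N x. P N x \<in> D"
    "\<And>N. bounded_linear (\<lambda>x. A (P N x))"
    "\<And>N x. norm (x - P N x) \<le> norm x" "\<And>x. decseq (\<lambda>N. norm (x - P N x))" "\<And>x. (\<lambda>N. P N x) \<longlonglongrightarrow> x"
proof -
  have D: "subspace D" and add: "\<And>x y. x \<in> D \<Longrightarrow> y \<in> D \<Longrightarrow> A (x + y) = A x + A y"
    and scl: "\<And>c x. x \<in> D \<Longrightarrow> A (c *\<^sub>R x) = c *\<^sub>R A x" and dense: "closure D = UNIV"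
    using A by (auto simp: closed_densely_defined_def)
  have A0: "A 0 = 0" using scl[OF subspace_0[OF D], of 0] by simp
  obtain S where S: "countable S" "S \<subseteq> D" "D \<subseteq> closure S" using separable by blast
  have Sne: "S \<noteq> {}" using S(3) subspace_0[OF D] by auto
  have Sd: "closure S = UNIV" using S(3) dense closure_minimal[OF S(3)] by auto
  define d where "d = from_nat_into S"
  have d: "range d = S" unfolding d_def by (rule range_from_nat_into[OF Sne S(1)])
  have "\<exists>C. finite C \<and> span C = span (d ` {..<N}) \<and> pairwise orthogonal C" for N
    using basis_orthogonal[of "d ` {..<N}"] by blast
  then obtain C where C: "\<And>N. finite (C N)" "\<And>N. span (C N) = span (d ` {..<N})"
    "\<And>N. pairwise orthogonal (C N)" by metis
  \<comment> \<open>The vectors in \<open>C N\<close> are orthogonal but not normalised. A zero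
    vector among them is harmless: its summand vanishes.\<close>
  define P where "P N x = (\<Sum>c\<in>C N. (inner x c / inner c c) *\<^sub>R c)" for N x
  have spanD: "span (C N) \<subseteq> D" for N
    using S(2) d D by (simp add: C(2)) (intro span_minimal, auto)
  have CD: "c \<in> D" if "c \<in> C N" for c N using spanD span_base that by blast
  have Pspan: "P N x \<in> span (C N)" for N x
    unfolding P_def by (intro span_sum span_scale span_base)
  have PD: "P N x \<in> D" for N x using Pspan spanD by blast
  have bl: "bounded_linear (P N)" for N unfolding P_def
    by (intro bounded_linear_sum bounded_linear_scaleR_left[THEN bounded_linear_compose]
        bounded_linear_divide[THEN bounded_linear_compose] bounded_linear_inner_left)
  have AP: "A (P N x) = (\<Sum>c\<in>C N. (inner x c / inner c c) *\<^sub>R A c)" for N x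
  proof -
    have "A (\<Sum>c\<in>F. (inner x c / inner c c) *\<^sub>R c) = (\<Sum>c\<in>F. (inner x c / inner c c) *\<^sub>R A c)
        \<and> (\<Sum>c\<in>F. (inner x c / inner c c) *\<^sub>R c) \<in> D" if "finite F" "F \<subseteq> C N" for F
      using that
    proof (induction F)
      case (insert c F)
      then show ?case using CD[of c N] D by (auto simp: add scl subspace_add subspace_scale)
    qed (simp add: A0 subspace_0[OF D])
    then show ?thesis using C(1) by (simp add: P_def)
  qed
  have blA: "bounded_linear (\<lambda>x. A (P N x))" for N unfolding AP
    by (intro bounded_linear_sum bounded_linear_scaleR_left[THEN bounded_linear_compose]
        bounded_linear_divide[THEN bounded_linear_compose] bounded_linear_inner_left)
  have orthC: "orthogonal (x - P N x) c" if "c \<in> C N" for x N c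
  proof -
    have "inner (P N x) c = (\<Sum>c'\<in>C N. if c' = c then inner x c else 0)"
      unfolding P_def inner_sum_left
      using C(3)[of N] that
      by (intro sum.cong) (auto simp: pairwise_def orthogonal_def)
    also have "\<dots> = inner x c" using that C(1) by simp
    finally show ?thesis by (simp add: orthogonal_def inner_diff)
  qed
  have best: "norm (x - P N x) \<le> norm (x - y)" if y: "y \<in> span (C N)" for x y N
  proof -
    have "P N x - y \<in> span (C N)" using Pspan y by (rule span_diff)
    then have "orthogonal (x - P N x) (P N x - y)" by (rule orthogonal_to_span) (rule orthC)
    then have "(norm ((x - P N x) + (P N x - y)))\<^sup>2 = (norm (x - P N x))\<^sup>2 + (norm (P N x - y))\<^sup>2"
      by (rule norm_add_Pythagorean)
    then have "(norm (x - P N x))\<^sup>2 \<le> (norm (x - y))\<^sup>2" by simp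
    then show ?thesis by (rule power2_le_imp_le) simp
  qed
  have dec: "decseq (\<lambda>N. norm (x - P N x))" for x
  proof (rule decseq_SucI)
    fix N
    have "span (C N) \<subseteq> span (C (Suc N))" unfolding C(2) by (intro span_mono) auto
    then show "norm (x - P (Suc N) x) \<le> norm (x - P N x)" using Pspan by (intro best) blast
  qed
  have lim: "(\<lambda>N. P N x) \<longlonglongrightarrow> x" for x
  proof (rule metric_LIMSEQ_I)
    fix e :: real assume "e > 0"
    then obtain y where "y \<in> S" "dist y x < e"
      using closure_approachable[of x S] Sd by auto
    then obtain n where n: "dist (d n) x < e" using d by blast
    have "dist (P N x) x < e" if "N \<ge> Suc n" for N
    proof -
      have "d n \<in> span (C N)" unfolding C(2) using that by (intro span_base) auto
      from best[OF this, of x] n show ?thesis by (simp add: dist_norm norm_minus_commute)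
    qed
    then show "\<exists>no. \<forall>n\<ge>no. dist (P n x) x < e" by blast
  qed
  have contr: "norm (x - P N x) \<le> norm x" for N x using best[OF span_zero, of x N] by simp
  show ?thesis by (rule that[OF bl PD blA contr dec lim])
qed

text \<open>The vector \<open>y\<close> is the adjoint of \<open>R s\<close> applied to
  \<open>\<xi>\<close>. It is again an admissible test vector because \<open>R s\<close> commutes
  with \<open>A\<close> on \<open>D\<close>, so that the two adjoints commute on
  \<open>\<xi>\<close> as well.\<close>

lemma resolvent_adjoint:
  assumes A: "closed_densely_defined D A" and R: "resolvent_family D A a R"
    and s: "0 \<le> s" and \<xi>: "\<xi> \<in> adj_dom D A"
  obtains y where "y \<in> adj_dom D A" "\<And>x. inner x y = inner (R s x) \<xi>"
    "\<And>x. inner x (adj_op D A y) = inner (R s x) (adj_op D A \<xi>)"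
proof -
  have bl: "bounded_linear (R s)" and com: "\<And>x. x \<in> D \<Longrightarrow> R s x \<in> D" "\<And>x. x \<in> D \<Longrightarrow> A (R s x) = R s (A x)"
    using R s by (auto simp: resolvent_family_def)
  have ex: "\<exists>y. \<forall>x. inner (R s x) \<zeta> = inner x y" for \<zeta>
    using riesz_representation[OF bounded_linear_compose[OF bounded_linear_inner_left bl]] by metis
  obtain y where y: "\<And>x. inner (R s x) \<xi> = inner x y" using ex by blast
  obtain z where z: "\<And>x. inner (R s x) (adj_op D A \<xi>) = inner x z" using ex by blast
  have "inner (A x) y = inner x z" if "x \<in> D" for x
    using adj_op_inner[OF A \<xi> com(1)[OF that]] that by (simp add: com(2) y z)
  from adj_op_unique[OF A this] show ?thesis using that y z by auto
qed

section \<open>Sums of independent vectors\<close>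

text \<open>The joint law of independent variables is the product of their laws, so Fubini's theorem
  allows the first variable to be frozen while the second is integrated.\<close>

lemma (in prob_space) indep_var_iterated_expectation:
  fixes g :: "'b \<times> 'b \<Rightarrow> real"
  assumes ind: "indep_var N X K Y" and g[measurable]: "g \<in> borel_measurable (N \<Otimes>\<^sub>M K)"
    and int: "integrable M (\<lambda>\<omega>. g (X \<omega>, Y \<omega>))"
  shows "expectation (\<lambda>\<omega>. g (X \<omega>, Y \<omega>)) = expectation (\<lambda>\<omega>. expectation (\<lambda>\<omega>'. g (X \<omega>, Y \<omega>')))"
proof -
  have [measurable]: "random_variable N X" "random_variable K Y"
    using ind by (auto dest: indep_var_rv1 indep_var_rv2)
  have eq: "distr M N X \<Otimes>\<^sub>M distr M K Y = distr M (N \<Otimes>\<^sub>M K) (\<lambda>\<omega>. (X \<omega>, Y \<omega>))"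
    using ind by (simp add: indep_var_distribution_eq)
  interpret X: prob_space "distr M N X" by (rule prob_space_distr) simp
  interpret Y: prob_space "distr M K Y" by (rule prob_space_distr) simp
  interpret XY: pair_prob_space "distr M N X" "distr M K Y" ..
  have int': "integrable (distr M N X \<Otimes>\<^sub>M distr M K Y) g"
    unfolding eq using int by (subst integrable_distr_eq) simp_all
  have "expectation (\<lambda>\<omega>. g (X \<omega>, Y \<omega>)) = (\<integral>p. g p \<partial>(distr M N X \<Otimes>\<^sub>M distr M K Y))"
    unfolding eq by (subst integral_distr) simp_all
  also have "\<dots> = (\<integral>x. (\<integral>y. g (x, y) \<partial>distr M K Y) \<partial>distr M N X)"
    using XY.integral_fst'[OF int'] by simp
  also have "\<dots> = expectation (\<lambda>\<omega>. \<integral>y. g (X \<omega>, y) \<partial>distr M K Y)"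
    by (subst integral_distr) simp_all
  also have "\<dots> = expectation (\<lambda>\<omega>. expectation (\<lambda>\<omega>'. g (X \<omega>, Y \<omega>')))"
    by (intro Bochner_Integration.integral_cong refl integral_distr)
      (auto intro: measurable_compose[OF measurable_Pair1' g] measurable_space[of X M N])
  finally show ?thesis .
qed

lemma (in prob_space) indep_var_partial_sum:
  fixes Y :: "nat \<Rightarrow> 'a \<Rightarrow> 'h::{real_normed_vector,second_countable_topology}"
  assumes "indep_vars (\<lambda>_. borel) Y {..<Suc n}"
  shows "indep_var borel (\<lambda>\<omega>. \<Sum>i<n. Y i \<omega>) borel (Y n)"
proof -
  have "indep_var borel ((\<lambda>f. \<Sum>i<n. f i) \<circ> (\<lambda>\<omega>. restrict (\<lambda>i. Y i \<omega>) {..<n}))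
      borel ((\<lambda>f. f n) \<circ> (\<lambda>\<omega>. restrict (\<lambda>i. Y i \<omega>) {n}))"
    by (intro indep_var_compose[OF indep_var_restrict[OF assms]]) auto
  then show ?thesis by (simp add: comp_def)
qed

text \<open>In the expansion of the square of \<open>a\<^sup>2 + 2 * q + b\<^sup>2\<close>, the term
  \<open>4 * a\<^sup>2 * q\<close> is kept exactly since its mean vanishes for centred
  \<open>y\<close>. All other terms in \<open>y\<close> are dominated by multiples of
  \<open>b\<^sup>2\<close>, so that in the mean only the variance of \<open>y\<close>
  appears.\<close>

lemma norm_add_pow4_le:
  fixes s y :: "'h::real_inner"
  assumes "norm y \<le> c"
  shows "(norm (s + y))^4 \<le> (norm s)^4 + 4 * (norm s)\<^sup>2 * inner s y + (8 * (norm s)\<^sup>2 + 3 * c\<^sup>2) * (norm y)\<^sup>2"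
proof -
  define a b q where "a = norm s" and "b = norm y" and "q = inner s y"
  have nn: "0 \<le> a" "0 \<le> b" "0 \<le> c" "b \<le> c" using assms order_trans[OF norm_ge_zero assms] by (auto simp: a_def b_def)
  have q: "\<bar>q\<bar> \<le> a * b" unfolding q_def a_def b_def by (rule Cauchy_Schwarz_ineq2)
  have "(norm (s + y))\<^sup>2 = a\<^sup>2 + 2 * q + b\<^sup>2"
    by (simp add: a_def b_def q_def power2_norm_eq_inner inner_add inner_commute)
  then have "(norm (s + y))^4 = (a\<^sup>2 + 2 * q + b\<^sup>2)\<^sup>2"
    by (metis (no_types) power_mult numeral_Bit0 mult_2 power2_eq_square power_add)
  also have "\<dots> = a^4 + 4 * a\<^sup>2 * q + 4 * q\<^sup>2 + b\<^sup>2 * b\<^sup>2 + 2 * a\<^sup>2 * b\<^sup>2 + 4 * (q * b\<^sup>2)"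
    by (simp add: power2_eq_square power4_eq_xxxx algebra_simps)
  also have "\<dots> \<le> a^4 + 4 * a\<^sup>2 * q + (8 * a\<^sup>2 + 3 * c\<^sup>2) * b\<^sup>2"
  proof -
    have "q\<^sup>2 \<le> (a * b)\<^sup>2" using q by (simp add: abs_le_square_iff[symmetric] nn)
    then have 1: "q\<^sup>2 \<le> a\<^sup>2 * b\<^sup>2" by (simp add: power_mult_distrib)
    have bc: "b\<^sup>2 \<le> c\<^sup>2" using nn by (simp add: power_mono)
    then have 2: "b\<^sup>2 * b\<^sup>2 \<le> c\<^sup>2 * b\<^sup>2" by (rule mult_right_mono) simp
    have "q \<le> a * c" using q nn mult_left_mono[of b c a] by linarith
    also have "a * c \<le> (a\<^sup>2 + c\<^sup>2) / 2" using sum_squares_bound[of a c] by simp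
    finally have "q * b\<^sup>2 \<le> (a\<^sup>2 + c\<^sup>2) / 2 * b\<^sup>2" by (rule mult_right_mono) simp
    then have 3: "4 * (q * b\<^sup>2) \<le> 2 * (a\<^sup>2 * b\<^sup>2) + 2 * (c\<^sup>2 * b\<^sup>2)" by (simp add: algebra_simps)
    show ?thesis using 1 2 3 by (simp add: algebra_simps)
  qed
  finally show ?thesis by (simp add: a_def b_def q_def)
qed

text \<open>Induction on \<open>n\<close>, freezing the partial sum. The fourth moment bound
  reproduces itself because the new cross term \<open>8 * V * v\<close> is the one in
  \<open>4 * (V + v)\<^sup>2\<close>.\<close>

lemma (in prob_space) indep_sum_moments:
  fixes Y :: "nat \<Rightarrow> 'a \<Rightarrow> 'h::{real_inner,banach,second_countable_topology}"
  assumes "indep_vars (\<lambda>_. borel) Y {..<n}"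
    and "\<And>i \<omega>. i < n \<Longrightarrow> \<omega> \<in> space M \<Longrightarrow> norm (Y i \<omega>) \<le> c"
    and "\<And>i. i < n \<Longrightarrow> expectation (Y i) = 0"
  shows "expectation (\<lambda>\<omega>. (norm (\<Sum>i<n. Y i \<omega>))\<^sup>2) = (\<Sum>i<n. expectation (\<lambda>\<omega>. (norm (Y i \<omega>))\<^sup>2)) \<and>
    expectation (\<lambda>\<omega>. (norm (\<Sum>i<n. Y i \<omega>))^4) \<le> 4 * (\<Sum>i<n. expectation (\<lambda>\<omega>. (norm (Y i \<omega>))\<^sup>2))\<^sup>2
      + 3 * c\<^sup>2 * (\<Sum>i<n. expectation (\<lambda>\<omega>. (norm (Y i \<omega>))\<^sup>2))"
  using assms
proof (induction n)
  case 0
  then show ?case by simp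
next
  case (Suc n)
  define S where "S \<omega> = (\<Sum>i<n. Y i \<omega>)" for \<omega>
  define v where "v = expectation (\<lambda>\<omega>. (norm (Y n \<omega>))\<^sup>2)"
  define V where "V = (\<Sum>i<n. expectation (\<lambda>\<omega>. (norm (Y i \<omega>))\<^sup>2))"
  have IH: "expectation (\<lambda>\<omega>. (norm (S \<omega>))\<^sup>2) = V" "expectation (\<lambda>\<omega>. (norm (S \<omega>))^4) \<le> 4 * V\<^sup>2 + 3 * c\<^sup>2 * V"
    using Suc.IH[OF indep_vars_subset[OF Suc.prems(1)]] Suc.prems(2,3)
    unfolding S_def V_def by (auto simp: less_Suc_eq)
  have ind: "indep_var borel S borel (Y n)"
    unfolding S_def by (rule indep_var_partial_sum[OF Suc.prems(1)])
  have mS[measurable]: "S \<in> borel_measurable M" and mY[measurable]: "Y n \<in> borel_measurable M"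
    using ind by (auto dest: indep_var_rv1 indep_var_rv2)
  have bY: "norm (Y n \<omega>) \<le> c" if "\<omega> \<in> space M" for \<omega> using Suc.prems(2) that by simp
  have bS: "norm (S \<omega>) \<le> real n * c" if "\<omega> \<in> space M" for \<omega>
    unfolding S_def using sum_norm_bound[of "{..<n}" "\<lambda>i. Y i \<omega>" c] Suc.prems(2)[of _ \<omega>] that by simp
  have bSY: "norm (S \<omega> + Y n \<omega>) \<le> real n * c + c" if "\<omega> \<in> space M" for \<omega>
    using bS[OF that] bY[OF that] norm_triangle_ineq[of "S \<omega>" "Y n \<omega>"] by simp
  have bint: "integrable M (\<lambda>\<omega>. (norm (U \<omega>))^k)"
    if "U \<in> borel_measurable M" "\<And>\<omega>. \<omega> \<in> space M \<Longrightarrow> norm (U \<omega>) \<le> B" for U :: "'a \<Rightarrow> 'h" and k and B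
    using that by (intro integrable_const_bound[where B="B^k"]) (auto intro!: power_mono)
  have iY: "integrable M (Y n)" using bY by (intro integrable_const_bound[where B=c]) auto
  note [simp] = bint[OF mS bS] bint[OF mY bY]
  have iq: "integrable M (\<lambda>\<omega>. inner s (Y n \<omega>))" for s using iY by simp
  have Eq: "expectation (\<lambda>\<omega>. inner s (Y n \<omega>)) = 0" for s
    using iY Suc.prems(3)[of n] by simp
  have s2: "expectation (\<lambda>\<omega>. (norm (s + Y n \<omega>))\<^sup>2) = (norm s)\<^sup>2 + v" for s
  proof -
    have "expectation (\<lambda>\<omega>. (norm (s + Y n \<omega>))\<^sup>2)
        = expectation (\<lambda>\<omega>. (norm s)\<^sup>2 + 2 * inner s (Y n \<omega>) + (norm (Y n \<omega>))\<^sup>2)"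
      by (intro Bochner_Integration.integral_cong refl)
        (simp add: power2_norm_eq_inner inner_add inner_commute)
    also have "\<dots> = (norm s)\<^sup>2 + v" using iq Eq by (simp add: v_def prob_space)
    finally show ?thesis .
  qed
  have s4: "expectation (\<lambda>\<omega>. (norm (s + Y n \<omega>))^4) \<le> (norm s)^4 + (8 * (norm s)\<^sup>2 + 3 * c\<^sup>2) * v" for s
  proof -
    have "norm (s + Y n \<omega>) \<le> norm s + c" if "\<omega> \<in> space M" for \<omega>
      using bY[OF that] norm_triangle_ineq[of s "Y n \<omega>"] by simp
    then have i4: "integrable M (\<lambda>\<omega>. (norm (s + Y n \<omega>))^4)"
      by (intro bint[of _ "norm s + c"]) auto
    have "expectation (\<lambda>\<omega>. (norm (s + Y n \<omega>))^4)
        \<le> expectation (\<lambda>\<omega>. (norm s)^4 + 4 * (norm s)\<^sup>2 * inner s (Y n \<omega>)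
            + (8 * (norm s)\<^sup>2 + 3 * c\<^sup>2) * (norm (Y n \<omega>))\<^sup>2)"
      using iq bY by (intro integral_mono[OF i4] norm_add_pow4_le) simp_all
    also have "\<dots> = (norm s)^4 + (8 * (norm s)\<^sup>2 + 3 * c\<^sup>2) * v"
      using iq Eq by (simp add: v_def prob_space)
    finally show ?thesis .
  qed
  \<comment> \<open>Independence enters here: the estimates \<open>s2\<close> and \<open>s4\<close>
    for a constant \<open>s\<close> are integrated over the law of \<open>S\<close>.\<close>
  have iter: "expectation (\<lambda>\<omega>. (norm (S \<omega> + Y n \<omega>))^k) = expectation (\<lambda>\<omega>. expectation (\<lambda>\<omega>'. (norm (S \<omega> + Y n \<omega>'))^k))" for k
    using indep_var_iterated_expectation[OF ind, of "\<lambda>(s, y). (norm (s + y))^k"]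
      bint[OF borel_measurable_add[OF mS mY] bSY] by simp
  have sum: "(\<Sum>i<Suc n. Y i \<omega>) = S \<omega> + Y n \<omega>" for \<omega> by (simp add: S_def)
  have V': "(\<Sum>i<Suc n. expectation (\<lambda>\<omega>. (norm (Y i \<omega>))\<^sup>2)) = V + v" by (simp add: V_def v_def)
  have 2: "expectation (\<lambda>\<omega>. (norm (S \<omega> + Y n \<omega>))\<^sup>2) = V + v"
    unfolding iter s2 using IH(1) by (simp add: prob_space)
  have "expectation (\<lambda>\<omega>. (norm (S \<omega> + Y n \<omega>))^4)
      \<le> expectation (\<lambda>\<omega>. (norm (S \<omega>))^4 + (8 * (norm (S \<omega>))\<^sup>2 + 3 * c\<^sup>2) * v)"
    unfolding iter
  proof (rule integral_mono)
    show "integrable M (\<lambda>\<omega>. expectation (\<lambda>\<omega>'. (norm (S \<omega> + Y n \<omega>'))^4))"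
    proof (rule integrable_const_bound[where B="(real n * c + c)^4"])
      show "AE \<omega> in M. norm (expectation (\<lambda>\<omega>'. (norm (S \<omega> + Y n \<omega>'))^4)) \<le> (real n * c + c)^4"
      proof (rule AE_I2)
        fix \<omega> assume \<omega>: "\<omega> \<in> space M"
        have *: "norm (S \<omega> + Y n \<omega>') \<le> real n * c + c" if "\<omega>' \<in> space M" for \<omega>'
          using bS[OF \<omega>] bY[OF that] norm_triangle_ineq[of "S \<omega>" "Y n \<omega>'"] by simp
        have "expectation (\<lambda>\<omega>'. (norm (S \<omega> + Y n \<omega>'))^4) \<le> expectation (\<lambda>\<omega>'. (real n * c + c)^4)"
          using * by (intro integral_mono[OF bint[of _ "real n * c + c"]] power_mono) auto
        then show "norm (expectation (\<lambda>\<omega>'. (norm (S \<omega> + Y n \<omega>'))^4)) \<le> (real n * c + c)^4"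
          by (simp add: prob_space)
      qed
    qed simp
    show "integrable M (\<lambda>\<omega>. (norm (S \<omega>))^4 + (8 * (norm (S \<omega>))\<^sup>2 + 3 * c\<^sup>2) * v)"
      by simp
  qed (rule s4)
  also have "\<dots> = expectation (\<lambda>\<omega>. (norm (S \<omega>))^4) + (8 * V + 3 * c\<^sup>2) * v"
    using IH(1) by (simp add: prob_space)
  also have "\<dots> \<le> 4 * V\<^sup>2 + 3 * c\<^sup>2 * V + (8 * V + 3 * c\<^sup>2) * v" using IH(2) by simp
  also have "\<dots> \<le> 4 * (V + v)\<^sup>2 + 3 * c\<^sup>2 * (V + v)" by (simp add: power2_eq_square algebra_simps)
  finally show ?case unfolding sum V' using 2 by blast
qed

lemma norm_add_pow4_le_8:
  fixes x y :: "'h::real_normed_vector"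
  shows "(norm (x + y))^4 \<le> 8 * ((norm x)^4 + (norm y)^4)"
proof -
  define a b where "a = norm x" and "b = norm y"
  have "(norm (x + y))^4 \<le> (a + b)^4"
    unfolding a_def b_def by (intro power_mono norm_triangle_ineq) simp
  also have "(a + b)^4 = ((a + b)\<^sup>2)\<^sup>2" by (simp flip: power_mult)
  also have "\<dots> \<le> (2 * (a\<^sup>2 + b\<^sup>2))\<^sup>2"
    using sum_squares_bound[of a b] by (intro power_mono) (simp_all add: power2_sum a_def b_def)
  also have "\<dots> \<le> 8 * (a^4 + b^4)"
    using sum_squares_bound[of "a\<^sup>2" "b\<^sup>2"] by (simp add: power2_eq_square power4_eq_xxxx algebra_simps)
  finally show ?thesis by (simp add: a_def b_def)
qed

lemma (in prob_space) centred_norm_le: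
  fixes Y :: "'a \<Rightarrow> 'h::{real_inner,banach,second_countable_topology}"
  assumes [measurable]: "Y \<in> borel_measurable M" and b: "\<And>\<omega>. \<omega> \<in> space M \<Longrightarrow> norm (Y \<omega>) \<le> c"
  shows "integrable M Y" "norm (expectation Y) \<le> c"
    "\<And>\<omega>. \<omega> \<in> space M \<Longrightarrow> norm (Y \<omega> - expectation Y) \<le> 2 * c"
    "expectation (\<lambda>\<omega>. Y \<omega> - expectation Y) = 0"
proof -
  show i: "integrable M Y" using b by (intro integrable_const_bound[where B=c]) auto
  have "norm (expectation Y) \<le> expectation (\<lambda>\<omega>. norm (Y \<omega>))" by (rule integral_norm_bound)
  also have "\<dots> \<le> expectation (\<lambda>_. c)" using i b by (intro integral_mono) auto
  finally show n: "norm (expectation Y) \<le> c" by (simp add: prob_space)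
  show "norm (Y \<omega> - expectation Y) \<le> 2 * c" if "\<omega> \<in> space M" for \<omega>
    using b[OF that] n norm_triangle_ineq4[of "Y \<omega>" "expectation Y"] by simp
  show "expectation (\<lambda>\<omega>. Y \<omega> - expectation Y) = 0" using i by (simp add: prob_space)
qed

text \<open>A converse to Chebyshev's inequality, in the style of Paley and Zygmund: the fourth moment bounds
  the contribution of the exceptional event to the second moment.\<close>

lemma (in prob_space) indep_sum_second_moment_le:
  fixes Y :: "nat \<Rightarrow> 'a \<Rightarrow> 'h::{real_inner,banach,second_countable_topology}"
  assumes ind: "indep_vars (\<lambda>_. borel) Y {..<n}"
    and b: "\<And>i \<omega>. i < n \<Longrightarrow> \<omega> \<in> space M \<Longrightarrow> norm (Y i \<omega>) \<le> c"
    and c: "c > 0"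
    and A: "A \<in> events" "prob A \<le> 1 / 1280"
    and S: "\<And>\<omega>. \<omega> \<in> space M - A \<Longrightarrow> norm (\<Sum>i<n. Y i \<omega>) \<le> c"
  shows "(\<Sum>i<n. expectation (\<lambda>\<omega>. (norm (Y i \<omega> - expectation (Y i)))\<^sup>2))
    + (norm (\<Sum>i<n. expectation (Y i)))\<^sup>2 \<le> 2 * c\<^sup>2"
proof -
  define G where "G i \<omega> = Y i \<omega> - expectation (Y i)" for i \<omega>
  define H where "H \<omega> = (\<Sum>i<n. G i \<omega>)" for \<omega>
  define \<mu> where "\<mu> = (\<Sum>i<n. expectation (Y i))"
  define V where "V = (\<Sum>i<n. expectation (\<lambda>\<omega>. (norm (G i \<omega>))\<^sup>2))"
  define U where "U = V + (norm \<mu>)\<^sup>2"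
  \<comment> \<open>\<open>U\<close> is the second moment of the sum of the \<open>Y i\<close>, as
    \<open>E2\<close> shows. Adding \<open>c\<^sup>2\<close> lets \<open>80 * L\<^sup>2\<close>
    absorb the mixed term \<open>96 * c\<^sup>2 * V\<close> of the fourth moment, and makes
    \<open>L\<close> positive.\<close>
  define L where "L = U + c\<^sup>2"
  have mY: "Y i \<in> borel_measurable M" if "i < n" for i using ind that by (auto simp: indep_vars_def)
  have bG: "norm (G i \<omega>) \<le> 2 * c" if "i < n" "\<omega> \<in> space M" for i \<omega>
    unfolding G_def using centred_norm_le(3)[OF mY b] that by auto
  have EG: "expectation (G i) = 0" if "i < n" for i
    unfolding G_def using centred_norm_le(4)[OF mY b] that by auto
  have indG: "indep_vars (\<lambda>_. borel) G {..<n}"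
    unfolding G_def by (rule indep_vars_compose2[OF ind]) simp
  have mG[measurable]: "G i \<in> borel_measurable M" if "i < n" for i
    using indG that by (auto simp: indep_vars_def)
  have mH[measurable]: "H \<in> borel_measurable M" unfolding H_def by (intro borel_measurable_sum mG) auto
  have mom: "expectation (\<lambda>\<omega>. (norm (H \<omega>))\<^sup>2) = V" "expectation (\<lambda>\<omega>. (norm (H \<omega>))^4) \<le> 4 * V\<^sup>2 + 12 * c\<^sup>2 * V"
    using indep_sum_moments[OF indG bG EG] unfolding H_def V_def by (auto simp: power_mult_distrib)
  have bH: "norm (H \<omega>) \<le> real n * (2 * c)" if "\<omega> \<in> space M" for \<omega>
    unfolding H_def using sum_norm_bound[of "{..<n}" "\<lambda>i. G i \<omega>" "2 * c"] bG[of _ \<omega>] that by simp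
  have iH: "integrable M (\<lambda>\<omega>. (norm (H \<omega>))^k)" for k
    using bH by (intro integrable_const_bound[where B="(real n * (2 * c))^k"]) (auto intro!: power_mono)
  have iH1: "integrable M H" using bH by (intro integrable_const_bound[where B="real n * (2 * c)"]) auto
  have iG: "integrable M (G i)" if "i < n" for i
    using bG that by (intro integrable_const_bound[where B="2*c"]) auto
  have EH: "expectation H = 0" unfolding H_def using iG EG by (subst Bochner_Integration.integral_sum) auto
  have SH: "(\<Sum>i<n. Y i \<omega>) = H \<omega> + \<mu>" for \<omega>
    by (simp add: H_def G_def \<mu>_def sum_subtractf)
  have eq2: "(norm (H \<omega> + \<mu>))\<^sup>2 = (norm (H \<omega>))\<^sup>2 + 2 * inner (H \<omega>) \<mu> + (norm \<mu>)\<^sup>2" for \<omega>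
    by (simp add: power2_norm_eq_inner inner_add inner_commute)
  have i2: "integrable M (\<lambda>\<omega>. (norm (H \<omega> + \<mu>))\<^sup>2)" unfolding eq2 using iH iH1 by simp
  have E2: "expectation (\<lambda>\<omega>. (norm (H \<omega> + \<mu>))\<^sup>2) = U"
    unfolding eq2 U_def using iH iH1 EH mom(1) by (simp add: prob_space)
  have V0: "V \<ge> 0" unfolding V_def by (intro sum_nonneg) simp
  have L0: "L > 0" using V0 c by (simp add: L_def U_def add_nonneg_pos)
  have "norm (H \<omega> + \<mu>) \<le> real n * (2 * c) + norm \<mu>" if "\<omega> \<in> space M" for \<omega>
    using bH[OF that] norm_triangle_ineq[of "H \<omega>" \<mu>] by simp
  then have i4: "integrable M (\<lambda>\<omega>. (norm (H \<omega> + \<mu>))^4)"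
    by (intro integrable_const_bound[where B="(real n * (2 * c) + norm \<mu>)^4"]) (auto intro!: power_mono)
  have "expectation (\<lambda>\<omega>. (norm (H \<omega> + \<mu>))^4) \<le> expectation (\<lambda>\<omega>. 8 * ((norm (H \<omega>))^4 + (norm \<mu>)^4))"
    using iH by (intro integral_mono[OF i4] norm_add_pow4_le_8) simp
  also have "\<dots> = 8 * (expectation (\<lambda>\<omega>. (norm (H \<omega>))^4) + (norm \<mu>)^4)"
    using iH by (simp add: prob_space)
  also have "\<dots> \<le> 80 * L\<^sup>2"
  proof -
    define m where "m = (norm \<mu>)\<^sup>2"
    have "(norm \<mu>)^4 = m\<^sup>2" by (simp add: m_def flip: power_mult)
    then have "8 * (expectation (\<lambda>\<omega>. (norm (H \<omega>))^4) + (norm \<mu>)^4) \<le> 32 * V\<^sup>2 + 96 * c\<^sup>2 * V + 8 * m\<^sup>2"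
      using mom(2) by simp
    also have "\<dots> \<le> 80 * (V + m + c\<^sup>2)\<^sup>2"
    proof -
      have "0 \<le> V * m" "0 \<le> V * c\<^sup>2" "0 \<le> m * c\<^sup>2" "0 \<le> c\<^sup>2 * c\<^sup>2" "0 \<le> V * V" "0 \<le> m * m"
        using V0 by (auto simp: m_def)
      moreover have "(V + m + c\<^sup>2)\<^sup>2 = V * V + m * m + c\<^sup>2 * c\<^sup>2 + 2 * (V * m) + 2 * (V * c\<^sup>2) + 2 * (m * c\<^sup>2)"
        by (simp add: power2_eq_square algebra_simps)
      moreover have "V\<^sup>2 = V * V" "m\<^sup>2 = m * m" "96 * c\<^sup>2 * V = 96 * (V * c\<^sup>2)" by (simp_all add: power2_eq_square)
      ultimately show ?thesis by linarith
    qed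
    finally show ?thesis by (simp add: L_def U_def m_def)
  qed
  finally have E4: "expectation (\<lambda>\<omega>. (norm (H \<omega> + \<mu>))^4) \<le> 80 * L\<^sup>2" .
  have iA: "integrable M (indicator A :: 'a \<Rightarrow> real)"
    using A(1) by (intro integrable_const_bound[where B=1]) auto
  \<comment> \<open>Outside \<open>A\<close> the squared norm is at most \<open>c\<^sup>2\<close>.
    On \<open>A\<close> the inequality \<open>x \<le> x\<^sup>2 / (640 * L) + 160 * L\<close> is
    used; its two terms contribute \<open>80 / 640\<close> and \<open>160 / 1280\<close> of
    \<open>L\<close>, that is \<open>L / 8\<close> each. With \<open>L = U + c\<^sup>2\<close> this
    bounds \<open>U\<close> by \<open>5 / 3\<close> of \<open>c\<^sup>2\<close>.\<close>
  have "U \<le> expectation (\<lambda>\<omega>. c\<^sup>2 + (norm (H \<omega> + \<mu>))^4 / (640 * L) + 160 * L * indicator A \<omega>)"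
    unfolding E2[symmetric]
  proof (rule integral_mono[OF i2])
    show "integrable M (\<lambda>\<omega>. c\<^sup>2 + (norm (H \<omega> + \<mu>))^4 / (640 * L) + 160 * L * indicator A \<omega>)"
      using i4 iA by simp
    fix \<omega> assume \<omega>: "\<omega> \<in> space M"
    define x where "x = (norm (H \<omega> + \<mu>))\<^sup>2"
    have x4: "(norm (H \<omega> + \<mu>))^4 = x\<^sup>2" by (simp add: x_def flip: power_mult)
    show "(norm (H \<omega> + \<mu>))\<^sup>2 \<le> c\<^sup>2 + (norm (H \<omega> + \<mu>))^4 / (640 * L) + 160 * L * indicator A \<omega>"
    proof (cases "\<omega> \<in> A")
      case True
      have "x \<le> x\<^sup>2 / (640 * L) + 160 * L"
      proof -
        have "x\<^sup>2 / (640 * L) + 160 * L - x = (x - 320 * L)\<^sup>2 / (640 * L)"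
          using L0 by (simp add: field_simps power2_eq_square)
        also have "\<dots> \<ge> 0" using L0 by simp
        finally show ?thesis by simp
      qed
      then show ?thesis unfolding x4 x_def[symmetric] using True by (simp add: add.assoc add_increasing)
    next
      case False
      then have "norm (H \<omega> + \<mu>) \<le> c" using S[of \<omega>] \<omega> SH by simp
      then have "(norm (H \<omega> + \<mu>))\<^sup>2 \<le> c\<^sup>2" by (rule power_mono) simp
      moreover have "0 \<le> (norm (H \<omega> + \<mu>))^4 / (640 * L)" using L0 by simp
      ultimately show ?thesis using False by simp
    qed
  qed
  also have "\<dots> = c\<^sup>2 + expectation (\<lambda>\<omega>. (norm (H \<omega> + \<mu>))^4) / (640 * L) + 160 * L * prob A"
    using i4 iA A(1) by (simp add: prob_space)
  also have "\<dots> \<le> c\<^sup>2 + L / 8 + L / 8"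
  proof -
    have "expectation (\<lambda>\<omega>. (norm (H \<omega> + \<mu>))^4) / (640 * L) \<le> 80 * L\<^sup>2 / (640 * L)"
      using E4 L0 by (intro divide_right_mono) auto
    also have "\<dots> = L / 8" using L0 by (simp add: power2_eq_square)
    finally have "expectation (\<lambda>\<omega>. (norm (H \<omega> + \<mu>))^4) / (640 * L) \<le> L / 8" .
    moreover have "160 * L * prob A \<le> 160 * L * (1 / 1280)" using A(2) L0 by (intro mult_left_mono) auto
    ultimately show ?thesis by simp
  qed
  finally have "U \<le> c\<^sup>2 + L / 8 + L / 8" .
  moreover have "U \<le> 2 * k" if "0 \<le> k" "U \<le> k + (U + k) / 8 + (U + k) / 8" for k using that by argo
  ultimately have "U \<le> 2 * c\<^sup>2" by (simp add: L_def)
  then show ?thesis by (simp add: U_def V_def G_def \<mu>_def)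
qed

section \<open>Truncated increments of processes with stationary independent increments\<close>

definition stationary_indep_increments ::
  "'w measure \<Rightarrow> (real \<Rightarrow> 'w \<Rightarrow> 'h::{real_normed_vector,second_countable_topology}) \<Rightarrow> bool" where
  "stationary_indep_increments M W \<longleftrightarrow>
     (\<forall>t\<ge>0. W t \<in> borel_measurable M) \<and>
     (\<forall>\<omega>\<in>space M. W 0 \<omega> = 0) \<and>
     (\<forall>(n::nat) (ts::nat \<Rightarrow> real). 0 \<le> ts 0 \<and> (\<forall>i<n. ts i < ts (Suc i)) \<longrightarrow>
         prob_space.indep_vars M (\<lambda>_. borel) (\<lambda>i \<omega>. W (ts (Suc i)) \<omega> - W (ts i) \<omega>) {..<n}) \<and>
     (\<forall>s t. 0 \<le> s \<and> s \<le> t \<longrightarrow>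
         distr M borel (\<lambda>\<omega>. W t \<omega> - W s \<omega>) = distr M borel (W (t - s)))"

text \<open>Large values are replaced by zero instead of being projected to the ball: the truncation
  only has to be bounded and inactive on small vectors.\<close>

definition norm_trunc :: "real \<Rightarrow> 'h::real_normed_vector \<Rightarrow> 'h" where
  "norm_trunc c x = (if norm x \<le> c then x else 0)"

lemma norm_norm_trunc_le: "0 \<le> c \<Longrightarrow> norm (norm_trunc c x) \<le> c"
  by (simp add: norm_trunc_def)

lemma borel_measurable_norm_trunc[measurable]:
  "norm_trunc c \<in> borel_measurable (borel :: 'h::{real_normed_vector,second_countable_topology} measure)"
  unfolding norm_trunc_def[abs_def] by measurable

lemma tagged_partition_points:
  assumes "tagged_partition t \<delta> n p s"
  shows "j \<le> k \<Longrightarrow> k \<le> n \<Longrightarrow> p j \<le> p k" "k \<le> n \<Longrightarrow> p k \<in> {0..t}" "i \<in> {1..n} \<Longrightarrow> s i \<in> {0..t}"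
proof -
  have step: "p (i - 1) < p i \<and> p (i - 1) \<le> s i \<and> s i \<le> p i" if "i \<in> {1..n}" for i
    using assms that by (auto simp: tagged_partition_def)
  have p0: "p 0 = 0" "p n = t" using assms by (auto simp: tagged_partition_def)
  show mono: "j \<le> k \<Longrightarrow> k \<le> n \<Longrightarrow> p j \<le> p k" for j k
  proof (induction k)
    case (Suc k)
    then show ?case using step[of "Suc k"] by (cases "j = Suc k") auto
  qed simp
  show range: "p k \<in> {0..t}" if "k \<le> n" for k using mono[of 0 k] mono[of k n] that p0 by auto
  show "s i \<in> {0..t}" if i: "i \<in> {1..n}"
  proof -
    have "i - 1 \<le> n" "i \<le> n" using i by auto
    then show ?thesis using step[OF i] range[of "i - 1"] range[of i] by auto
  qed
qed

context prob_space
begin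

definition trunc_mean :: "(real \<Rightarrow> 'a \<Rightarrow> 'h::{real_inner,banach,second_countable_topology}) \<Rightarrow> real \<Rightarrow> real \<Rightarrow> 'h" where
  "trunc_mean W c h = expectation (\<lambda>\<omega>. norm_trunc c (W h \<omega>))"

definition trunc_var :: "(real \<Rightarrow> 'a \<Rightarrow> 'h::{real_inner,banach,second_countable_topology}) \<Rightarrow> real \<Rightarrow> real \<Rightarrow> real" where
  "trunc_var W c h = expectation (\<lambda>\<omega>. (norm (norm_trunc c (W h \<omega>) - trunc_mean W c h))\<^sup>2)"

lemma expectation_increment:
  fixes W :: "real \<Rightarrow> 'a \<Rightarrow> 'h::{real_normed_vector,second_countable_topology}"
    and g :: "'h \<Rightarrow> 'k::{banach,second_countable_topology}"
  assumes W: "stationary_indep_increments M W" and "0 \<le> s" "s \<le> t" and [measurable]: "g \<in> borel_measurable borel"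
  shows "expectation (\<lambda>\<omega>. g (W t \<omega> - W s \<omega>)) = expectation (\<lambda>\<omega>. g (W (t - s) \<omega>))"
proof -
  have [measurable]: "W t \<in> borel_measurable M" "W s \<in> borel_measurable M" "W (t - s) \<in> borel_measurable M"
    using assms by (auto simp: stationary_indep_increments_def)
  have "expectation (\<lambda>\<omega>. g (W t \<omega> - W s \<omega>)) = integral\<^sup>L (distr M borel (\<lambda>\<omega>. W t \<omega> - W s \<omega>)) g"
    by (subst integral_distr) simp_all
  also have "\<dots> = integral\<^sup>L (distr M borel (W (t - s))) g"
    using assms by (simp add: stationary_indep_increments_def)
  also have "\<dots> = expectation (\<lambda>\<omega>. g (W (t - s) \<omega>))" by (subst integral_distr) simp_all
  finally show ?thesis .
qed

text \<open>Divide \<open>[0, t]\<close> into about \<open>t / h\<close> blocks of length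
  \<open>h\<close>. Off \<open>A\<close> an increment is at most \<open>2 * \<epsilon>\<close>, so
  truncation changes nothing and the truncated increments telescope to a value of \<open>W\<close>.
  The bound for sums of independent vectors controls \<open>n\<close> times the variance and the
  square of \<open>n\<close> times the mean; since all blocks have the same law, each moment is of
  order \<open>1 / n\<close>, hence linear in \<open>h\<close>.\<close>

lemma trunc_moments_linear:
  fixes W :: "real \<Rightarrow> 'a \<Rightarrow> 'h::{real_inner,banach,second_countable_topology}"
  assumes W: "stationary_indep_increments M W"
    and t: "0 < h" "h \<le> t" and \<epsilon>: "0 < \<epsilon>"
    and A: "A \<in> events" "prob A \<le> 1 / 1280"
    and small: "\<And>\<omega> s. \<omega> \<in> space M - A \<Longrightarrow> s \<in> {0..t} \<Longrightarrow> norm (W s \<omega>) \<le> \<epsilon>"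
  shows "trunc_var W (2 * \<epsilon>) h \<le> 16 * \<epsilon>\<^sup>2 * h / t" "norm (trunc_mean W (2 * \<epsilon>) h) \<le> 6 * \<epsilon> * h / t"
proof -
  define n where "n = nat \<lfloor>t / h\<rfloor>"
  define c where "c = 2 * \<epsilon>"
  have q: "1 \<le> t / h" using t by simp
  then have fl: "1 \<le> \<lfloor>t / h\<rfloor>" by linarith
  then have rn: "real n = of_int \<lfloor>t / h\<rfloor>" by (simp add: n_def)
  have n1: "real n \<ge> 1" using fl rn by linarith
  have nle: "real n * h \<le> t"
  proof -
    have "real n \<le> t / h" unfolding rn by (rule of_int_floor_le)
    then show ?thesis using t by (simp add: pos_le_divide_eq)
  qed
  \<comment> \<open>Rounding down at most halves a number that is at least 1.\<close>
  have "t / h < 2 * real n" using n1 rn by linarith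
  then have nge: "1 / real n \<le> 2 * h / t" using t n1 by (simp add: field_simps)
  define Y where "Y i \<omega> = norm_trunc c (W (real (Suc i) * h) \<omega> - W (real i * h) \<omega>)" for i \<omega>
  have ind0: "indep_vars (\<lambda>_. borel) (\<lambda>i \<omega>. W (real (Suc i) * h) \<omega> - W (real i * h) \<omega>) {..<n}"
    using W t by (auto simp: stationary_indep_increments_def elim!: allE[of _ n] allE[of _ "\<lambda>i. real i * h"])
  have ind: "indep_vars (\<lambda>_. borel) Y {..<n}"
    unfolding Y_def by (rule indep_vars_compose2[OF ind0]) measurable
  have diff: "real (Suc i) * h - real i * h = h" for i by (simp add: algebra_simps)
  have EY: "expectation (Y i) = trunc_mean W c h" for i
    unfolding Y_def trunc_mean_def
    using expectation_increment[OF W, of "real i * h" "real (Suc i) * h" "norm_trunc c"] t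
    unfolding diff by (simp add: mult_right_mono)
  have VY: "expectation (\<lambda>\<omega>. (norm (Y i \<omega> - trunc_mean W c h))\<^sup>2) = trunc_var W c h" for i
    unfolding Y_def trunc_var_def
    using expectation_increment[OF W, of "real i * h" "real (Suc i) * h"
        "\<lambda>x. (norm (norm_trunc c x - trunc_mean W c h))\<^sup>2"] t
    unfolding diff by (simp add: mult_right_mono)
  have "(\<Sum>i<n. expectation (\<lambda>\<omega>. (norm (Y i \<omega> - expectation (Y i)))\<^sup>2))
    + (norm (\<Sum>i<n. expectation (Y i)))\<^sup>2 \<le> 2 * c\<^sup>2"
  proof (rule indep_sum_second_moment_le[OF ind _ _ A])
    show "norm (Y i \<omega>) \<le> c" for i \<omega> using \<epsilon> by (simp add: Y_def c_def norm_norm_trunc_le)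
    show "c > 0" using \<epsilon> by (simp add: c_def)
    fix \<omega> assume \<omega>: "\<omega> \<in> space M - A"
    have in_int: "real i * h \<in> {0..t}" if "i \<le> n" for i
    proof -
      have "real i * h \<le> real n * h" using that t by (intro mult_right_mono) auto
      then have "real i * h \<le> t" using nle by (rule order_trans)
      then show ?thesis using t by simp
    qed
    have "Y i \<omega> = W (real (Suc i) * h) \<omega> - W (real i * h) \<omega>" if "i < n" for i
      using small[OF \<omega> in_int[of i]] small[OF \<omega> in_int[of "Suc i"]] that
        norm_triangle_ineq4[of "W (real (Suc i) * h) \<omega>" "W (real i * h) \<omega>"]
      by (simp add: Y_def norm_trunc_def c_def)
    then have "(\<Sum>i<n. Y i \<omega>) = (\<Sum>i<n. W (real (Suc i) * h) \<omega> - W (real i * h) \<omega>)" by simp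
    also have "\<dots> = W (real n * h) \<omega> - W 0 \<omega>"
      using sum_lessThan_telescope[of "\<lambda>i. W (real i * h) \<omega>" n] by simp
    also have "\<dots> = W (real n * h) \<omega>" using W \<omega> by (simp add: stationary_indep_increments_def)
    finally show "norm (\<Sum>i<n. Y i \<omega>) \<le> c"
      using small[OF \<omega> in_int[of n]] \<epsilon> by (simp add: c_def)
  qed
  then have main: "real n * trunc_var W c h + (real n * norm (trunc_mean W c h))\<^sup>2 \<le> 8 * \<epsilon>\<^sup>2"
    unfolding EY VY sum_constant_scaleR by (simp add: c_def power_mult_distrib)
  have v0: "0 \<le> trunc_var W c h" unfolding trunc_var_def by simp
  have "real n * trunc_var W c h \<le> 8 * \<epsilon>\<^sup>2"
    using main zero_le_power2[of "real n * norm (trunc_mean W c h)"] by linarith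
  then have "trunc_var W c h \<le> 8 * \<epsilon>\<^sup>2 * (1 / real n)" using n1 by (simp add: field_simps)
  also have "\<dots> \<le> 8 * \<epsilon>\<^sup>2 * (2 * h / t)" by (intro mult_left_mono nge) simp
  finally show "trunc_var W (2 * \<epsilon>) h \<le> 16 * \<epsilon>\<^sup>2 * h / t" by (simp add: c_def)
  have "(real n * norm (trunc_mean W c h))\<^sup>2 \<le> 8 * \<epsilon>\<^sup>2"
    using main v0 n1 mult_nonneg_nonneg[of "real n" "trunc_var W c h"] by linarith
  \<comment> \<open>\<open>8\<close> is rounded up to the square \<open>9\<close>; with
    \<open>1 / real n \<le> 2 * h / t\<close> this gives the constant \<open>6\<close>.\<close>
  also have "\<dots> \<le> (3 * \<epsilon>)\<^sup>2" by (simp add: power_mult_distrib)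
  finally have "real n * norm (trunc_mean W c h) \<le> 3 * \<epsilon>" by (rule power2_le_imp_le) (use \<epsilon> in simp)
  then have "norm (trunc_mean W c h) \<le> 3 * \<epsilon> * (1 / real n)" using n1 by (simp add: field_simps)
  also have "\<dots> \<le> 3 * \<epsilon> * (2 * h / t)" using \<epsilon> by (intro mult_left_mono nge) simp
  finally show "norm (trunc_mean W (2 * \<epsilon>) h) \<le> 6 * \<epsilon> * h / t" by (simp add: c_def)
qed

text \<open>Off \<open>A\<close> each increment equals its truncation, that is a centred part plus
  its mean. The means are linear in the step lengths, which add up to \<open>t\<close>, so they
  contribute at most \<open>6 * C * \<epsilon>\<close>. The centred parts are independent, their
  variances add up in the same way, and Chebyshev's inequality applies. The bound is thus uniform
  over all partitions.\<close>

lemma increment_sum_small: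
  fixes W :: "real \<Rightarrow> 'a \<Rightarrow> 'h::{real_inner,banach,second_countable_topology}"
    and L :: "nat \<Rightarrow> 'h \<Rightarrow> 'h"
  assumes W: "stationary_indep_increments M W"
    and t: "0 < t" and \<epsilon>: "0 < \<epsilon>" and C: "0 < C"
    and A: "A \<in> events" "prob A \<le> 1 / 1280"
    and small: "\<And>\<omega> s. \<omega> \<in> space M - A \<Longrightarrow> s \<in> {0..t} \<Longrightarrow> norm (W s \<omega>) \<le> \<epsilon>"
    and p: "tagged_partition t \<delta> n p s"
    and L: "\<And>i. i \<in> {1..n} \<Longrightarrow> bounded_linear (L i)"
    and LC: "\<And>i x. i \<in> {1..n} \<Longrightarrow> norm (L i x) \<le> C * norm x"
  shows "prob {\<omega>\<in>space M. norm (\<Sum>i=1..n. L i (W (t - p (i - 1)) \<omega> - W (t - p i) \<omega>)) > 6 * C * \<epsilon> + C * sqrt \<epsilon>}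
     \<le> prob A + 16 * \<epsilon>"
proof -
  \<comment> \<open>The sums traverse the path backwards from \<open>t\<close>, whereas independence
    is formulated for increasing times; \<open>ts\<close> and \<open>K\<close> reverse the order.
    For \<open>j\<close> beyond \<open>n\<close>, natural subtraction gives \<open>ts j = t\<close>,
    so \<open>ts_in\<close> holds for every \<open>j\<close>.\<close>
  define ts where "ts j = t - p (n - j)" for j
  define K where "K j = L (n - j)" for j
  define c where "c = 2 * \<epsilon>"
  have p0: "p 0 = 0" "p n = t" and pstep: "\<And>i. i < n \<Longrightarrow> p i < p (Suc i)"
    using p by (auto simp: tagged_partition_def dest!: bspec[where x="Suc _"])
  have ts_less: "ts j < ts (Suc j)" if "j < n" for j
    using pstep[of "n - Suc j"] that by (simp add: ts_def Suc_diff_Suc)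
  have ts0: "ts 0 = 0" "ts n = t" by (auto simp: ts_def p0)
  have ts_in: "ts j \<in> {0..t}" for j using tagged_partition_points(2)[OF p, of "n - j"] by (auto simp: ts_def)
  define \<Delta> where "\<Delta> j \<omega> = W (ts (Suc j)) \<omega> - W (ts j) \<omega>" for j \<omega>
  define h where "h j = ts (Suc j) - ts j" for j
  have h: "0 < h j" "h j \<le> t" if "j < n" for j
    using ts_less[OF that] ts_in[of j] ts_in[of "Suc j"] that by (auto simp: h_def)
  have sum_h: "(\<Sum>j<n. h j) = t"
    unfolding h_def using sum_lessThan_telescope[of ts n] ts0 by simp
  define m where "m j = trunc_mean W c (h j)" for j
  define G where "G j \<omega> = K j (norm_trunc c (\<Delta> j \<omega>) - m j)" for j \<omega>
  have reidx: "(\<Sum>i=1..n. L i (W (t - p (i - 1)) \<omega> - W (t - p i) \<omega>)) = (\<Sum>j<n. K j (\<Delta> j \<omega>))" for \<omega>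
    by (rule sum.reindex_bij_witness[of _ "\<lambda>j. n - j" "\<lambda>i. n - i"])
      (auto simp: K_def \<Delta>_def ts_def Suc_diff_le)
  have Kbl: "bounded_linear (K j)" and KC: "norm (K j x) \<le> C * norm x" if "j < n" for j x
    using L[of "n - j"] LC[of "n - j"] that by (auto simp: K_def)
  have Kmeas: "K j \<in> borel_measurable borel" if "j < n" for j
    using Kbl[OF that] by (intro borel_measurable_continuous_onI linear_continuous_on)
  have ind0: "indep_vars (\<lambda>_. borel) \<Delta> {..<n}"
    unfolding \<Delta>_def using W ts_less ts0
    by (auto simp: stationary_indep_increments_def elim!: allE[of _ n] allE[of _ ts])
  have \<Delta>m[measurable]: "\<Delta> j \<in> borel_measurable M" if "j < n" for j
    using ind0 that by (auto simp: indep_vars_def)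
  have ind: "indep_vars (\<lambda>_. borel) G {..<n}"
    unfolding G_def by (rule indep_vars_compose2[OF ind0]) (auto intro!: measurable_compose[OF _ Kmeas])
  have Gm: "G j \<in> borel_measurable M" if "j < n" for j
    using ind that by (auto simp: indep_vars_def)
  have m_eq: "expectation (\<lambda>\<omega>. norm_trunc c (\<Delta> j \<omega>)) = m j" if "j < n" for j
    using expectation_increment[OF W, of "ts j" "ts (Suc j)" "norm_trunc c"] ts_in[of j] ts_less[of j] that
    by (simp add: \<Delta>_def m_def trunc_mean_def h_def)
  have v_eq: "expectation (\<lambda>\<omega>. (norm (norm_trunc c (\<Delta> j \<omega>) - m j))\<^sup>2) = trunc_var W c (h j)" if "j < n" for j
    using expectation_increment[OF W, of "ts j" "ts (Suc j)" "\<lambda>x. (norm (norm_trunc c x - m j))\<^sup>2"]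
      ts_in[of j] ts_less[of j] that
    by (simp add: \<Delta>_def m_def trunc_var_def h_def)
  have c0: "0 \<le> c" using \<epsilon> by (simp add: c_def)
  have tm: "(\<lambda>\<omega>. norm_trunc c (\<Delta> j \<omega>)) \<in> borel_measurable M" if "j < n" for j using that by measurable
  note cn = centred_norm_le[OF tm norm_norm_trunc_le[OF c0]]
  have b1: "norm (norm_trunc c (\<Delta> j \<omega>) - m j) \<le> 2 * c" if "j < n" "\<omega> \<in> space M" for j \<omega>
    using cn(3)[OF that] by (simp add: m_eq that)
  have bG: "norm (G j \<omega>) \<le> C * (2 * c)" if "j < n" "\<omega> \<in> space M" for j \<omega>
    unfolding G_def using KC[OF that(1)] b1[OF that] C by (meson less_imp_le mult_left_mono order_trans)
  have EG: "expectation (G j) = 0" if "j < n" for j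
  proof -
    have "expectation (G j) = K j (expectation (\<lambda>\<omega>. norm_trunc c (\<Delta> j \<omega>) - m j))"
      unfolding G_def using cn(1)[OF that] by (intro integral_bounded_linear Kbl that) auto
    also have "\<dots> = 0" using cn(4)[OF that] Kbl[OF that] by (simp add: m_eq that linear_simps)
    finally show ?thesis .
  qed
  define H where "H \<omega> = (\<Sum>j<n. G j \<omega>)" for \<omega>
  have Hm[measurable]: "H \<in> borel_measurable M" unfolding H_def by (intro borel_measurable_sum Gm) auto
  have bH: "norm (H \<omega>) \<le> real n * (C * (2 * c))" if "\<omega> \<in> space M" for \<omega>
    unfolding H_def using sum_norm_bound[of "{..<n}" "\<lambda>i. G i \<omega>" "C * (2 * c)"] bG[of _ \<omega>] that by simp
  have iH: "integrable M (\<lambda>\<omega>. (norm (H \<omega>))\<^sup>2)"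
    using bH by (intro integrable_const_bound[where B="(real n * (C * (2 * c)))\<^sup>2"]) (auto intro!: power_mono)
  have "expectation (\<lambda>\<omega>. (norm (H \<omega>))\<^sup>2) = (\<Sum>j<n. expectation (\<lambda>\<omega>. (norm (G j \<omega>))\<^sup>2))"
    using indep_sum_moments[OF ind bG EG] by (simp add: H_def)
  also have "\<dots> \<le> (\<Sum>j<n. C\<^sup>2 * (16 * \<epsilon>\<^sup>2 * h j / t))"
  proof (rule sum_mono)
    fix j assume "j \<in> {..<n}"
    then have j: "j < n" by simp
    have "expectation (\<lambda>\<omega>. (norm (G j \<omega>))\<^sup>2) \<le> expectation (\<lambda>\<omega>. C\<^sup>2 * (norm (norm_trunc c (\<Delta> j \<omega>) - m j))\<^sup>2)"
    proof (rule integral_mono)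
      show "integrable M (\<lambda>\<omega>. (norm (G j \<omega>))\<^sup>2)"
        using bG[OF j] Gm[OF j]
        by (intro integrable_const_bound[where B="(C * (2 * c))\<^sup>2"]) (auto intro!: power_mono)
      have "integrable M (\<lambda>\<omega>. (norm (norm_trunc c (\<Delta> j \<omega>) - m j))\<^sup>2)"
        using power_mono[OF b1[OF j] norm_ge_zero, of _ 2] tm[OF j]
        by (intro integrable_const_bound[where B="(2 * c)\<^sup>2"] AE_I2) auto
      then show "integrable M (\<lambda>\<omega>. C\<^sup>2 * (norm (norm_trunc c (\<Delta> j \<omega>) - m j))\<^sup>2)" by simp
      show "(norm (G j \<omega>))\<^sup>2 \<le> C\<^sup>2 * (norm (norm_trunc c (\<Delta> j \<omega>) - m j))\<^sup>2" for \<omega>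
        unfolding G_def power_mult_distrib[symmetric] by (intro power_mono KC j) simp
    qed
    also have "\<dots> = C\<^sup>2 * trunc_var W c (h j)" using v_eq[OF j] by simp
    also have "\<dots> \<le> C\<^sup>2 * (16 * \<epsilon>\<^sup>2 * h j / t)"
      unfolding c_def using h[OF j] by (intro mult_left_mono trunc_moments_linear(1)[OF W _ _ \<epsilon> A small]) auto
    finally show "expectation (\<lambda>\<omega>. (norm (G j \<omega>))\<^sup>2) \<le> C\<^sup>2 * (16 * \<epsilon>\<^sup>2 * h j / t)" .
  qed
  also have "\<dots> = C\<^sup>2 * 16 * \<epsilon>\<^sup>2 / t * (\<Sum>j<n. h j)" unfolding sum_distrib_left by (intro sum.cong) (simp_all add: field_simps)
  also have "\<dots> = 16 * C\<^sup>2 * \<epsilon>\<^sup>2" using t by (simp add: sum_h)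
  finally have E2: "expectation (\<lambda>\<omega>. (norm (H \<omega>))\<^sup>2) \<le> 16 * C\<^sup>2 * \<epsilon>\<^sup>2" .
  \<comment> \<open>The second moment is of order \<open>\<epsilon>\<^sup>2\<close>; the level
    \<open>C\<^sup>2 * \<epsilon>\<close> for the square makes both the size
    \<open>C * sqrt \<epsilon>\<close> and the probability \<open>16 * \<epsilon>\<close> tend to
    zero with \<open>\<epsilon>\<close>.\<close>
  let ?B = "{\<omega>\<in>space M. (norm (H \<omega>))\<^sup>2 \<ge> C\<^sup>2 * \<epsilon>}"
  have "prob ?B \<le> expectation (\<lambda>\<omega>. (norm (H \<omega>))\<^sup>2) / (C\<^sup>2 * \<epsilon>)"
    by (rule integral_Markov_inequality_measure[OF iH, where A="space M"]) (use C \<epsilon> in auto)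
  also have "\<dots> \<le> 16 * C\<^sup>2 * \<epsilon>\<^sup>2 / (C\<^sup>2 * \<epsilon>)" using C \<epsilon> by (intro divide_right_mono E2) simp
  also have "\<dots> = 16 * \<epsilon>" using C \<epsilon> by (simp add: power2_eq_square)
  finally have PB: "prob ?B \<le> 16 * \<epsilon>" .
  have "norm (\<Sum>j<n. K j (\<Delta> j \<omega>)) \<le> 6 * C * \<epsilon> + C * sqrt \<epsilon>" if \<omega>: "\<omega> \<in> space M" "\<omega> \<notin> A" "\<omega> \<notin> ?B" for \<omega>
  proof -
    have "K j (\<Delta> j \<omega>) = G j \<omega> + K j (m j)" if j: "j < n" for j
    proof -
      have "norm (\<Delta> j \<omega>) \<le> c"
        using small[of \<omega> "ts j"] small[of \<omega> "ts (Suc j)"] \<omega> j ts_in[of j] ts_in[of "Suc j"]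
          norm_triangle_ineq4[of "W (ts (Suc j)) \<omega>" "W (ts j) \<omega>"] by (simp add: \<Delta>_def c_def)
      then show ?thesis using Kbl[OF j] by (simp add: G_def norm_trunc_def linear_simps)
    qed
    then have "(\<Sum>j<n. K j (\<Delta> j \<omega>)) = H \<omega> + (\<Sum>j<n. K j (m j))" by (simp add: H_def sum.distrib)
    moreover have "norm (\<Sum>j<n. K j (m j)) \<le> (\<Sum>j<n. C * (6 * \<epsilon> * h j / t))"
    proof (rule order_trans[OF norm_sum sum_mono])
      fix j assume "j \<in> {..<n}"
      then have j: "j < n" by simp
      have "norm (m j) \<le> 6 * \<epsilon> * h j / t"
        unfolding m_def c_def using h[OF j] by (intro trunc_moments_linear(2)[OF W _ _ \<epsilon> A small]) auto
      then show "norm (K j (m j)) \<le> C * (6 * \<epsilon> * h j / t)"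
        using KC[OF j, of "m j"] C by (meson less_imp_le mult_left_mono order_trans)
    qed
    moreover have "(\<Sum>j<n. C * (6 * \<epsilon> * h j / t)) = C * 6 * \<epsilon> / t * (\<Sum>j<n. h j)"
      unfolding sum_distrib_left by (intro sum.cong) (simp_all add: field_simps)
    moreover have "\<dots> = 6 * C * \<epsilon>" using t by (simp add: sum_h)
    moreover have "norm (H \<omega>) \<le> C * sqrt \<epsilon>"
    proof (rule power2_le_imp_le)
      show "(norm (H \<omega>))\<^sup>2 \<le> (C * sqrt \<epsilon>)\<^sup>2" using \<omega> \<epsilon> by (auto simp: power_mult_distrib)
    qed (use C \<epsilon> in simp)
    ultimately show ?thesis using norm_triangle_ineq[of "H \<omega>" "\<Sum>j<n. K j (m j)"] by simp
  qed
  then have "{\<omega>\<in>space M. norm (\<Sum>j<n. K j (\<Delta> j \<omega>)) > 6 * C * \<epsilon> + C * sqrt \<epsilon>} \<subseteq> A \<union> ?B" by force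
  then have "prob {\<omega>\<in>space M. norm (\<Sum>j<n. K j (\<Delta> j \<omega>)) > 6 * C * \<epsilon> + C * sqrt \<epsilon>} \<le> prob (A \<union> ?B)"
    using A(1) by (intro finite_measure_mono) auto
  also have "\<dots> \<le> prob A + prob ?B" using A(1) by (intro measure_Un_le) auto
  finally show ?thesis unfolding reidx using PB by simp
qed

end

section \<open>Cadlag paths\<close>

definition cadlag :: "(real \<Rightarrow> 'h::topological_space) \<Rightarrow> bool" where
  "cadlag f \<longleftrightarrow> (\<forall>t\<ge>0. continuous (at_right t) f \<and> (t > 0 \<longrightarrow> (\<exists>l. (f \<longlongrightarrow> l) (at_left t))))"

text \<open>Near a given time the path stays close to one of two points, its left limit and its
  value. At time \<open>0\<close> the left part is vacuous, so \<open>l\<close> is arbitrary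
  there.\<close>

lemma cadlag_local:
  fixes f :: "real \<Rightarrow> 'h::metric_space"
  assumes f: "cadlag f" and t: "0 \<le> t" and r: "0 < r"
  obtains e l where "0 < e" "\<And>s. 0 \<le> s \<Longrightarrow> s < t \<Longrightarrow> t - s < e \<Longrightarrow> dist (f s) l < r"
    "\<And>s. t \<le> s \<Longrightarrow> s - t < e \<Longrightarrow> dist (f s) (f t) < r"
proof -
  have "(f \<longlongrightarrow> f t) (at_right t)" using f t by (auto simp: cadlag_def continuous_within)
  then have "eventually (\<lambda>s. dist (f s) (f t) < r) (at_right t)" using r by (rule tendstoD)
  then obtain e1 where e1: "e1 > t" "\<And>s. t < s \<Longrightarrow> s < e1 \<Longrightarrow> dist (f s) (f t) < r"
    by (auto simp: eventually_at_right[of t "t + 1"])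
  have "\<exists>e2 l. e2 < t \<and> (\<forall>s. 0 \<le> s \<longrightarrow> e2 < s \<longrightarrow> s < t \<longrightarrow> dist (f s) l < r)"
  proof (cases "t = 0")
    case True
    then show ?thesis by (intro exI[of _ "-1"]) auto
  next
    case False
    then obtain l where "(f \<longlongrightarrow> l) (at_left t)" using f t by (auto simp: cadlag_def)
    then have "eventually (\<lambda>s. dist (f s) l < r) (at_left t)" using r by (rule tendstoD)
    then show ?thesis by (auto simp: eventually_at_left[of "t - 1" t])
  qed
  then obtain e2 l where e2: "e2 < t" "\<And>s. 0 \<le> s \<Longrightarrow> e2 < s \<Longrightarrow> s < t \<Longrightarrow> dist (f s) l < r" by blast
  show ?thesis
  proof (rule that[of "min (e1 - t) (t - e2)" l])
    show "0 < min (e1 - t) (t - e2)" using e1 e2 by simp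
    show "dist (f s) l < r" if "0 \<le> s" "s < t" "t - s < min (e1 - t) (t - e2)" for s
      using that e2 by auto
    show "dist (f s) (f t) < r" if "t \<le> s" "s - t < min (e1 - t) (t - e2)" for s
      using that e1 r by (cases "s = t") auto
  qed
qed

text \<open>Compactness: finitely many neighbourhoods cover the interval, and monotonicity in the
  index allows the largest of the finitely many local indices.\<close>

lemma uniform_index_on_interval:
  fixes Q :: "nat \<Rightarrow> real \<Rightarrow> bool"
  assumes mono: "\<And>N N' s. N \<le> N' \<Longrightarrow> Q N s \<Longrightarrow> Q N' s"
    and loc: "\<And>t. t \<in> {0..T} \<Longrightarrow> \<exists>e>0. \<exists>N. \<forall>s\<in>{0..T}. \<bar>s - t\<bar> < e \<longrightarrow> Q N s"
  shows "\<exists>N. \<forall>s\<in>{0..T}. Q N s"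
proof -
  from loc obtain e N where e: "\<And>t. t \<in> {0..T} \<Longrightarrow> 0 < e t"
    and N: "\<And>t s. t \<in> {0..T} \<Longrightarrow> s \<in> {0..T} \<Longrightarrow> \<bar>s - t\<bar> < e t \<Longrightarrow> Q (N t) s" by metis
  have "{0..T} \<subseteq> (\<Union>t\<in>{0..T}. ball t (e t))" using e by force
  then obtain C where C: "C \<subseteq> {0..T}" "finite C" "{0..T} \<subseteq> (\<Union>t\<in>C. ball t (e t))"
    using compactE_image[OF compact_Icc[of 0 T], of "{0..T}" "\<lambda>t. ball t (e t)"]
    by (metis open_ball)
  have "Q (Max (N ` C)) s" if s: "s \<in> {0..T}" for s
  proof -
    obtain t where "t \<in> C" "s \<in> ball t (e t)" using C(3) s by blast
    then have "Q (N t) s" "N t \<le> Max (N ` C)"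
      using N[of t s] s C(1,2) by (auto simp: dist_real_def abs_minus_commute)
    then show ?thesis using mono by blast
  qed
  then show ?thesis by blast
qed

lemma cadlag_bounded:
  fixes f :: "real \<Rightarrow> 'h::real_normed_vector"
  assumes f: "cadlag f"
  obtains B where "0 \<le> B" "\<And>s. s \<in> {0..T} \<Longrightarrow> norm (f s) \<le> B"
proof -
  have "\<exists>N. \<forall>s\<in>{0..T}. norm (f s) \<le> real N"
  proof (rule uniform_index_on_interval)
    fix t assume t: "t \<in> {0..T}"
    obtain e l where e: "0 < e" "\<And>s. 0 \<le> s \<Longrightarrow> s < t \<Longrightarrow> t - s < e \<Longrightarrow> dist (f s) l < 1"
      "\<And>s. t \<le> s \<Longrightarrow> s - t < e \<Longrightarrow> dist (f s) (f t) < 1"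
      using cadlag_local[OF f, of t 1] t by auto
    have "norm (f s) \<le> real (nat \<lceil>norm l + norm (f t) + 1\<rceil>)" if "s \<in> {0..T}" "\<bar>s - t\<bar> < e" for s
    proof -
      have "norm (f s) \<le> norm l + norm (f t) + 1"
      proof (cases "s < t")
        case True
        then have "norm (f s - l) < 1" using e(2)[of s] that by (simp add: dist_norm)
        then show ?thesis using norm_triangle_sub[of "f s" l] norm_ge_zero[of "f t"] by linarith
      next
        case False
        then have "norm (f s - f t) < 1" using e(3)[of s] that by (simp add: dist_norm)
        then show ?thesis using norm_triangle_sub[of "f s" "f t"] norm_ge_zero[of l] by linarith
      qed
      then show ?thesis by linarith
    qed
    then show "\<exists>e>0. \<exists>N. \<forall>s\<in>{0..T}. \<bar>s - t\<bar> < e \<longrightarrow> norm (f s) \<le> real N" using e(1) by blast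
  qed auto
  then obtain N where "\<forall>s\<in>{0..T}. norm (f s) \<le> real N" by blast
  then show ?thesis by (intro that[of "real N"]) auto
qed

text \<open>The residual maps are contractions, so an index that works for the left limit and for
  the value at \<open>t\<close> works, up to another \<open>r / 2\<close>, for the whole path near
  \<open>t\<close>. \<open>uniform_index_on_interval\<close> then plays the part of relative
  compactness of the range.\<close>

lemma cadlag_uniform_approx:
  fixes f :: "real \<Rightarrow> 'h::real_normed_vector" and P :: "nat \<Rightarrow> 'h \<Rightarrow> 'h"
  assumes f: "cadlag f" and r: "0 < r"
    and P: "\<And>N. bounded_linear (P N)" "\<And>N x. norm (x - P N x) \<le> norm x"
      "\<And>x. decseq (\<lambda>N. norm (x - P N x))" "\<And>x. (\<lambda>N. P N x) \<longlonglongrightarrow> x"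
  shows "\<exists>N. \<forall>s\<in>{0..T}. norm (f s - P N (f s)) \<le> r"
proof (rule uniform_index_on_interval)
  fix N N' s assume "N \<le> N'" "norm (f s - P N (f s)) \<le> r"
  then show "norm (f s - P N' (f s)) \<le> r" using decseqD[OF P(3)] order_trans by blast
next
  fix t assume t: "t \<in> {0..T}"
  obtain e l where e: "0 < e" "\<And>s. 0 \<le> s \<Longrightarrow> s < t \<Longrightarrow> t - s < e \<Longrightarrow> dist (f s) l < r / 2"
    "\<And>s. t \<le> s \<Longrightarrow> s - t < e \<Longrightarrow> dist (f s) (f t) < r / 2"
    using cadlag_local[OF f, of t "r / 2"] t r by auto
  have lim: "eventually (\<lambda>N. norm (x - P N x) < r / 2) sequentially" for x
    using tendstoD[OF P(4), of "r / 2" x] r by (simp add: dist_norm norm_minus_commute)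
  obtain N where N: "norm (l - P N l) < r / 2" "norm (f t - P N (f t)) < r / 2"
    using eventually_happens[OF eventually_conj[OF lim[of l] lim[of "f t"]]] by auto
  have near: "norm (y - P N y) \<le> r" if "dist y x < r / 2" "norm (x - P N x) < r / 2" for x y
  proof -
    interpret bounded_linear "P N" by (rule P(1))
    have "y - P N y = (y - x - P N (y - x)) + (x - P N x)" by (simp add: diff)
    then have "norm (y - P N y) \<le> norm (y - x - P N (y - x)) + norm (x - P N x)"
      using norm_triangle_ineq by metis
    also have "\<dots> \<le> r" using P(2)[of "y - x" N] that by (simp add: dist_norm)
    finally show ?thesis .
  qed
  have "norm (f s - P N (f s)) \<le> r" if "s \<in> {0..T}" "\<bar>s - t\<bar> < e" for s
  proof (cases "s < t")
    case True
    then show ?thesis using near[of "f s" l] N e(2)[of s] that by auto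
  next
    case False
    then show ?thesis using near[of "f s" "f t"] N e(3)[of s] that by auto
  qed
  then show "\<exists>e>0. \<exists>N. \<forall>s\<in>{0..T}. \<bar>s - t\<bar> < e \<longrightarrow> norm (f s - P N (f s)) \<le> r" using e(1) by blast
qed

text \<open>Only finitely many times have oscillation at least \<open>r\<close>: an accumulation
  point of them would contradict \<open>cadlag_local\<close>, as the values on one side of it are
  close together. Every discontinuity is detected by some \<open>r = 1 / Suc n\<close>.\<close>

lemma cadlag_countable_discontinuities:
  fixes f :: "real \<Rightarrow> 'h::metric_space"
  assumes f: "cadlag f"
  shows "countable {s\<in>{0<..T}. \<not> isCont f s}"
proof -
  define J where "J r = {s\<in>{0<..T}. \<not> (\<exists>e>0. \<forall>u. \<bar>u - s\<bar> < e \<longrightarrow> dist (f u) (f s) < r)}" for r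
  have fin: "finite (J r)" if r: "r > 0" for r
  proof (rule ccontr)
    assume "infinite (J r)"
    moreover have "J r \<subseteq> {0..T}" by (auto simp: J_def)
    ultimately obtain t where t: "t \<in> {0..T}" "t islimpt J r"
      using compact_eq_Bolzano_Weierstrass[of "{0..T}"] compact_Icc by blast
    obtain e l where e: "0 < e" "\<And>s. 0 \<le> s \<Longrightarrow> s < t \<Longrightarrow> t - s < e \<Longrightarrow> dist (f s) l < r / 2"
      "\<And>s. t \<le> s \<Longrightarrow> s - t < e \<Longrightarrow> dist (f s) (f t) < r / 2"
      using cadlag_local[OF f, of t "r / 2"] t r by auto
    obtain s where s: "s \<in> J r" "s \<noteq> t" "dist s t < e"
      using t(2) e(1) by (auto simp: islimpt_approachable)
    \<comment> \<open>The radius \<open>d\<close> keeps \<open>u\<close> nonnegative, on the same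
      side of \<open>t\<close> as \<open>s\<close>, and within \<open>e\<close> of
      \<open>t\<close>.\<close>
    define d where "d = min (min \<bar>s - t\<bar> (e - \<bar>s - t\<bar>)) s"
    have "s > 0" using s(1) by (simp add: J_def)
    then have d: "d > 0" using s by (auto simp: d_def dist_real_def)
    have "dist (f u) (f s) < r" if u: "\<bar>u - s\<bar> < d" for u
    proof (cases "s < t")
      case True
      have "0 \<le> u" "u < t" "t - u < e" "t - s < e"
        using True u s(3) \<open>s > 0\<close> unfolding d_def dist_real_def by linarith+
      then have "dist (f u) l < r / 2" "dist (f s) l < r / 2" using True \<open>s > 0\<close> by (simp_all only: e(2) less_imp_le)
      then show ?thesis using dist_triangle_half_l by (metis dist_commute)
    next
      case False
      have "t \<le> u" "t \<le> s" "u - t < e" "s - t < e"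
        using False u s(3) unfolding d_def dist_real_def by linarith+
      then have "dist (f u) (f t) < r / 2" "dist (f s) (f t) < r / 2" by (simp_all only: e(3))
      then show ?thesis using dist_triangle_half_l by (metis dist_commute)
    qed
    then have "s \<notin> J r" using d unfolding J_def by blast
    then show False using s(1) by contradiction
  qed
  have "{s\<in>{0<..T}. \<not> isCont f s} \<subseteq> (\<Union>n. J (1 / Suc n))"
  proof
    fix s assume s: "s \<in> {s\<in>{0<..T}. \<not> isCont f s}"
    show "s \<in> (\<Union>n. J (1 / Suc n))"
    proof (rule ccontr)
      assume "s \<notin> (\<Union>n. J (1 / Suc n))"
      then have *: "\<exists>e>0. \<forall>u. \<bar>u - s\<bar> < e \<longrightarrow> dist (f u) (f s) < 1 / Suc n" for n
      proof -
        have "s \<notin> J (1 / Suc n)" using \<open>s \<notin> (\<Union>n. J (1 / Suc n))\<close> by blast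
        then show ?thesis using s unfolding J_def by blast
      qed
      have "isCont f s" unfolding continuous_at_eps_delta
      proof (intro allI impI)
        fix e :: real assume "e > 0"
        then obtain n where "1 / Suc n < e" using nat_approx_posE by blast
        then show "\<exists>d>0. \<forall>x'. dist x' s < d \<longrightarrow> dist (f x') (f s) < e"
          using *[of n] unfolding dist_real_def by (meson less_trans)
      qed
      then show False using s by simp
    qed
  qed
  moreover have "countable (\<Union>n. J (1 / Suc n))" using fin by (intro countable_UN) (auto intro: countable_finite)
  ultimately show ?thesis by (rule countable_subset)
qed

lemma cadlag_jointly_measurable:
  fixes Z :: "real \<Rightarrow> 'w \<Rightarrow> 'h::{real_normed_vector,second_countable_topology}"
  assumes Z[measurable]: "\<And>t. 0 \<le> t \<Longrightarrow> Z t \<in> borel_measurable M"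
    and cad: "\<And>\<omega>. \<omega> \<in> space M \<Longrightarrow> cadlag (\<lambda>s. Z s \<omega>)"
  shows "(\<lambda>(s, \<omega>). indicator {0..T} s *\<^sub>R Z s \<omega>) \<in> borel_measurable (borel \<Otimes>\<^sub>M M)"
proof -
  \<comment> \<open>\<open>q n s\<close> is the first grid point of mesh \<open>1 / Suc n\<close>
    strictly to the right of \<open>s\<close>; strictness lets right continuity be applied. For
    fixed \<open>n\<close> it takes countably many values, so \<open>Zn n\<close> is jointly
    measurable; \<open>max 0\<close> provides a legal time for negative grid points.\<close>
  define q where "q n s = (of_int \<lfloor>real (Suc n) * s\<rfloor> + 1) / real (Suc n)" for n and s :: real
  define Zn where "Zn n p = indicator {0..T} (fst p) *\<^sub>R Z (max 0 (q n (fst p))) (snd p)" for n and p :: "real \<times> 'w"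
  have q: "s < q n s" "q n s \<le> s + 1 / real (Suc n)" for n s
  proof -
    have "real (Suc n) * s < of_int \<lfloor>real (Suc n) * s\<rfloor> + 1" by linarith
    then show "s < q n s" by (simp add: q_def less_divide_eq mult.commute)
    have "of_int \<lfloor>real (Suc n) * s\<rfloor> + 1 \<le> real (Suc n) * s + 1" by linarith
    then have "q n s \<le> (real (Suc n) * s + 1) / real (Suc n)"
      unfolding q_def by (intro divide_right_mono) auto
    then show "q n s \<le> s + 1 / real (Suc n)" by (simp add: add_divide_distrib)
  qed
  show ?thesis
  proof (rule borel_measurable_LIMSEQ_metric)
    fix n
    have "(\<lambda>p. (\<lambda>i p. Z (max 0 ((of_int i + 1) / real (Suc n))) (snd p)) \<lfloor>real (Suc n) * fst p\<rfloor> p) \<in> borel_measurable (borel \<Otimes>\<^sub>M M)"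
      by (rule measurable_compose_countable) measurable
    then have [measurable]: "(\<lambda>p. Z (max 0 (q n (fst p))) (snd p)) \<in> borel_measurable (borel \<Otimes>\<^sub>M M)"
      by (simp add: q_def)
    show "Zn n \<in> borel_measurable (borel \<Otimes>\<^sub>M M)" unfolding Zn_def by measurable
  next
    fix p :: "real \<times> 'w" assume p: "p \<in> space (borel \<Otimes>\<^sub>M M)"
    obtain s \<omega> where sw: "p = (s, \<omega>)" by (cases p)
    then have \<omega>: "\<omega> \<in> space M" using p by (simp add: space_pair_measure)
    show "(\<lambda>n. Zn n p) \<longlonglongrightarrow> (case p of (s, \<omega>) \<Rightarrow> indicator {0..T} s *\<^sub>R Z s \<omega>)"
    proof (cases "s \<in> {0..T}")
      case False
      then show ?thesis by (simp add: Zn_def sw)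
    next
      case True
      have "(\<lambda>n. q n s) \<longlonglongrightarrow> s"
      proof (rule tendsto_sandwich[of "\<lambda>_. s" _ _ "\<lambda>n. s + 1 / real (Suc n)"])
        show "(\<lambda>n. s + 1 / real (Suc n)) \<longlonglongrightarrow> s"
          using tendsto_add[OF tendsto_const[of s] lim_1_over_n[THEN LIMSEQ_Suc]] by simp
        show "(\<lambda>_. s) \<longlonglongrightarrow> s" by simp
      qed (use less_imp_le[OF q(1)] q(2) in auto)
      then have "filterlim (\<lambda>n. q n s) (at_right s) sequentially"
        using q(1) less_imp_neq[OF q(1), THEN not_sym] by (simp add: filterlim_at)
      moreover have "((\<lambda>u. Z u \<omega>) \<longlongrightarrow> Z s \<omega>) (at_right s)"
        using cad[OF \<omega>] True by (auto simp: cadlag_def continuous_within)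
      ultimately have "(\<lambda>n. Z (q n s) \<omega>) \<longlonglongrightarrow> Z s \<omega>" by (rule filterlim_compose[rotated])
      moreover have "max 0 (q n s) = q n s" for n using q(1)[of s n] True by simp
      ultimately show ?thesis using True by (simp add: Zn_def sw)
    qed
  qed
qed

section \<open>Sums over tagged partitions as integrals of step functions\<close>

lemma tagged_partition_step_sum:
  fixes f :: "real \<Rightarrow> 'h::real_normed_vector"
  assumes p: "tagged_partition t \<delta> n p s" and u: "0 \<le> u" and t: "0 < t"
  obtains q where "q \<in> {0..t}"
    "(\<Sum>i=1..n. indicator {0..s i} u *\<^sub>R (f (p (i - 1)) - f (p i))) = f q - f t"
    "u < t - \<delta> \<Longrightarrow> 0 < u \<Longrightarrow> \<bar>q - u\<bar> < \<delta>"
proof -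
  have p0: "p 0 = 0" "p n = t"
    and step: "\<And>i. i \<in> {1..n} \<Longrightarrow> p (i - 1) < p i \<and> p i - p (i - 1) < \<delta> \<and> p (i - 1) \<le> s i \<and> s i \<le> p i"
    using p by (auto simp: tagged_partition_def)
  note pmono = tagged_partition_points(1)[OF p]
  \<comment> \<open>The tags are weakly increasing, so the indices with \<open>u \<le> s i\<close>
    form a final segment \<open>j..n\<close> and the sum telescopes. The tag before
    \<open>s j\<close> lies below \<open>u\<close>, which places \<open>p (j - 1)\<close> within one
    mesh width of \<open>u\<close>. If no tag reaches \<open>u\<close>, then \<open>u\<close>
    exceeds \<open>t - \<delta>\<close>, and \<open>q = t\<close> represents the value zero.\<close>
  show ?thesis
  proof (cases "\<exists>i\<in>{1..n}. u \<le> s i")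
    case False
    have "\<not> (u < t - \<delta> \<and> 0 < u)"
    proof
      assume a: "u < t - \<delta> \<and> 0 < u"
      show False
      proof (cases n)
        case 0
        then show False using p0 t by simp
      next
        case (Suc m)
        then show False using a step[of n] False p0 by force
      qed
    qed
    moreover have "(\<Sum>i=1..n. indicator {0..s i} u *\<^sub>R (f (p (i - 1)) - f (p i))) = 0"
      using False u by (intro sum.neutral) (auto simp: indicator_def)
    ultimately show ?thesis using t by (intro that[of t]) auto
  next
    case True
    define j where "j = (LEAST i. i \<in> {1..n} \<and> u \<le> s i)"
    have j: "j \<in> {1..n}" "u \<le> s j" 
      using LeastI_ex[of "\<lambda>i. i \<in> {1..n} \<and> u \<le> s i"] True unfolding j_def by blast+
    have jl: "\<not> u \<le> s i" if "i \<in> {1..n}" "i < j" for i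
      using not_less_Least[of i "\<lambda>i. i \<in> {1..n} \<and> u \<le> s i"] that unfolding j_def by blast
    have ge: "u \<le> s i" if "i \<in> {1..n}" "j \<le> i" for i
    proof (cases "i = j")
      case False
      then have "s j \<le> p j" "p j \<le> p (i - 1)" "p (i - 1) \<le> s i"
        using step[of j] step[of i] pmono[of j "i - 1"] j that by auto
      then show ?thesis using j(2) by simp
    qed (use j in simp)
    have "(\<Sum>i=1..n. indicator {0..s i} u *\<^sub>R (f (p (i - 1)) - f (p i))) = (\<Sum>i=j..n. f (p (i - 1)) - f (p i))"
      using j(1) jl ge u
      by (intro sum.mono_neutral_cong_right) (auto simp: indicator_def not_le)
    also have "\<dots> = f (p (j - 1)) - f (p n)"
    proof -
      have "(\<Sum>i=j..n. f (p (i - 1)) - f (p i)) = f (p (j - 1)) - f (p n)" if "j \<le> n" "1 \<le> j"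
        using that by (induction n rule: dec_induct) auto
      then show ?thesis using j by simp
    qed
    finally have sum: "(\<Sum>i=1..n. indicator {0..s i} u *\<^sub>R (f (p (i - 1)) - f (p i))) = f (p (j - 1)) - f t"
      using p0 by simp
    show ?thesis
    proof (rule that[OF _ sum])
      show "p (j - 1) \<in> {0..t}" using pmono[of 0 "j - 1"] pmono[of "j - 1" n] j p0 by auto
      assume "0 < u"
      have "u \<le> p j" "p j < p (j - 1) + \<delta>" using step[OF j(1)] j(2) by auto
      moreover have "p (j - 1) < u + \<delta>"
      proof (cases "j = 1")
        case True
        then show ?thesis using step[OF j(1)] \<open>0 < u\<close> p0 by simp
      next
        case False
        then have "j - 1 \<in> {1..n}" "j - 1 < j" using j by auto
        then show ?thesis using step[of "j - 1"] jl[of "j - 1"] by auto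
      qed
      ultimately show "\<bar>p (j - 1) - u\<bar> < \<delta>" by auto
    qed
  qed
qed


text \<open>Inserting \<open>G(s\<^sub>i) = H + \<integral> 1\<^bsub>[0,s\<^sub>i]\<^esub> k\<close> and summing inside the integral, the increments of \<open>f\<close>
  telescope to a step function that converges to \<open>f\<close> at its continuity points.\<close>

lemma tagged_partition_sum_tendsto:
  fixes f :: "real \<Rightarrow> 'h::real_normed_vector"
    and k G :: "real \<Rightarrow> 'h \<Rightarrow> 'k::{banach,second_countable_topology}"
  assumes t: "0 < t"
    and k: "\<And>u. u \<in> {0..t} \<Longrightarrow> bounded_linear (k u)"
      "\<And>u x. u \<in> {0..t} \<Longrightarrow> norm (k u x) \<le> B * norm x"
      "\<And>x. (\<lambda>u. indicator {0..t} u *\<^sub>R k u x) \<in> borel_measurable lborel"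
    and H: "linear H"
    and G: "\<And>s x. s \<in> {0..t} \<Longrightarrow> G s x = H x + (LINT u:{0..s}|lborel. k u x)"
    and f: "f t = 0" "\<And>u. u \<in> {0..t} \<Longrightarrow> norm (f u) \<le> b"
      "countable {u\<in>{0<..<t}. \<not> isCont f u}"
      "(\<lambda>u. indicator {0..t} u *\<^sub>R k u (f u)) \<in> borel_measurable lborel"
    and p: "\<And>m. tagged_partition t (\<delta> m) (n m) (p m) (s m)" "\<delta> \<longlonglongrightarrow> 0"
  shows "(\<lambda>m. \<Sum>i=1..n m. G (s m i) (f (p m (i - 1)) - f (p m i)))
    \<longlonglongrightarrow> H (f 0) + (LINT u:{0..t}|lborel. k u (f u))"
proof -
  define y where "y m i = f (p m (i - 1)) - f (p m i)" for m i
  define \<sigma> where "\<sigma> m u = (\<Sum>i=1..n m. indicator {0..s m i} u *\<^sub>R y m i)" for m u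
  have B0: "0 \<le> B * norm x" for x :: 'h using order_trans[OF norm_ge_zero k(2)[of 0 x]] t by simp
  note s_in = tagged_partition_points(3)[OF p(1)]
  \<comment> \<open>The indicator is placed inside the argument of \<open>k u\<close>, so that
    linearity later collects the sum over \<open>i\<close> into \<open>\<sigma>\<close>.\<close>
  have kint: "integrable lborel (\<lambda>u. indicator {0..t} u *\<^sub>R k u (indicator {0..r} u *\<^sub>R x))"
    if "r \<in> {0..t}" for r x
  proof (rule Bochner_Integration.integrable_bound)
    show "integrable lborel (\<lambda>u. B * norm x * indicator {0..t} u :: real)"
      using t by (intro integrable_mult_right integrable_real_indicator) (auto simp: emeasure_lborel_Icc_eq)
    have "(\<lambda>u. indicator {0..r} u *\<^sub>R (indicator {0..t} u *\<^sub>R k u x)) \<in> borel_measurable lborel"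
      using k(3)[of x] by measurable
    also have "(\<lambda>u. indicator {0..r} u *\<^sub>R (indicator {0..t} u *\<^sub>R k u x))
        = (\<lambda>u. indicator {0..t} u *\<^sub>R k u (indicator {0..r} u *\<^sub>R x))"
      using k(1) by (auto simp: indicator_def linear_simps fun_eq_iff)
    finally show "(\<lambda>u. indicator {0..t} u *\<^sub>R k u (indicator {0..r} u *\<^sub>R x)) \<in> borel_measurable lborel" .
    show "AE u in lborel. norm (indicator {0..t} u *\<^sub>R k u (indicator {0..r} u *\<^sub>R x))
        \<le> norm (B * norm x * indicator {0..t} u :: real)"
      using k(2)[of _ x] B0[of x] k(1) by (auto simp: indicator_def linear_simps)
  qed
  have ksum: "k u (\<sigma> m u) = (\<Sum>i=1..n m. k u (indicator {0..s m i} u *\<^sub>R y m i))" if "u \<in> {0..t}" for u m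
    unfolding \<sigma>_def by (rule linear_sum[OF bounded_linear.linear[OF k(1)[OF that]]])
  have Gsum: "(\<Sum>i=1..n m. G (s m i) (y m i)) = H (f 0) + (\<integral>u. indicator {0..t} u *\<^sub>R k u (\<sigma> m u) \<partial>lborel)" for m
  proof -
    have "G (s m i) (y m i) = H (y m i) + (\<integral>u. indicator {0..t} u *\<^sub>R k u (indicator {0..s m i} u *\<^sub>R y m i) \<partial>lborel)"
      if i: "i \<in> {1..n m}" for i
    proof -
      have "indicator {0..s m i} u *\<^sub>R k u (y m i) = indicator {0..t} u *\<^sub>R k u (indicator {0..s m i} u *\<^sub>R y m i)" for u
        using s_in[OF i] k(1)[of u] by (auto simp: indicator_def linear_simps)
      then show ?thesis using G[OF s_in[OF i]] by (simp add: set_lebesgue_integral_def)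
    qed
    then have "(\<Sum>i=1..n m. G (s m i) (y m i)) = (\<Sum>i=1..n m. H (y m i))
        + (\<Sum>i=1..n m. \<integral>u. indicator {0..t} u *\<^sub>R k u (indicator {0..s m i} u *\<^sub>R y m i) \<partial>lborel)"
      by (simp add: sum.distrib)
    also have "(\<Sum>i=1..n m. H (y m i)) = H (\<Sum>i=1..n m. y m i)" by (rule linear_sum[OF H, symmetric])
    also have "(\<Sum>i=1..n m. y m i) = f 0"
    proof -
      have "(\<Sum>i=1..j. y m i) = f (p m 0) - f (p m j)" for j
        unfolding y_def by (induction j) auto
      then show ?thesis using p(1)[of m] f(1) by (simp add: tagged_partition_def)
    qed
    also have "(\<Sum>i=1..n m. \<integral>u. indicator {0..t} u *\<^sub>R k u (indicator {0..s m i} u *\<^sub>R y m i) \<partial>lborel)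
       = (\<integral>u. (\<Sum>i=1..n m. indicator {0..t} u *\<^sub>R k u (indicator {0..s m i} u *\<^sub>R y m i)) \<partial>lborel)"
      using kint s_in by (intro Bochner_Integration.integral_sum[symmetric]) auto
    also have "\<dots> = (\<integral>u. indicator {0..t} u *\<^sub>R k u (\<sigma> m u) \<partial>lborel)"
    proof (rule Bochner_Integration.integral_cong[OF refl])
      fix u
      show "(\<Sum>i=1..n m. indicator {0..t} u *\<^sub>R k u (indicator {0..s m i} u *\<^sub>R y m i)) = indicator {0..t} u *\<^sub>R k u (\<sigma> m u)"
        using ksum[of u m] by (cases "u \<in> {0..t}") simp_all
    qed
    finally show ?thesis .
  qed
  have meas: "(\<lambda>u. indicator {0..t} u *\<^sub>R k u (\<sigma> m u)) \<in> borel_measurable lborel" for m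
  proof -
    have "(\<lambda>u. \<Sum>i=1..n m. indicator {0..t} u *\<^sub>R k u (indicator {0..s m i} u *\<^sub>R y m i)) \<in> borel_measurable lborel"
      using kint s_in by (intro borel_measurable_sum borel_measurable_integrable) auto
    also have "(\<lambda>u. \<Sum>i=1..n m. indicator {0..t} u *\<^sub>R k u (indicator {0..s m i} u *\<^sub>R y m i))
        = (\<lambda>u. indicator {0..t} u *\<^sub>R k u (\<sigma> m u))"
    proof
      fix u
      show "(\<Sum>i=1..n m. indicator {0..t} u *\<^sub>R k u (indicator {0..s m i} u *\<^sub>R y m i)) = indicator {0..t} u *\<^sub>R k u (\<sigma> m u)"
        using ksum[of u m] by (cases "u \<in> {0..t}") simp_all
    qed
    finally show ?thesis .
  qed
  have \<sigma>_val: "\<exists>q\<in>{0..t}. \<sigma> m u = f q \<and> (u < t - \<delta> m \<longrightarrow> 0 < u \<longrightarrow> \<bar>q - u\<bar> < \<delta> m)" if "0 \<le> u" for m u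
  proof -
    have "\<exists>q\<in>{0..t}. \<sigma> m u = f q - f t \<and> (u < t - \<delta> m \<longrightarrow> 0 < u \<longrightarrow> \<bar>q - u\<bar> < \<delta> m)"
      by (rule tagged_partition_step_sum[OF p(1)[of m] that t, where f=f, folded y_def, folded \<sigma>_def]) blast
    then show ?thesis by (simp add: f(1))
  qed
  have \<sigma>_bound: "norm (\<sigma> m u) \<le> b" if "u \<in> {0..t}" for m u
    using \<sigma>_val[of u m] that f(2) by auto
  \<comment> \<open>The evaluation points \<open>q m\<close> may lie on either side of
    \<open>u\<close>, so continuity from both sides is used; the exceptional points are countable
    and hence null.\<close>
  have \<sigma>_lim: "(\<lambda>m. \<sigma> m u) \<longlonglongrightarrow> f u" if u: "u \<in> {0<..<t}" "isCont f u" for u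
  proof -
    have "\<exists>q. \<sigma> m u = f q \<and> (u < t - \<delta> m \<longrightarrow> \<bar>q - u\<bar> < \<delta> m)" for m
      using \<sigma>_val[of u m] u(1) by auto
    then obtain q where q: "\<And>m. \<sigma> m u = f (q m)" "\<And>m. u < t - \<delta> m \<Longrightarrow> \<bar>q m - u\<bar> < \<delta> m" by metis
    have "eventually (\<lambda>m. \<delta> m < t - u) sequentially" using p(2) u(1) by (intro order_tendstoD) auto
    then have "eventually (\<lambda>m. norm (q m - u) \<le> \<delta> m) sequentially"
    proof eventually_elim
      case (elim m)
      then have "u < t - \<delta> m" by simp
      from q(2)[OF this] show ?case by simp
    qed
    then have "(\<lambda>m. q m - u) \<longlonglongrightarrow> 0" by (rule Lim_null_comparison[OF _ p(2)])
    then have "q \<longlonglongrightarrow> u" by (simp add: LIM_zero_iff)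
    then show ?thesis unfolding q(1) by (rule isCont_tendsto_compose[OF u(2)])
  qed
  have "(\<lambda>m. \<integral>u. indicator {0..t} u *\<^sub>R k u (\<sigma> m u) \<partial>lborel) \<longlonglongrightarrow> (\<integral>u. indicator {0..t} u *\<^sub>R k u (f u) \<partial>lborel)"
  proof (rule integral_dominated_convergence)
    show "integrable lborel (\<lambda>u. \<bar>B\<bar> * b * indicator {0..t} u :: real)"
      using t by (intro integrable_mult_right integrable_real_indicator) (auto simp: emeasure_lborel_Icc_eq)
    show "AE u in lborel. norm (indicator {0..t} u *\<^sub>R k u (\<sigma> m u)) \<le> \<bar>B\<bar> * b * indicator {0..t} u" for m
    proof (rule AE_I2)
      fix u
      show "norm (indicator {0..t} u *\<^sub>R k u (\<sigma> m u)) \<le> \<bar>B\<bar> * b * indicator {0..t} u"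
      proof (cases "u \<in> {0..t}")
        case True
        have "norm (k u (\<sigma> m u)) \<le> B * norm (\<sigma> m u)" by (rule k(2)[OF True])
        also have "\<dots> \<le> \<bar>B\<bar> * b" using \<sigma>_bound[OF True, of m] by (intro mult_mono) auto
        finally show ?thesis using True by simp
      qed simp
    qed
    have "{u. \<not> (u \<in> {0..t} \<longrightarrow> u \<in> {0<..<t} \<and> isCont f u)} \<subseteq> {0, t} \<union> {u\<in>{0<..<t}. \<not> isCont f u}" by auto
    then have "countable {u. \<not> (u \<in> {0..t} \<longrightarrow> u \<in> {0<..<t} \<and> isCont f u)}"
      by (rule countable_subset) (intro countable_Un f(3), simp)
    from AE_not_in[OF countable_imp_null_set_lborel[OF this]]
    have "AE u in lborel. u \<in> {0..t} \<longrightarrow> u \<in> {0<..<t} \<and> isCont f u"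
      by (rule eventually_mono) blast
    then show "AE u in lborel. (\<lambda>m. indicator {0..t} u *\<^sub>R k u (\<sigma> m u)) \<longlonglongrightarrow> indicator {0..t} u *\<^sub>R k u (f u)"
    proof eventually_elim
      case (elim u)
      show ?case
      proof (cases "u \<in> {0..t}")
        case True
        then show ?thesis using elim \<sigma>_lim
          by (intro tendsto_scaleR tendsto_const bounded_linear.tendsto[OF k(1)]) auto
      qed simp
    qed
  qed (use meas f(4) in auto)
  then show ?thesis unfolding y_def[symmetric] Gsum set_lebesgue_integral_def by (intro tendsto_add tendsto_const)
qed

section \<open>The resolvent and its convolution kernels\<close>

lemma lborel_integral_reflect:
  fixes f :: "real \<Rightarrow> 'k::{banach,second_countable_topology}"
  shows "(\<integral>x. f (t - x) \<partial>lborel) = (\<integral>x. f x \<partial>lborel)"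
  using lborel_integral_real_affine[of "-1" f t] by simp

lemma lborel_integral_shift:
  fixes f :: "real \<Rightarrow> 'k::{banach,second_countable_topology}"
  shows "(\<integral>x. f (x - t) \<partial>lborel) = (\<integral>x. f x \<partial>lborel)"
  using lborel_integral_real_affine[of 1 f "-t"] by simp

lemma AE_lborel_reflect:
  assumes "AE x in lborel. P x"
  shows "AE x in lborel. P (t - x :: real)"
proof -
  obtain N where N: "{x\<in>space lborel. \<not> P x} \<subseteq> N" "emeasure lborel N = 0" "N \<in> sets lborel"
    using AE_E[OF assms] by blast
  have "AE x in lborel. x \<notin> N" using N by (intro AE_not_in) (auto simp: null_sets_def)
  then have "AE x in lborel. t + (-1) * x \<notin> N" using N(3) by (intro AE_borel_affine) auto
  then show ?thesis by (rule eventually_mono) (use N(1) in auto)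
qed

text \<open>A product bound yields joint integrability at once; every interchange of convolution
  integrals below has this form.\<close>

lemma Fubini_dominated:
  fixes h :: "real \<Rightarrow> real \<Rightarrow> 'k::{banach,second_countable_topology}"
  assumes h[measurable]: "(\<lambda>(x, y). h x y) \<in> borel_measurable (borel \<Otimes>\<^sub>M borel)"
    and f: "integrable lborel f" and g: "integrable lborel g"
    and le: "\<And>x y. norm (h x y) \<le> f x * g y"
  shows "(\<integral>x. (\<integral>y. h x y \<partial>lborel) \<partial>lborel) = (\<integral>y. (\<integral>x. h x y \<partial>lborel) \<partial>lborel)"
    and "integrable lborel (\<lambda>x. \<integral>y. h x y \<partial>lborel)" "integrable lborel (\<lambda>y. \<integral>x. h x y \<partial>lborel)"
proof -
  have h'[measurable]: "(\<lambda>(x, y). h x y) \<in> borel_measurable (lborel \<Otimes>\<^sub>M lborel)"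
    using h by (simp cong: measurable_cong_sets)
  have fib: "integrable lborel (\<lambda>y. h x y)" for x
  proof (rule Bochner_Integration.integrable_bound)
    show "integrable lborel (\<lambda>y. f x * g y)" using g by simp
    show "(\<lambda>y. h x y) \<in> borel_measurable lborel"
      using measurable_compose[OF measurable_Pair1' h, of x] by simp
    show "AE y in lborel. norm (h x y) \<le> norm (f x * g y)"
      unfolding real_norm_def by (intro AE_I2 order_trans[OF le abs_ge_self])
  qed
  have int: "integrable (lborel \<Otimes>\<^sub>M lborel) (\<lambda>(x, y). h x y)"
  proof (rule lborel_pair.Fubini_integrable[OF h'])
    show "integrable lborel (\<lambda>x. \<integral>y. norm (case (x, y) of (x, y) \<Rightarrow> h x y) \<partial>lborel)"
    proof (rule Bochner_Integration.integrable_bound)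
      show "integrable lborel (\<lambda>x. f x * (\<integral>y. g y \<partial>lborel))" using f by simp
      show "(\<lambda>x. \<integral>y. norm (case (x, y) of (x, y) \<Rightarrow> h x y) \<partial>lborel) \<in> borel_measurable lborel"
        by measurable
      have "(\<integral>y. norm (h x y) \<partial>lborel) \<le> f x * (\<integral>y. g y \<partial>lborel)" for x
      proof -
        have "(\<integral>y. norm (h x y) \<partial>lborel) \<le> (\<integral>y. f x * g y \<partial>lborel)"
          using fib g le by (intro integral_mono) auto
        then show ?thesis using g by simp
      qed
      then show "AE x in lborel. norm (\<integral>y. norm (case (x, y) of (x, y) \<Rightarrow> h x y) \<partial>lborel)
          \<le> norm (f x * (\<integral>y. g y \<partial>lborel))"
        by (intro AE_I2) (simp add: order_trans[OF _ abs_ge_self])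
    qed
    show "AE x in lborel. integrable lborel (\<lambda>y. case (x, y) of (x, y) \<Rightarrow> h x y)" using fib by simp
  qed
  show "(\<integral>x. (\<integral>y. h x y \<partial>lborel) \<partial>lborel) = (\<integral>y. (\<integral>x. h x y \<partial>lborel) \<partial>lborel)"
    using lborel_pair.Fubini_integral[of h] int by simp
  show "integrable lborel (\<lambda>x. \<integral>y. h x y \<partial>lborel)" using lborel_pair.integrable_fst'[OF int] by simp
  show "integrable lborel (\<lambda>y. \<integral>x. h x y \<partial>lborel)" using lborel_pair.integrable_snd[of h] int by simp
qed

text \<open>\<open>c\<close> and \<open>b\<close> witness \<open>W11_loc a\<close>: the absolutely
  continuous version of \<open>a\<close> has value \<open>c\<close> at \<open>0\<close> and
  derivative \<open>b\<close> almost everywhere.\<close>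

locale volterra_resolvent =
  fixes D :: "'h::{real_inner,banach,second_countable_topology} set" and A :: "'h \<Rightarrow> 'h"
    and a b :: "real \<Rightarrow> real" and c T :: real and R :: "real \<Rightarrow> 'h \<Rightarrow> 'h"
  assumes A_op: "closed_densely_defined D A" and R_res: "resolvent_family D A a R"
    and T: "0 \<le> T" and a_loc: "locally_integrable a" and b_loc: "locally_integrable b"
    and a_eq: "AE t in lborel. 0 \<le> t \<longrightarrow> a t = c + (LINT s:{0..t}|lborel. b s)"
begin

text \<open>All functions of time are cut off outside \<open>[0, T]\<close>, so that convolutions are integrals over the
  whole line. By \<open>a_eq\<close>, the function \<open>\<alpha>\<close> agrees with \<open>a\<close> almost everywhere on \<open>[0, T]\<close>; the operator
  \<open>K u\<close> is the derivative at \<open>u\<close> of the convolution of \<open>a\<close> and \<open>R\<close>.\<close>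

abbreviation I :: "real \<Rightarrow> real" where "I \<equiv> indicator {0..T}"

definition Rz :: "real \<Rightarrow> 'h \<Rightarrow> 'h" where "Rz u x = I u *\<^sub>R R u x"

definition b0 :: "real \<Rightarrow> real" where "b0 v = I v * b v"

definition \<alpha> :: "real \<Rightarrow> real" where "\<alpha> u = c * I u + (\<integral>v. b0 v * I (u - v) \<partial>lborel)"

definition K :: "real \<Rightarrow> 'h \<Rightarrow> 'h" where "K u x = c *\<^sub>R Rz u x + (\<integral>v. b0 v *\<^sub>R Rz (u - v) x \<partial>lborel)"

text \<open>Strict positivity is included because \<open>increment_sum_small\<close> divides by the
  square of the operator bound.\<close>

definition CR :: real where "CR = (SOME C. 0 < C \<and> (\<forall>u\<in>{0..T}. \<forall>x. norm (R u x) \<le> C * norm x))"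

definition Cb :: real where "Cb = \<bar>c\<bar> + (\<integral>v. \<bar>b0 v\<bar> \<partial>lborel)"

lemma CR: "0 < CR" "u \<in> {0..T} \<Longrightarrow> norm (R u x) \<le> CR * norm x"
proof -
  obtain C where C: "\<forall>t\<in>{0..T}. \<forall>x. norm (R t x) \<le> C * norm x"
    using R_res T unfolding resolvent_family_def by blast
  have "norm (R t x) \<le> (\<bar>C\<bar> + 1) * norm x" if "t \<in> {0..T}" for t x
  proof -
    have "norm (R t x) \<le> C * norm x" using C that by blast
    also have "\<dots> \<le> (\<bar>C\<bar> + 1) * norm x" by (intro mult_right_mono) auto
    finally show ?thesis .
  qed
  then have "\<exists>C>0. \<forall>u\<in>{0..T}. \<forall>x. norm (R u x) \<le> C * norm x" by (intro exI[of _ "\<bar>C\<bar> + 1"]) auto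
  from someI_ex[OF this, folded CR_def]
  show "0 < CR" "u \<in> {0..T} \<Longrightarrow> norm (R u x) \<le> CR * norm x" by auto
qed

lemma R_bounded_linear: "0 \<le> u \<Longrightarrow> bounded_linear (R u)"
  using R_res by (auto simp: resolvent_family_def)

lemma I_integrable: "integrable lborel I"
  using T by (intro integrable_real_indicator) (auto simp: emeasure_lborel_Icc_eq)

lemma Rz_bounded_linear: "bounded_linear (Rz u)"
proof (cases "u \<in> {0..T}")
  case True
  then have "Rz u = R u" by (auto simp: Rz_def fun_eq_iff)
  then show ?thesis using R_bounded_linear True by simp
next
  case False
  then have "Rz u = (\<lambda>x. 0)" by (auto simp: Rz_def fun_eq_iff)
  then show ?thesis by (simp add: bounded_linear_zero)
qed

lemma Rz_norm_le_I: "norm (Rz u x) \<le> CR * norm x * I u"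
  using CR by (auto simp: Rz_def indicator_def)

lemma Rz_norm_le: "norm (Rz u x) \<le> CR * norm x"
  using Rz_norm_le_I[of u x] CR(1) by (cases "u \<in> {0..T}") (auto intro: order_trans)

text \<open>Strong continuity together with the uniform bound makes \<open>R u x\<close> jointly
  continuous in time and space.\<close>

lemma Rz_measurable[measurable (raw)]:
  assumes [measurable]: "f \<in> borel_measurable M" "g \<in> borel_measurable M"
  shows "(\<lambda>w. Rz (f w) (g w)) \<in> borel_measurable M"
proof -
  \<comment> \<open>Clamping times to \<open>[0, T]\<close> extends \<open>R\<close> continuously to
    the whole line; the cut-off, which is only measurable, is applied afterwards.\<close>
  define cl where "cl u = max 0 (min T u)" for u :: real
  have cl_in: "cl u \<in> {0..T}" for u using T by (auto simp: cl_def)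
  have cont: "continuous_on UNIV (\<lambda>p. R (cl (fst p)) (snd p))"
    unfolding continuous_on_sequentially
  proof (intro ballI allI impI, elim conjE)
    fix q :: "nat \<Rightarrow> real \<times> 'h" and p assume "q \<longlonglongrightarrow> p"
    then have q: "(\<lambda>n. fst (q n)) \<longlonglongrightarrow> fst p" "(\<lambda>n. snd (q n)) \<longlonglongrightarrow> snd p"
      by (auto intro: tendsto_fst tendsto_snd)
    have 1: "(\<lambda>n. cl (fst (q n))) \<longlonglongrightarrow> cl (fst p)" unfolding cl_def by (intro tendsto_intros q)
    have "continuous_on {0..} (\<lambda>t. R t (snd p))" using R_res by (auto simp: resolvent_family_def)
    from continuous_on_tendsto_compose[OF this 1]
    have 2: "(\<lambda>n. R (cl (fst (q n))) (snd p)) \<longlonglongrightarrow> R (cl (fst p)) (snd p)"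
      by (auto simp: cl_def)
    have 3: "(\<lambda>n. R (cl (fst (q n))) (snd (q n) - snd p)) \<longlonglongrightarrow> 0"
    proof (rule Lim_null_comparison)
      show "\<forall>\<^sub>F n in sequentially. norm (R (cl (fst (q n))) (snd (q n) - snd p)) \<le> CR * norm (snd (q n) - snd p)"
        by (rule always_eventually, rule allI, rule CR(2)[OF cl_in])
      have "(\<lambda>n. CR * norm (snd (q n) - snd p)) \<longlonglongrightarrow> CR * norm (snd p - snd p)"
        by (intro tendsto_intros q)
      then show "(\<lambda>n. CR * norm (snd (q n) - snd p)) \<longlonglongrightarrow> 0" by simp
    qed
    have "R (cl u) (x - y) + R (cl u) y = R (cl u) x" for u x y
      using R_bounded_linear[of "cl u"] cl_in[of u] by (simp add: linear_simps)
    then show "((\<lambda>p. R (cl (fst p)) (snd p)) \<circ> q) \<longlonglongrightarrow> R (cl (fst p)) (snd p)"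
      using tendsto_add[OF 3 2] by (simp add: comp_def)
  qed
  have "(\<lambda>w. R (cl (f w)) (g w)) \<in> borel_measurable M"
    by (rule borel_measurable_continuous_Pair[OF assms cont])
  then have "(\<lambda>w. I (f w) *\<^sub>R R (cl (f w)) (g w)) \<in> borel_measurable M" by measurable
  also have "(\<lambda>w. I (f w) *\<^sub>R R (cl (f w)) (g w)) = (\<lambda>w. Rz (f w) (g w))"
    by (auto simp: Rz_def indicator_def cl_def fun_eq_iff)
  finally show ?thesis .
qed

lemma b0_integrable: "integrable lborel b0"
  using b_loc T by (auto simp: locally_integrable_def set_integrable_def b0_def[abs_def])

lemma b0_measurable[measurable]: "b0 \<in> borel_measurable borel"
  using borel_measurable_integrable[OF b0_integrable] by simp

lemma b0_bounded_integrable: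
  fixes g :: "real \<Rightarrow> 'k::{banach,second_countable_topology}"
  assumes [measurable]: "g \<in> borel_measurable borel" and "\<And>v. norm (g v) \<le> C"
  shows "integrable lborel (\<lambda>v. b0 v *\<^sub>R g v)" "norm (\<integral>v. b0 v *\<^sub>R g v \<partial>lborel) \<le> C * (\<integral>v. \<bar>b0 v\<bar> \<partial>lborel)"
proof -
  have le: "norm (b0 v *\<^sub>R g v) \<le> C * \<bar>b0 v\<bar>" for v
    using mult_left_mono[OF assms(2)[of v], of "\<bar>b0 v\<bar>"] by (simp add: mult.commute)
  have i: "integrable lborel (\<lambda>v. C * \<bar>b0 v\<bar>)" using b0_integrable by simp
  show int: "integrable lborel (\<lambda>v. b0 v *\<^sub>R g v)"
    by (rule Bochner_Integration.integrable_bound[OF i]) (use order_trans[OF le abs_ge_self] in auto)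
  have "norm (\<integral>v. b0 v *\<^sub>R g v \<partial>lborel) \<le> (\<integral>v. C * \<bar>b0 v\<bar> \<partial>lborel)"
    by (rule order_trans[OF integral_norm_bound integral_mono[OF integrable_norm[OF int] i le]])
  then show "norm (\<integral>v. b0 v *\<^sub>R g v \<partial>lborel) \<le> C * (\<integral>v. \<bar>b0 v\<bar> \<partial>lborel)" by simp
qed

lemma \<alpha>_measurable[measurable]: "\<alpha> \<in> borel_measurable borel"
  unfolding \<alpha>_def[abs_def] by measurable

lemma \<alpha>_bound: "\<bar>\<alpha> u\<bar> \<le> Cb"
proof -
  have "\<bar>\<integral>v. b0 v * I (u - v) \<partial>lborel\<bar> \<le> (\<integral>v. \<bar>b0 v\<bar> \<partial>lborel)"
    using b0_bounded_integrable(2)[of "\<lambda>v. I (u - v)" 1] by (simp add: indicator_def)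
  moreover have "\<bar>c * I u\<bar> \<le> \<bar>c\<bar>" by (simp add: indicator_def)
  ultimately show ?thesis unfolding \<alpha>_def Cb_def by linarith
qed

lemma \<alpha>_neg: "u < 0 \<Longrightarrow> \<alpha> u = 0"
proof -
  assume u: "u < 0"
  then have "(\<lambda>v. b0 v * I (u - v)) = (\<lambda>v. 0)" by (auto simp: b0_def indicator_def fun_eq_iff)
  then show "\<alpha> u = 0" using u by (simp add: \<alpha>_def)
qed

lemma \<alpha>_eq: "u \<in> {0..T} \<Longrightarrow> \<alpha> u = c + (LINT s:{0..u}|lborel. b s)"
proof -
  assume u: "u \<in> {0..T}"
  then have "(\<lambda>v. b0 v * I (u - v)) = (\<lambda>v. indicator {0..u} v * b v)"
    by (auto simp: b0_def indicator_def fun_eq_iff)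
  then show ?thesis using u by (simp add: \<alpha>_def set_lebesgue_integral_def)
qed

text \<open>The bridge from the integrals in the hypotheses to convolutions over the line.
  Reflection carries the almost everywhere identity of \<open>a\<close> and \<open>\<alpha>\<close>
  over to \<open>t - \<tau>\<close>, and the upper limit \<open>t\<close> is encoded in the
  vanishing of \<open>\<alpha>\<close> on negative arguments.\<close>

lemma a_conv_eq:
  fixes g :: "real \<Rightarrow> 'k::{banach,second_countable_topology}"
  assumes t: "t \<in> {0..T}" and [measurable]: "(\<lambda>\<tau>. I \<tau> *\<^sub>R g \<tau>) \<in> borel_measurable borel"
  shows "(LINT \<tau>:{0..t}|lborel. a (t - \<tau>) *\<^sub>R g \<tau>) = (\<integral>\<tau>. \<alpha> (t - \<tau>) *\<^sub>R (I \<tau> *\<^sub>R g \<tau>) \<partial>lborel)"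
proof -
  have [measurable]: "(\<lambda>u. I u * a u) \<in> borel_measurable borel"
    using a_loc T by (auto simp: locally_integrable_def set_integrable_def dest!: spec[of _ T] borel_measurable_integrable)
  have "(LINT \<tau>:{0..t}|lborel. a (t - \<tau>) *\<^sub>R g \<tau>) = (\<integral>\<tau>. (I (t - \<tau>) * a (t - \<tau>)) *\<^sub>R (I \<tau> *\<^sub>R g \<tau>) \<partial>lborel)"
    unfolding set_lebesgue_integral_def using t
    by (intro Bochner_Integration.integral_cong) (auto simp: indicator_def)
  also have "\<dots> = (\<integral>\<tau>. \<alpha> (t - \<tau>) *\<^sub>R (I \<tau> *\<^sub>R g \<tau>) \<partial>lborel)"
  proof (rule integral_cong_AE)
    show "(\<lambda>\<tau>. (I (t - \<tau>) * a (t - \<tau>)) *\<^sub>R (I \<tau> *\<^sub>R g \<tau>)) \<in> borel_measurable lborel"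
      using measurable_compose[of "\<lambda>\<tau>. t - \<tau>" lborel borel "\<lambda>u. I u * a u" borel] by measurable
    show "(\<lambda>\<tau>. \<alpha> (t - \<tau>) *\<^sub>R (I \<tau> *\<^sub>R g \<tau>)) \<in> borel_measurable lborel" by measurable
    show "AE \<tau> in lborel. (I (t - \<tau>) * a (t - \<tau>)) *\<^sub>R (I \<tau> *\<^sub>R g \<tau>) = \<alpha> (t - \<tau>) *\<^sub>R (I \<tau> *\<^sub>R g \<tau>)"
      using AE_lborel_reflect[OF a_eq, of t]
    proof eventually_elim
      case (elim \<tau>)
      show ?case
      proof (cases "0 \<le> \<tau> \<and> \<tau> \<le> t")
        case True
        then show ?thesis using elim t \<alpha>_eq[of "t - \<tau>"] by simp
      next
        case False
        then show ?thesis using t \<alpha>_neg[of "t - \<tau>"] by (auto simp: indicator_def)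
      qed
    qed
  qed
  finally show ?thesis .
qed

lemma K_measurable[measurable (raw)]:
  assumes [measurable]: "f \<in> borel_measurable M" "g \<in> borel_measurable M"
  shows "(\<lambda>w. K (f w) (g w)) \<in> borel_measurable M"
  unfolding K_def by measurable

lemma Rz_b0_integrable: "integrable lborel (\<lambda>v. b0 v *\<^sub>R Rz (u - v) x)"
  by (rule b0_bounded_integrable(1)[OF _ Rz_norm_le]) measurable

lemma K_norm_le: "norm (K u x) \<le> (Cb * CR) * norm x"
proof -
  have "norm (\<integral>v. b0 v *\<^sub>R Rz (u - v) x \<partial>lborel) \<le> CR * norm x * (\<integral>v. \<bar>b0 v\<bar> \<partial>lborel)"
    by (rule b0_bounded_integrable(2)[OF _ Rz_norm_le]) measurable
  moreover have "norm (c *\<^sub>R Rz u x) \<le> \<bar>c\<bar> * (CR * norm x)"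
    using mult_left_mono[OF Rz_norm_le[of u x], of "\<bar>c\<bar>"] by simp
  ultimately show ?thesis unfolding K_def Cb_def
    using norm_triangle_ineq[of "c *\<^sub>R Rz u x" "\<integral>v. b0 v *\<^sub>R Rz (u - v) x \<partial>lborel"]
    by (simp add: algebra_simps)
qed

lemma K_bounded_linear: "bounded_linear (K u)"
proof (rule bounded_linear_intro)
  fix x y r
  note lin = linear_simps[OF Rz_bounded_linear]
  show "K u (x + y) = K u x + K u y"
    unfolding K_def using Rz_b0_integrable by (simp add: lin scaleR_add_right)
  show "K u (r *\<^sub>R x) = r *\<^sub>R K u x"
    unfolding K_def by (simp add: lin scaleR_add_right mult.commute flip: integral_scaleR_right)
  show "norm (K u x) \<le> norm x * (Cb * CR)" using K_norm_le[of u x] by (simp add: mult.commute)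
qed

lemma K_neg: "u < 0 \<Longrightarrow> K u x = 0"
proof -
  assume u: "u < 0"
  then have "(\<lambda>v. b0 v *\<^sub>R Rz (u - v) x) = (\<lambda>v. 0)" by (auto simp: b0_def Rz_def indicator_def fun_eq_iff)
  then show ?thesis using u by (simp add: K_def Rz_def)
qed

text \<open>Associativity of convolution for \<open>\<alpha> = c I + b0 * I\<close>. On the right,
  \<open>G\<close> enters only through its convolution with \<open>I\<close>, the quantity that
  \<open>convolved_X_eq\<close> will identify for paths of \<open>X0\<close>.\<close>

lemma \<alpha>_conv_split:
  fixes G :: "real \<Rightarrow> 'h"
  assumes G: "integrable lborel G"
  shows "(\<integral>\<tau>. \<alpha> (t - \<tau>) *\<^sub>R G \<tau> \<partial>lborel) = c *\<^sub>R (\<integral>\<tau>. I (t - \<tau>) *\<^sub>R G \<tau> \<partial>lborel)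
    + (\<integral>v. b0 v *\<^sub>R (\<integral>\<tau>. I (t - v - \<tau>) *\<^sub>R G \<tau> \<partial>lborel) \<partial>lborel)"
proof -
  have [measurable]: "G \<in> borel_measurable borel" using borel_measurable_integrable[OF G] by simp
  define h where "h v \<tau> = (b0 v * I (t - \<tau> - v)) *\<^sub>R G \<tau>" for v \<tau>
  have hm: "(\<lambda>(v, \<tau>). h v \<tau>) \<in> borel_measurable (borel \<Otimes>\<^sub>M borel)" unfolding h_def by measurable
  have hb: "norm (h v \<tau>) \<le> \<bar>b0 v\<bar> * norm (G \<tau>)" for v \<tau>
    unfolding h_def by (auto simp: indicator_def)
  note F = Fubini_dominated[OF hm integrable_abs[OF b0_integrable] integrable_norm[OF G] hb]
  have iI: "integrable lborel (\<lambda>\<tau>. I (t - \<tau>) *\<^sub>R G \<tau>)"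
    by (rule Bochner_Integration.integrable_bound[OF G]) (auto simp: indicator_def)
  have "\<alpha> (t - \<tau>) *\<^sub>R G \<tau> = c *\<^sub>R (I (t - \<tau>) *\<^sub>R G \<tau>) + (\<integral>v. h v \<tau> \<partial>lborel)" for \<tau>
  proof -
    have "integrable lborel (\<lambda>v. b0 v * I (t - \<tau> - v))"
      using b0_bounded_integrable(1)[of "\<lambda>v. I (t - \<tau> - v)" 1] by (simp add: indicator_def)
    then show ?thesis unfolding \<alpha>_def h_def by (simp add: scaleR_add_left)
  qed
  then have "(\<integral>\<tau>. \<alpha> (t - \<tau>) *\<^sub>R G \<tau> \<partial>lborel) = (\<integral>\<tau>. c *\<^sub>R (I (t - \<tau>) *\<^sub>R G \<tau>) + (\<integral>v. h v \<tau> \<partial>lborel) \<partial>lborel)"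
    by simp
  also have "\<dots> = c *\<^sub>R (\<integral>\<tau>. I (t - \<tau>) *\<^sub>R G \<tau> \<partial>lborel) + (\<integral>\<tau>. (\<integral>v. h v \<tau> \<partial>lborel) \<partial>lborel)"
    using iI F(3) by (subst Bochner_Integration.integral_add) (auto simp del: scaleR_scaleR)
  also have "(\<integral>\<tau>. (\<integral>v. h v \<tau> \<partial>lborel) \<partial>lborel) = (\<integral>v. (\<integral>\<tau>. h v \<tau> \<partial>lborel) \<partial>lborel)" using F(1) by simp
  also have "\<dots> = (\<integral>v. b0 v *\<^sub>R (\<integral>\<tau>. I (t - v - \<tau>) *\<^sub>R G \<tau> \<partial>lborel) \<partial>lborel)"
  proof -
    have "h v \<tau> = b0 v *\<^sub>R (I (t - v - \<tau>) *\<^sub>R G \<tau>)" for v \<tau>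
    proof -
      have "t - \<tau> - v = t - v - \<tau>" by simp
      then show ?thesis by (simp only: h_def scaleR_scaleR)
    qed
    then show ?thesis by (simp del: scaleR_scaleR)
  qed
  finally show ?thesis .
qed

text \<open>The same associativity for \<open>K\<close>, arranged so that \<open>G\<close> enters
  only through its convolution with \<open>Rz\<close>. Equality of the inner convolutions here and
  in \<open>\<alpha>_conv_split\<close> therefore transfers to the outer ones.\<close>

lemma K_conv_split:
  assumes [measurable]: "G \<in> borel_measurable borel" and G: "\<And>\<tau>. norm (G \<tau>) \<le> B * I \<tau>"
  shows "(\<integral>\<tau>. K (t - \<tau>) (G \<tau>) \<partial>lborel) = c *\<^sub>R (\<integral>\<tau>. Rz (t - \<tau>) (G \<tau>) \<partial>lborel)
    + (\<integral>v. b0 v *\<^sub>R (\<integral>\<tau>. Rz (t - v - \<tau>) (G \<tau>) \<partial>lborel) \<partial>lborel)"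
proof -
  have iBI: "integrable lborel (\<lambda>\<tau>. CR * (B * I \<tau>))" using I_integrable by simp
  have RG: "norm (Rz u (G \<tau>)) \<le> CR * (B * I \<tau>)" for u \<tau>
    using order_trans[OF Rz_norm_le[of u "G \<tau>"] mult_left_mono[OF G[of \<tau>], of CR]] CR(1) by simp
  define h where "h v \<tau> = b0 v *\<^sub>R Rz (t - \<tau> - v) (G \<tau>)" for v \<tau>
  have hm: "(\<lambda>(v, \<tau>). h v \<tau>) \<in> borel_measurable (borel \<Otimes>\<^sub>M borel)" unfolding h_def by measurable
  have hb: "norm (h v \<tau>) \<le> \<bar>b0 v\<bar> * (CR * (B * I \<tau>))" for v \<tau>
    unfolding h_def using RG by (simp add: mult_left_mono)
  note F = Fubini_dominated[OF hm integrable_abs[OF b0_integrable] iBI hb]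
  have iR: "integrable lborel (\<lambda>\<tau>. Rz (t - \<tau>) (G \<tau>))"
    by (rule Bochner_Integration.integrable_bound[OF iBI]) (use order_trans[OF RG abs_ge_self] in auto)
  have "(\<integral>\<tau>. K (t - \<tau>) (G \<tau>) \<partial>lborel) = (\<integral>\<tau>. c *\<^sub>R Rz (t - \<tau>) (G \<tau>) + (\<integral>v. h v \<tau> \<partial>lborel) \<partial>lborel)"
    unfolding K_def h_def by simp
  also have "\<dots> = c *\<^sub>R (\<integral>\<tau>. Rz (t - \<tau>) (G \<tau>) \<partial>lborel) + (\<integral>\<tau>. (\<integral>v. h v \<tau> \<partial>lborel) \<partial>lborel)"
    using iR F(3) by (subst Bochner_Integration.integral_add) (auto simp del: scaleR_scaleR)
  also have "(\<integral>\<tau>. (\<integral>v. h v \<tau> \<partial>lborel) \<partial>lborel) = (\<integral>v. (\<integral>\<tau>. h v \<tau> \<partial>lborel) \<partial>lborel)" using F(1) by simp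
  also have "\<dots> = (\<integral>v. b0 v *\<^sub>R (\<integral>\<tau>. Rz (t - v - \<tau>) (G \<tau>) \<partial>lborel) \<partial>lborel)"
  proof -
    have "t - \<tau> - v = t - v - \<tau>" for \<tau> v by simp
    then show ?thesis by (simp only: h_def integral_scaleR_right)
  qed
  finally show ?thesis .
qed

section \<open>The resolvent equation in integrated form\<close>

definition Q :: "real \<Rightarrow> 'h \<Rightarrow> 'h" where "Q u x = (\<integral>\<tau>. \<alpha> (u - \<tau>) *\<^sub>R Rz \<tau> x \<partial>lborel)"

lemma Rz_integrable: "integrable lborel (\<lambda>\<tau>. Rz \<tau> x)"
proof (rule Bochner_Integration.integrable_bound)
  show "integrable lborel (\<lambda>\<tau>. CR * norm x * I \<tau>)" using I_integrable by simp
qed (use order_trans[OF Rz_norm_le_I abs_ge_self] in auto)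

lemma \<alpha>_scaleR_integrable:
  fixes G :: "real \<Rightarrow> 'k::{banach,second_countable_topology}"
  assumes G: "integrable lborel G"
  shows "integrable lborel (\<lambda>\<tau>. \<alpha> (u - \<tau>) *\<^sub>R G \<tau>)"
proof (rule Bochner_Integration.integrable_bound)
  show "integrable lborel (\<lambda>\<tau>. Cb * norm (G \<tau>))" using G by simp
  show "(\<lambda>\<tau>. \<alpha> (u - \<tau>) *\<^sub>R G \<tau>) \<in> borel_measurable lborel" using borel_measurable_integrable[OF G] by measurable
  have "norm (\<alpha> (u - \<tau>) *\<^sub>R G \<tau>) \<le> Cb * norm (G \<tau>)" for \<tau>
    using mult_right_mono[OF \<alpha>_bound[of "u - \<tau>"], of "norm (G \<tau>)"] by simp
  then show "AE \<tau> in lborel. norm (\<alpha> (u - \<tau>) *\<^sub>R G \<tau>) \<le> norm (Cb * norm (G \<tau>))"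
    unfolding real_norm_def by (intro AE_I2 order_trans[OF _ abs_ge_self])
qed

text \<open>Convolution is associative and commutative, so
  \<open>\<alpha> * R = c (1 * R) + b * 1 * R\<close> is the primitive of \<open>K\<close>. After
  Fubini, the substitution \<open>u = \<tau> + v\<close> matches the two sides.\<close>

lemma Q_eq_integral_K: "Q s y = (LINT u:{0..s}|lborel. K u y)" if s: "s \<le> T"
proof -
  define h where "h v u = (b0 v * I (s - u)) *\<^sub>R Rz (u - v) y" for v u
  have hm: "(\<lambda>(v, \<tau>). h v \<tau>) \<in> borel_measurable (borel \<Otimes>\<^sub>M borel)" unfolding h_def by measurable
  have "integrable lborel (\<lambda>u. I (s + (-1) * u))" by (rule lborel_integrable_real_affine[OF I_integrable]) simp
  then have iI: "integrable lborel (\<lambda>u. CR * norm y * I (s - u))" by simp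
  have hb: "norm (h v u) \<le> \<bar>b0 v\<bar> * (CR * norm y * I (s - u))" for v u
    unfolding h_def using Rz_norm_le[of "u - v" y] by (auto simp: indicator_def mult_left_mono)
  note F = Fubini_dominated[OF hm integrable_abs[OF b0_integrable] iI hb]
  have iR: "integrable lborel (\<lambda>u. I (s - u) *\<^sub>R Rz u y)"
    by (rule Bochner_Integration.integrable_bound[OF Rz_integrable[of y]]) (auto simp: indicator_def)
  have "(LINT u:{0..s}|lborel. K u y) = (\<integral>u. I (s - u) *\<^sub>R K u y \<partial>lborel)"
    unfolding set_lebesgue_integral_def
  proof (intro Bochner_Integration.integral_cong refl)
    fix u show "indicat_real {0..s} u *\<^sub>R K u y = I (s - u) *\<^sub>R K u y"
      using s K_neg[of u y] by (cases "u < 0") (auto simp: indicator_def)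
  qed
  also have "\<dots> = (\<integral>u. c *\<^sub>R (I (s - u) *\<^sub>R Rz u y) + (\<integral>v. h v u \<partial>lborel) \<partial>lborel)"
  proof (intro Bochner_Integration.integral_cong refl)
    fix u
    have "(\<integral>v. h v u \<partial>lborel) = I (s - u) *\<^sub>R (\<integral>v. b0 v *\<^sub>R Rz (u - v) y \<partial>lborel)"
      unfolding h_def by (simp add: mult.commute flip: integral_scaleR_right)
    then show "I (s - u) *\<^sub>R K u y = c *\<^sub>R (I (s - u) *\<^sub>R Rz u y) + (\<integral>v. h v u \<partial>lborel)"
      by (simp add: K_def scaleR_add_right mult.commute)
  qed
  also have "\<dots> = c *\<^sub>R (\<integral>u. I (s - u) *\<^sub>R Rz u y \<partial>lborel) + (\<integral>u. (\<integral>v. h v u \<partial>lborel) \<partial>lborel)"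
    using iR F(3) by (subst Bochner_Integration.integral_add) (auto simp del: scaleR_scaleR)
  also have "(\<integral>u. (\<integral>v. h v u \<partial>lborel) \<partial>lborel) = (\<integral>v. (\<integral>u. h v u \<partial>lborel) \<partial>lborel)" using F(1) by simp
  also have "\<dots> = (\<integral>v. b0 v *\<^sub>R (\<integral>\<tau>. I (s - v - \<tau>) *\<^sub>R Rz \<tau> y \<partial>lborel) \<partial>lborel)"
  proof (intro Bochner_Integration.integral_cong refl)
    fix v
    have "(\<integral>u. h v u \<partial>lborel) = (\<integral>u. (\<lambda>\<tau>. (b0 v * I (s - v - \<tau>)) *\<^sub>R Rz \<tau> y) (u - v) \<partial>lborel)"
      unfolding h_def by (intro Bochner_Integration.integral_cong refl) simp
    also have "\<dots> = (\<integral>\<tau>. (b0 v * I (s - v - \<tau>)) *\<^sub>R Rz \<tau> y \<partial>lborel)" by (rule lborel_integral_shift)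
    also have "\<dots> = b0 v *\<^sub>R (\<integral>\<tau>. I (s - v - \<tau>) *\<^sub>R Rz \<tau> y \<partial>lborel)" by (simp flip: integral_scaleR_right)
    finally show "(\<integral>u. h v u \<partial>lborel) = b0 v *\<^sub>R (\<integral>\<tau>. I (s - v - \<tau>) *\<^sub>R Rz \<tau> y \<partial>lborel)" .
  qed
  finally show ?thesis unfolding Q_def \<alpha>_conv_split[OF Rz_integrable] by simp
qed

lemma Q_bounded_linear: "bounded_linear (Q u)"
proof (rule bounded_linear_intro)
  fix x y r
  note lin = linear_simps[OF Rz_bounded_linear]
  show "Q u (x + y) = Q u x + Q u y"
    unfolding Q_def using \<alpha>_scaleR_integrable[OF Rz_integrable] by (simp add: lin scaleR_add_right)
  show "Q u (r *\<^sub>R x) = r *\<^sub>R Q u x"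
    unfolding Q_def by (simp add: lin mult.commute flip: integral_scaleR_right)
  have int: "integrable lborel (\<lambda>\<tau>. Cb * CR * norm x * I \<tau>)" using I_integrable by simp
  have "norm (\<alpha> (u - \<tau>) *\<^sub>R Rz \<tau> x) \<le> Cb * CR * norm x * I \<tau>" for \<tau>
    using mult_mono[OF \<alpha>_bound[of "u - \<tau>"] Rz_norm_le_I[of \<tau> x]] order_trans[OF abs_ge_zero \<alpha>_bound]
    by (simp add: mult.assoc)
  then have "norm (Q u x) \<le> (\<integral>\<tau>. Cb * CR * norm x * I \<tau> \<partial>lborel)"
    unfolding Q_def
    by (intro order_trans[OF integral_norm_bound integral_mono[OF integrable_norm[OF \<alpha>_scaleR_integrable[OF Rz_integrable]] int]])
  then show "norm (Q u x) \<le> norm x * (Cb * CR * (\<integral>\<tau>. I \<tau> \<partial>lborel))" by (simp add: mult_ac)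
qed

text \<open>\<open>R \<tau>\<close> commutes with \<open>A\<close> on \<open>D\<close>, which brings
  \<open>A\<close> to the fixed vector \<open>x\<close> and leaves the bounded operator
  \<open>Q u\<close> outside.\<close>

lemma R_eq_Q:
  assumes "x \<in> D" "u \<in> {0..T}"
  shows "R u x = x + Q u (A x)"
proof -
  have "R u x = x + (LINT \<tau>:{0..u}|lborel. a (u - \<tau>) *\<^sub>R A (R \<tau> x))"
    using R_res assms by (simp add: resolvent_family_def)
  also have "(LINT \<tau>:{0..u}|lborel. a (u - \<tau>) *\<^sub>R A (R \<tau> x)) = (LINT \<tau>:{0..u}|lborel. a (u - \<tau>) *\<^sub>R R \<tau> (A x))"
    using R_res assms by (intro set_lebesgue_integral_cong) (auto simp: resolvent_family_def)
  also have "\<dots> = (\<integral>\<tau>. \<alpha> (u - \<tau>) *\<^sub>R (I \<tau> *\<^sub>R R \<tau> (A x)) \<partial>lborel)"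
    using Rz_measurable[of "\<lambda>u. u" borel "\<lambda>_. A x"] by (intro a_conv_eq assms) (simp add: Rz_def)
  also have "\<dots> = Q u (A x)" by (simp add: Q_def Rz_def)
  finally show ?thesis .
qed

lemma Q_inner:
  "inner (Q u x) \<zeta> = (\<integral>\<tau>. \<alpha> (u - \<tau>) * inner (Rz \<tau> x) \<zeta> \<partial>lborel)"
proof -
  have "inner (Q u x) \<zeta> = (\<integral>\<tau>. inner (\<alpha> (u - \<tau>) *\<^sub>R Rz \<tau> x) \<zeta> \<partial>lborel)"
    unfolding Q_def by (intro integral_inner_left[symmetric] \<alpha>_scaleR_integrable Rz_integrable)
  then show ?thesis by simp
qed

text \<open>Moving \<open>A\<close> to the test vector leaves bounded operators only, so the
  identity extends from \<open>D\<close> to all \<open>x\<close> by density.\<close>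

lemma R_weak:
  assumes \<xi>: "\<xi> \<in> adj_dom D A" and u: "u \<in> {0..T}"
  shows "inner (R u x) \<xi> = inner x \<xi> + inner (Q u x) (adj_op D A \<xi>)"
proof -
  have Rc: "continuous_on UNIV (R u)" and Qc: "continuous_on UNIV (Q u)"
    using R_bounded_linear[of u] Q_bounded_linear u by (auto intro: linear_continuous_on)
  let ?S = "{x. inner (R u x) \<xi> = inner x \<xi> + inner (Q u x) (adj_op D A \<xi>)}"
  have "closed ?S" by (intro closed_Collect_eq continuous_intros Rc Qc)
  moreover have "D \<subseteq> ?S"
  proof
    fix x assume x: "x \<in> D"
    have "inner (Rz \<tau> (A x)) \<xi> = inner (Rz \<tau> x) (adj_op D A \<xi>)" for \<tau>
    proof (cases "\<tau> \<in> {0..T}")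
      case True
      then have "R \<tau> x \<in> D" "A (R \<tau> x) = R \<tau> (A x)" using R_res x by (auto simp: resolvent_family_def)
      then show ?thesis using adj_op_inner[OF A_op \<xi>, of "R \<tau> x"] by (simp add: Rz_def)
    qed (simp add: Rz_def)
    then have "inner (Q u (A x)) \<xi> = inner (Q u x) (adj_op D A \<xi>)" by (simp add: Q_inner)
    then show "x \<in> ?S" using R_eq_Q[OF x u] by (simp add: inner_add_left)
  qed
  ultimately have "closure D \<subseteq> ?S" by (rule closure_minimal[rotated])
  then show ?thesis using A_op by (auto simp: closed_densely_defined_def)
qed

text \<open>Formally, \<open>1 * X = (R - A (a * R)) * X = R * (X - A (a * X)) = R * Z\<close>. The
  hypothesis \<open>eq\<close> is the weak equation at \<open>\<tau>\<close>, tested with the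
  adjoint of \<open>R (r - \<tau>)\<close> applied to \<open>\<xi>\<close>. Integrating it over
  \<open>\<tau>\<close> and expanding the left side by \<open>R_weak\<close> produces the double
  integral of \<open>h\<close> on both sides, in the two orders, and these cancel by Fubini.\<close>

lemma convolved_identity:
  assumes \<xi>: "\<xi> \<in> adj_dom D A" and r: "r \<in> {0..T}"
    and X: "integrable lborel X0" "\<And>\<tau>. \<tau> \<notin> {0..T} \<Longrightarrow> X0 \<tau> = 0"
    and Zm[measurable]: "Z0 \<in> borel_measurable borel" and Z: "\<And>\<tau>. norm (Z0 \<tau>) \<le> B * I \<tau>"
    and eq: "AE \<tau> in lborel. \<tau> \<in> {0..r} \<longrightarrow> inner (R (r - \<tau>) (X0 \<tau>)) \<xi>
      = (\<integral>\<sigma>. \<alpha> (\<tau> - \<sigma>) * inner (R (r - \<tau>) (X0 \<sigma>)) (adj_op D A \<xi>) \<partial>lborel) + inner (R (r - \<tau>) (Z0 \<tau>)) \<xi>"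
  shows "inner (\<integral>\<tau>. I (r - \<tau>) *\<^sub>R X0 \<tau> \<partial>lborel) \<xi> = inner (\<integral>\<tau>. Rz (r - \<tau>) (Z0 \<tau>) \<partial>lborel) \<xi>"
proof -
  define \<eta> where "\<eta> = adj_op D A \<xi>"
  have [measurable]: "X0 \<in> borel_measurable borel" using borel_measurable_integrable[OF X(1)] by simp
  define h where "h \<tau> \<sigma> = \<alpha> (\<tau> - \<sigma>) * inner (Rz (r - \<tau>) (X0 \<sigma>)) \<eta>" for \<tau> \<sigma>
  have hm: "(\<lambda>(\<tau>, \<sigma>). h \<tau> \<sigma>) \<in> borel_measurable (borel \<Otimes>\<^sub>M borel)" unfolding h_def by measurable
  have "integrable lborel (\<lambda>u. I (r + (-1) * u))" by (rule lborel_integrable_real_affine[OF I_integrable]) simp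
  then have iI: "integrable lborel (\<lambda>\<tau>. Cb * CR * norm \<eta> * I (r - \<tau>))" by simp
  have Cb0: "0 \<le> Cb" using order_trans[OF abs_ge_zero \<alpha>_bound] .
  have hb: "norm (h \<tau> \<sigma>) \<le> (Cb * CR * norm \<eta> * I (r - \<tau>)) * norm (X0 \<sigma>)" for \<tau> \<sigma>
  proof -
    have "\<bar>inner (Rz (r - \<tau>) (X0 \<sigma>)) \<eta>\<bar> \<le> norm (Rz (r - \<tau>) (X0 \<sigma>)) * norm \<eta>" by (rule Cauchy_Schwarz_ineq2)
    also have "\<dots> \<le> (CR * norm (X0 \<sigma>) * I (r - \<tau>)) * norm \<eta>" by (intro mult_right_mono Rz_norm_le_I) simp
    finally have "\<bar>\<alpha> (\<tau> - \<sigma>)\<bar> * \<bar>inner (Rz (r - \<tau>) (X0 \<sigma>)) \<eta>\<bar> \<le> Cb * ((CR * norm (X0 \<sigma>) * I (r - \<tau>)) * norm \<eta>)"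
      using \<alpha>_bound Cb0 by (intro mult_mono) auto
    then show ?thesis by (simp add: h_def abs_mult mult_ac)
  qed
  note F = Fubini_dominated[OF hm iI integrable_norm[OF X(1)] hb]
  have QX: "inner (Q (r - \<sigma>) (X0 \<sigma>)) \<eta> = (\<integral>\<tau>. h \<tau> \<sigma> \<partial>lborel)" for \<sigma>
  proof -
    have "inner (Q (r - \<sigma>) (X0 \<sigma>)) \<eta> = (\<integral>\<tau>. \<alpha> (r - \<sigma> - \<tau>) * inner (Rz \<tau> (X0 \<sigma>)) \<eta> \<partial>lborel)" by (rule Q_inner)
    also have "\<dots> = (\<integral>\<tau>. (\<lambda>\<tau>. \<alpha> (r - \<sigma> - \<tau>) * inner (Rz \<tau> (X0 \<sigma>)) \<eta>) (r - \<tau>) \<partial>lborel)"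
      by (rule lborel_integral_reflect[symmetric])
    finally show ?thesis by (simp add: h_def)
  qed
  have iX: "integrable lborel (\<lambda>\<tau>. I (r - \<tau>) *\<^sub>R X0 \<tau>)"
    by (rule Bochner_Integration.integrable_bound[OF X(1)]) (auto simp: indicator_def)
  have iZ: "integrable lborel (\<lambda>\<tau>. Rz (r - \<tau>) (Z0 \<tau>))"
  proof (rule Bochner_Integration.integrable_bound)
    show "integrable lborel (\<lambda>\<tau>. CR * (B * I \<tau>))" using I_integrable by simp
    have "norm (Rz (r - \<tau>) (Z0 \<tau>)) \<le> CR * (B * I \<tau>)" for \<tau>
      using order_trans[OF Rz_norm_le[of "r - \<tau>" "Z0 \<tau>"] mult_left_mono[OF Z[of \<tau>], of CR]] CR(1) by simp
    then show "AE \<tau> in lborel. norm (Rz (r - \<tau>) (Z0 \<tau>)) \<le> norm (CR * (B * I \<tau>))"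
      unfolding real_norm_def by (intro AE_I2 order_trans[OF _ abs_ge_self])
  qed measurable
  \<comment> \<open>Outside \<open>[0, r]\<close> every term vanishes, by the cut-offs and because
    \<open>\<alpha>\<close> is zero on negative arguments; so the identity can be integrated over
    the whole line.\<close>
  have ae: "AE \<tau> in lborel. inner (I (r - \<tau>) *\<^sub>R X0 \<tau>) \<xi> + (\<integral>\<sigma>. h \<sigma> \<tau> \<partial>lborel)
      = (\<integral>\<sigma>. h \<tau> \<sigma> \<partial>lborel) + inner (Rz (r - \<tau>) (Z0 \<tau>)) \<xi>"
    using eq
  proof eventually_elim
    case (elim \<tau>)
    consider "\<tau> < 0" | "\<tau> > r" | "\<tau> \<in> {0..r}" by fastforce
    then show ?case
    proof cases
      case 1
      have "h \<tau> \<sigma> = 0" for \<sigma>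
        using 1 \<alpha>_neg[of "\<tau> - \<sigma>"] X(2)[of \<sigma>] by (cases "\<sigma> < 0") (auto simp: h_def linear_simps[OF Rz_bounded_linear])
      moreover have "X0 \<tau> = 0" "Z0 \<tau> = 0" using 1 X(2)[of \<tau>] Z[of \<tau>] by auto
      moreover from this have "h \<sigma> \<tau> = 0" for \<sigma> by (simp add: h_def linear_simps[OF Rz_bounded_linear])
      ultimately show ?thesis by (simp add: linear_simps[OF Rz_bounded_linear])
    next
      case 2
      then have "h \<tau> \<sigma> = 0" "h \<sigma> \<tau> = 0" for \<sigma>
        using \<alpha>_neg[of "\<sigma> - \<tau>"] by (cases "\<sigma> \<le> r"; auto simp: h_def Rz_def)+
      then show ?thesis using 2 by (simp add: Rz_def)
    next
      case 3
      then have in_T: "r - \<tau> \<in> {0..T}" using r by auto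
      then have "Rz (r - \<tau>) = R (r - \<tau>)" by (auto simp: Rz_def)
      then show ?thesis
        using elim 3 R_weak[OF \<xi> in_T, of "X0 \<tau>"] in_T QX[of \<tau>] by (simp add: h_def \<eta>_def)
    qed
  qed
  have "inner (\<integral>\<tau>. I (r - \<tau>) *\<^sub>R X0 \<tau> \<partial>lborel) \<xi> + (\<integral>\<tau>. (\<integral>\<sigma>. h \<sigma> \<tau> \<partial>lborel) \<partial>lborel)
      = (\<integral>\<tau>. inner (I (r - \<tau>) *\<^sub>R X0 \<tau>) \<xi> + (\<integral>\<sigma>. h \<sigma> \<tau> \<partial>lborel) \<partial>lborel)"
    using iX F(3) by (subst Bochner_Integration.integral_add) (auto simp del: inner_scaleR_left)
  also have "\<dots> = (\<integral>\<tau>. (\<integral>\<sigma>. h \<tau> \<sigma> \<partial>lborel) + inner (Rz (r - \<tau>) (Z0 \<tau>)) \<xi> \<partial>lborel)"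
    using iX iZ F(2,3) by (intro integral_cong_AE[OF _ _ ae] borel_measurable_integrable Bochner_Integration.integrable_add)
      (auto simp del: inner_scaleR_left)
  also have "\<dots> = (\<integral>\<tau>. (\<integral>\<sigma>. h \<tau> \<sigma> \<partial>lborel) \<partial>lborel) + inner (\<integral>\<tau>. Rz (r - \<tau>) (Z0 \<tau>) \<partial>lborel) \<xi>"
    using iZ F(2) by (subst Bochner_Integration.integral_add) auto
  finally show ?thesis using F(1) by simp
qed

text \<open>In place of differentiating \<open>1 * a * X = a * R * Z\<close>, the two splittings are
  compared. They involve the inner convolutions only at \<open>t\<close> and at \<open>t - v\<close>
  with \<open>v \<ge> 0\<close>, as \<open>b0\<close> vanishes on negative numbers, and the latter
  are integrated over \<open>v\<close>; this is why one identity is exact and the other only almost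
  everywhere.\<close>

lemma \<alpha>_conv_eq_K_conv:
  assumes X: "integrable lborel X0"
    and Zm[measurable]: "Z0 \<in> borel_measurable borel" and Z: "\<And>\<tau>. norm (Z0 \<tau>) \<le> B * I \<tau>"
    and t: "(\<integral>\<tau>. I (t - \<tau>) *\<^sub>R X0 \<tau> \<partial>lborel) = (\<integral>\<tau>. Rz (t - \<tau>) (Z0 \<tau>) \<partial>lborel)"
    and ae: "AE r in lborel. r \<le> t \<longrightarrow> (\<integral>\<tau>. I (r - \<tau>) *\<^sub>R X0 \<tau> \<partial>lborel) = (\<integral>\<tau>. Rz (r - \<tau>) (Z0 \<tau>) \<partial>lborel)"
  shows "(\<integral>\<tau>. \<alpha> (t - \<tau>) *\<^sub>R X0 \<tau> \<partial>lborel) = (\<integral>\<tau>. K (t - \<tau>) (Z0 \<tau>) \<partial>lborel)"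
proof -
  have [measurable]: "X0 \<in> borel_measurable borel" using borel_measurable_integrable[OF X(1)] by simp
  have "AE v in lborel. b0 v *\<^sub>R (\<integral>\<tau>. I (t - v - \<tau>) *\<^sub>R X0 \<tau> \<partial>lborel) = b0 v *\<^sub>R (\<integral>\<tau>. Rz (t - v - \<tau>) (Z0 \<tau>) \<partial>lborel)"
    using AE_lborel_reflect[OF ae, of t]
  proof eventually_elim
    case (elim v)
    then show ?case by (cases "v < 0") (auto simp: b0_def)
  qed
  then have "(\<integral>v. b0 v *\<^sub>R (\<integral>\<tau>. I (t - v - \<tau>) *\<^sub>R X0 \<tau> \<partial>lborel) \<partial>lborel) = (\<integral>v. b0 v *\<^sub>R (\<integral>\<tau>. Rz (t - v - \<tau>) (Z0 \<tau>) \<partial>lborel) \<partial>lborel)"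
    by (intro integral_cong_AE) measurable
  then show ?thesis unfolding \<alpha>_conv_split[OF X] K_conv_split[OF Zm Z] t by simp
qed

end

section \<open>Convergence in probability and measurability\<close>

lemma levy_process_cadlag: "levy_process M Z \<Longrightarrow> \<omega> \<in> space M \<Longrightarrow> cadlag (\<lambda>s. Z s \<omega>)"
  by (simp add: levy_process_def cadlag_def)

lemma levy_process_increments: "levy_process M Z \<Longrightarrow> stationary_indep_increments M Z"
  by (simp add: levy_process_def stationary_indep_increments_def)

text \<open>Applied to the identity minus \<open>P N\<close>, it makes the moment estimates
  available for the remainder \<open>Z - P N Z\<close>.\<close>

lemma (in prob_space) stationary_indep_increments_linear:
  fixes Z :: "real \<Rightarrow> 'a \<Rightarrow> 'h::{real_normed_vector,second_countable_topology}"
    and L :: "'h \<Rightarrow> 'k::{real_normed_vector,second_countable_topology}"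
  assumes Z: "stationary_indep_increments M Z" and L: "bounded_linear L"
  shows "stationary_indep_increments M (\<lambda>s \<omega>. L (Z s \<omega>))"
proof -
  interpret L: bounded_linear L by (rule L)
  have Lm[measurable]: "L \<in> borel_measurable borel"
    by (intro borel_measurable_continuous_onI linear_continuous_on L)
  have Zm: "\<And>t. 0 \<le> t \<Longrightarrow> Z t \<in> borel_measurable M"
    and Z0: "\<And>\<omega>. \<omega> \<in> space M \<Longrightarrow> Z 0 \<omega> = 0"
    and Zi: "\<And>n ts. 0 \<le> ts 0 \<Longrightarrow> (\<And>i. i < n \<Longrightarrow> ts i < ts (Suc i)) \<Longrightarrow>
         indep_vars (\<lambda>_. borel) (\<lambda>i \<omega>. Z (ts (Suc i)) \<omega> - Z (ts i) \<omega>) {..<n}"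
    and Zd: "\<And>s t. 0 \<le> s \<Longrightarrow> s \<le> t \<Longrightarrow>
         distr M borel (\<lambda>\<omega>. Z t \<omega> - Z s \<omega>) = distr M borel (Z (t - s))"
    using Z by (auto simp: stationary_indep_increments_def)
  have ind: "indep_vars (\<lambda>_. borel) (\<lambda>i \<omega>. L (Z (ts (Suc i)) \<omega>) - L (Z (ts i) \<omega>)) {..<n}"
    if "0 \<le> ts 0" "\<And>i. i < n \<Longrightarrow> ts i < ts (Suc i)" for n and ts :: "nat \<Rightarrow> real"
    using indep_vars_compose2[OF Zi[OF that], where Y="\<lambda>_. L" and N="\<lambda>_. borel"] by (simp add: L.diff)
  have dis: "distr M borel (\<lambda>\<omega>. L (Z t \<omega>) - L (Z s \<omega>)) = distr M borel (\<lambda>\<omega>. L (Z (t - s) \<omega>))"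
    if st: "0 \<le> s" "s \<le> t" for s t
  proof -
    have [measurable]: "Z t \<in> borel_measurable M" "Z s \<in> borel_measurable M" "Z (t - s) \<in> borel_measurable M"
      using Zm st by auto
    have "distr M borel (\<lambda>\<omega>. L (Z t \<omega>) - L (Z s \<omega>)) = distr (distr M borel (\<lambda>\<omega>. Z t \<omega> - Z s \<omega>)) borel L"
      by (subst distr_distr) (simp_all add: comp_def L.diff)
    also have "\<dots> = distr M borel (\<lambda>\<omega>. L (Z (t - s) \<omega>))"
      unfolding Zd[OF st] by (subst distr_distr) (simp_all add: comp_def)
    finally show ?thesis .
  qed
  show ?thesis unfolding stationary_indep_increments_def
    using Zm Z0 ind dis by (auto simp: L.zero intro: measurable_compose[OF _ Lm])
qed

text \<open>Lower semicontinuity of the norm under weak limits, in probabilistic form. If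
  \<open>norm (V \<omega>) > r\<close>, the open condition
  \<open>r * norm \<xi> < inner (V \<omega>) \<xi>\<close> holds at
  \<open>\<xi> = V \<omega>\<close>, hence at some element of the dense set, and it passes to
  \<open>E m \<omega>\<close> for all large \<open>m\<close>. The events \<open>B k\<close> express
  this and increase with \<open>k\<close>, so the bound \<open>q\<close> survives in the
  limit.\<close>

lemma (in prob_space) weak_limit_prob_le:
  fixes E :: "nat \<Rightarrow> 'a \<Rightarrow> 'h::{real_inner,second_countable_topology}"
  assumes [measurable]: "\<And>m. E m \<in> borel_measurable M" "V \<in> borel_measurable M"
    and \<Xi>: "closure \<Xi> = UNIV"
    and lim: "AE \<omega> in M. \<forall>\<xi>\<in>\<Xi>. (\<lambda>m. inner (E m \<omega>) \<xi>) \<longlonglongrightarrow> inner (V \<omega>) \<xi>"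
    and r: "0 \<le> r" and q: "\<And>m. prob {\<omega>\<in>space M. norm (E m \<omega>) > r} \<le> q"
  shows "prob {\<omega>\<in>space M. norm (V \<omega>) > r} \<le> q"
proof -
  define B where "B k = {\<omega>\<in>space M. \<forall>m\<ge>k. norm (E m \<omega>) > r}" for k
  have Bs[measurable]: "B k \<in> events" for k unfolding B_def by measurable
  have "prob {\<omega>\<in>space M. norm (V \<omega>) > r} \<le> prob (\<Union>k. B k)"
  proof (rule finite_measure_mono_AE)
    show "AE \<omega> in M. \<omega> \<in> {\<omega>\<in>space M. norm (V \<omega>) > r} \<longrightarrow> \<omega> \<in> (\<Union>k. B k)"
      using lim AE_space
    proof eventually_elim
      case (elim \<omega>)
      show ?case
      proof
        assume "\<omega> \<in> {\<omega>\<in>space M. norm (V \<omega>) > r}"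
        then have V: "norm (V \<omega>) > r" by simp
        let ?O = "{\<xi>. r * norm \<xi> < inner (V \<omega>) \<xi>}"
        have "open ?O" by (intro open_Collect_less continuous_intros)
        moreover have "V \<omega> \<in> ?O"
          using V r by (auto simp: dot_square_norm power2_eq_square intro!: mult_strict_right_mono)
        ultimately obtain \<xi> where \<xi>: "\<xi> \<in> \<Xi>" "r * norm \<xi> < inner (V \<omega>) \<xi>"
          using \<Xi> closure_approachable open_Int_closure_eq_empty[of ?O \<Xi>] by auto
        have "eventually (\<lambda>m. r * norm \<xi> < inner (E m \<omega>) \<xi>) sequentially"
          using elim(1) \<xi> by (intro order_tendstoD) auto
        then obtain k where k: "\<And>m. m \<ge> k \<Longrightarrow> r * norm \<xi> < inner (E m \<omega>) \<xi>"
          by (auto simp: eventually_sequentially)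
        have "norm (E m \<omega>) > r" if "m \<ge> k" for m
        proof -
          have "r * norm \<xi> < norm (E m \<omega>) * norm \<xi>"
            using k[OF that] norm_cauchy_schwarz[of "E m \<omega>" \<xi>] by linarith
          then show ?thesis by (simp add: mult_less_cancel_right)
        qed
        then show "\<omega> \<in> (\<Union>k. B k)" using elim(2) by (auto simp: B_def)
      qed
    qed
  qed auto
  also have "prob (\<Union>k. B k) \<le> q"
  proof (rule LIMSEQ_le_const2)
    show "(\<lambda>k. prob (B k)) \<longlonglongrightarrow> prob (\<Union>k. B k)"
      by (intro finite_Lim_measure_incseq) (auto simp: incseq_def B_def)
    have "prob (B k) \<le> q" for k
      by (rule order_trans[OF finite_measure_mono q[of k]]) (auto simp: B_def)
    then show "\<exists>N. \<forall>n\<ge>N. prob (B n) \<le> q" by blast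
  qed
  finally show ?thesis .
qed

lemma (in prob_space) pointwise_limit_in_prob:
  fixes S :: "nat \<Rightarrow> 'a \<Rightarrow> 'h::{real_normed_vector,second_countable_topology}"
  assumes [measurable]: "\<And>m. S m \<in> borel_measurable M" "L \<in> borel_measurable M"
    and lim: "\<And>\<omega>. \<omega> \<in> space M \<Longrightarrow> (\<lambda>m. S m \<omega>) \<longlonglongrightarrow> L \<omega>" and r: "0 < r"
  shows "(\<lambda>m. prob {\<omega>\<in>space M. norm (S m \<omega> - L \<omega>) > r}) \<longlonglongrightarrow> 0"
proof -
  define B where "B k = {\<omega>\<in>space M. \<exists>m\<ge>k. norm (S m \<omega> - L \<omega>) > r}" for k
  have Bs[measurable]: "B k \<in> events" for k unfolding B_def by measurable
  have "(\<lambda>k. prob (B k)) \<longlonglongrightarrow> prob (\<Inter>k. B k)"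
    by (intro finite_Lim_measure_decseq) (auto simp: decseq_def B_def intro: order_trans)
  moreover have "(\<Inter>k. B k) = {}"
  proof -
    have "\<omega> \<notin> (\<Inter>k. B k)" for \<omega>
    proof
      assume a: "\<omega> \<in> (\<Inter>k. B k)"
      then have "\<omega> \<in> space M" by (auto simp: B_def)
      from lim[OF this] r obtain k where "\<And>m. m \<ge> k \<Longrightarrow> norm (S m \<omega> - L \<omega>) < r"
        by (auto simp: LIMSEQ_iff)
      moreover have "\<omega> \<in> B k" using a by blast
      ultimately show False by (force simp: B_def)
    qed
    then show ?thesis by blast
  qed
  ultimately have "(\<lambda>k. prob (B k)) \<longlonglongrightarrow> 0" by simp
  then show ?thesis
    by (rule tendsto_sandwich[OF _ _ tendsto_const, rotated 2])
      (auto intro!: always_eventually finite_measure_mono simp: B_def)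
qed

lemma predictable_jointly_measurable:
  fixes X :: "real \<Rightarrow> 'w \<Rightarrow> 'h::{real_normed_vector,second_countable_topology}"
  assumes F: "filtration_of M F" and X: "predictable M F T X"
  shows "(\<lambda>(t, \<omega>). indicator {0..T} t *\<^sub>R X t \<omega>) \<in> borel_measurable (borel \<Otimes>\<^sub>M M)"
proof -
  let ?\<Omega> = "{0..T} \<times> space M"
  let ?G = "{{s<..t} \<times> A | s t A. 0 \<le> s \<and> s < t \<and> t \<le> T \<and> A \<in> sets (F s)} \<union> {{0} \<times> A | A. A \<in> sets (F 0)}"
  let ?N = "restrict_space (borel \<Otimes>\<^sub>M M) ?\<Omega>"
  let ?f = "\<lambda>(t, \<omega>). X t \<omega>"
  have FM: "A \<in> sets M" if "A \<in> sets (F s)" for A s using F that by (auto simp: filtration_of_def)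
  have \<Omega>: "?\<Omega> \<in> sets (borel \<Otimes>\<^sub>M M)" by simp
  have sp: "space ?N = ?\<Omega>" by (auto simp: space_restrict_space space_pair_measure)
  show ?thesis
  proof (cases "0 \<le> T")
    case False
    then have "(\<lambda>(t, \<omega>). indicator {0..T} t *\<^sub>R X t \<omega>) = (\<lambda>_. 0)" by auto
    then show ?thesis by simp
  next
    case True
    have sub: "?G \<subseteq> sets ?N"
    proof
      fix B assume "B \<in> ?G"
      then have "B \<in> sets (borel \<Otimes>\<^sub>M M) \<and> B \<subseteq> ?\<Omega>"
        using FM True sets.sets_into_space[OF FM] by (auto simp: subset_eq)
      then show "B \<in> sets ?N" using \<Omega> by (simp add: sets_restrict_space_iff)
    qed
    have Pow: "?G \<subseteq> Pow ?\<Omega>" using order_trans[OF sub sets.space_closed] unfolding sp .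
    have "?f \<in> borel_measurable ?N"
    proof (rule measurableI)
      fix B :: "'h set" assume B: "B \<in> sets borel"
      have "?f -` B \<inter> space (predictable_sigma M F T) \<in> sets (predictable_sigma M F T)"
        using X B unfolding predictable_def by (rule measurable_sets)
      then have "?f -` B \<inter> ?\<Omega> \<in> sigma_sets ?\<Omega> ?G"
        unfolding predictable_sigma_def using Pow by (simp add: sets_measure_of space_measure_of)
      also have "\<dots> \<subseteq> sets ?N" using sets.sigma_sets_subset[OF sub] sp by simp
      finally show "?f -` B \<inter> space ?N \<in> sets ?N" using sp by simp
    qed simp
    then have "(\<lambda>p. indicator ?\<Omega> p *\<^sub>R ?f p) \<in> borel_measurable (borel \<Otimes>\<^sub>M M)"
      using \<Omega> by (subst (asm) borel_measurable_restrict_space_iff) (auto simp: space_pair_measure)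
    then show ?thesis
      by (rule measurable_cong[THEN iffD1, rotated]) (auto simp: space_pair_measure indicator_def)
  qed
qed

text \<open>On each path some index works, but it depends on \<open>\<omega>\<close>. The
  exceptional events decrease to the empty set, so continuity of the probability measure gives one
  index outside an event of probability at most \<open>q\<close>.\<close>

lemma (in prob_space) uniform_approx_event:
  fixes Z :: "real \<Rightarrow> 'a \<Rightarrow> 'h::{real_normed_vector,second_countable_topology}" and P :: "nat \<Rightarrow> 'h \<Rightarrow> 'h"
  assumes Zm: "\<And>s. 0 \<le> s \<Longrightarrow> Z s \<in> borel_measurable M"
    and cad: "\<And>\<omega>. \<omega> \<in> space M \<Longrightarrow> cadlag (\<lambda>s. Z s \<omega>)"
    and P: "\<And>N. bounded_linear (P N)" "\<And>N x. norm (x - P N x) \<le> norm x"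
      "\<And>x. decseq (\<lambda>N. norm (x - P N x))" "\<And>x. (\<lambda>N. P N x) \<longlonglongrightarrow> x"
    and t: "0 < t" and \<epsilon>: "0 < \<epsilon>" and q: "0 < q"
  obtains N E where "E \<in> events" "prob E \<le> q"
    "\<And>\<omega> s. \<omega> \<in> space M - E \<Longrightarrow> s \<in> {0..t} \<Longrightarrow> norm (Z s \<omega> - P N (Z s \<omega>)) \<le> \<epsilon>"
proof -
  \<comment> \<open>Right continuity reduces the uncountable union over times to a countable one.
    The endpoint \<open>t\<close> is added separately, since it has no times to its right in the
    interval.\<close>
  define Qs where "Qs = insert t ({0..t} \<inter> \<rat>)"
  have Qs: "countable Qs" "Qs \<subseteq> {0..t}" using t by (auto simp: Qs_def countable_rat)
  define E where "E N = (\<Union>s\<in>Qs. {\<omega>\<in>space M. \<epsilon> < norm (Z s \<omega> - P N (Z s \<omega>))})" for N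
  have Pm[measurable]: "P N \<in> borel_measurable borel" for N
    by (intro borel_measurable_continuous_onI linear_continuous_on P)
  have Es: "E N \<in> events" for N unfolding E_def
  proof (rule sets.countable_UN''[OF Qs(1)])
    fix s assume "s \<in> Qs"
    then have [measurable]: "Z s \<in> borel_measurable M" using Zm Qs by auto
    show "{\<omega>\<in>space M. \<epsilon> < norm (Z s \<omega> - P N (Z s \<omega>))} \<in> events" by measurable
  qed
  have dec: "decseq E"
  proof (rule decseq_SucI)
    fix N
    have "norm (x - P (Suc N) x) \<le> norm (x - P N x)" for x using P(3)[of x] by (simp add: decseq_Suc_iff)
    then show "E (Suc N) \<subseteq> E N" unfolding E_def by (fastforce intro: less_le_trans)
  qed
  have "(\<Inter>N. E N) = {}"
  proof -
    have "\<exists>N. \<omega> \<notin> E N" for \<omega>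
    proof (cases "\<omega> \<in> space M")
      case True
      obtain N where "\<forall>s\<in>{0..t}. norm (Z s \<omega> - P N (Z s \<omega>)) \<le> \<epsilon>"
        using cadlag_uniform_approx[OF cad[OF True] \<epsilon> P] by blast
      then have "\<omega> \<notin> E N" using Qs(2) by (force simp: E_def)
      then show ?thesis by blast
    qed (auto simp: E_def)
    then show ?thesis by blast
  qed
  then have "(\<lambda>N. prob (E N)) \<longlonglongrightarrow> 0" using finite_Lim_measure_decseq[of E] Es dec by auto
  then have "eventually (\<lambda>N. prob (E N) < q) sequentially" using q by (intro order_tendstoD)
  then obtain N where N: "prob (E N) < q" by (auto simp: eventually_sequentially)
  show ?thesis
  proof (rule that[OF Es[of N]])
    show "prob (E N) \<le> q" using N by simp
    fix \<omega> s assume \<omega>: "\<omega> \<in> space M - E N" and s: "s \<in> {0..t}"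
    let ?g = "\<lambda>s. norm (Z s \<omega> - P N (Z s \<omega>))"
    have on_Q: "?g s \<le> \<epsilon>" if "s \<in> Qs" for s using that \<omega> by (force simp: E_def)
    show "?g s \<le> \<epsilon>"
    proof (cases "s = t")
      case True
      then show ?thesis using on_Q by (simp add: Qs_def)
    next
      case False
      then have st: "0 \<le> s" "s < t" using s by auto
      show ?thesis
      proof (rule ccontr)
        assume "\<not> ?g s \<le> \<epsilon>"
        then have gt: "\<epsilon> < ?g s" by simp
        have "((\<lambda>s. Z s \<omega>) \<longlongrightarrow> Z s \<omega>) (at_right s)"
          using cad[of \<omega>] \<omega> st by (auto simp: cadlag_def continuous_within)
        then have "(?g \<longlongrightarrow> ?g s) (at_right s)"
          by (intro tendsto_norm tendsto_diff bounded_linear.tendsto[OF P(1)])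
        then have "eventually (\<lambda>u. \<epsilon> < ?g u) (at_right s)" using gt by (rule order_tendstoD)
        then obtain e where e: "e > s" "\<And>u. s < u \<Longrightarrow> u < e \<Longrightarrow> \<epsilon> < ?g u"
          by (auto simp: eventually_at_right[of s "s + 1"])
        obtain u where u: "u \<in> \<rat>" "s < u" "u < min e t" using Rats_dense_in_real[of s "min e t"] e st by auto
        then have "u \<in> Qs" using st by (auto simp: Qs_def)
        then show False using on_Q[of u] e(2)[of u] u by simp
      qed
    qed
  qed
qed

section \<open>Identification of weak solutions\<close>

locale weak_solution = volterra_resolvent D A a b c T R + prob_space M
  for D :: "'h::{real_inner,banach,second_countable_topology} set" and A a b c T R
    and M :: "'w measure" +
  fixes F :: "real \<Rightarrow> 'w measure" and Z X :: "real \<Rightarrow> 'w \<Rightarrow> 'h"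
  assumes F: "filtration_of M F" and Z: "levy_process M Z" and X: "predictable M F T X"
    and X_int: "\<And>\<omega>. \<omega> \<in> space M \<Longrightarrow> set_integrable lborel {0..T} (\<lambda>s. X s \<omega>)"
    and X_eq: "\<And>t \<xi>. t \<in> {0..T} \<Longrightarrow> \<xi> \<in> adj_dom D A \<Longrightarrow> AE \<omega> in M. inner (X t \<omega>) \<xi> =
         (LINT \<tau>:{0..t}|lborel. inner (a (t - \<tau>) *\<^sub>R X \<tau> \<omega>) (adj_op D A \<xi>)) + inner (Z t \<omega>) \<xi>"
begin

definition X0 :: "real \<Rightarrow> 'w \<Rightarrow> 'h" where "X0 t \<omega> = I t *\<^sub>R X t \<omega>"

definition Z0 :: "real \<Rightarrow> 'w \<Rightarrow> 'h" where "Z0 t \<omega> = I t *\<^sub>R Z t \<omega>"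

lemma Z_measurable: "0 \<le> t \<Longrightarrow> Z t \<in> borel_measurable M"
  using Z by (simp add: levy_process_def)

lemma Z_cadlag: "\<omega> \<in> space M \<Longrightarrow> cadlag (\<lambda>s. Z s \<omega>)"
  by (rule levy_process_cadlag[OF Z])

lemma Z_zero: "\<omega> \<in> space M \<Longrightarrow> Z 0 \<omega> = 0"
  using Z by (simp add: levy_process_def)

lemma X0_measurable[measurable (raw)]:
  assumes "f \<in> borel_measurable N" "g \<in> measurable N M"
  shows "(\<lambda>w. X0 (f w) (g w)) \<in> borel_measurable N"
  using measurable_compose[OF measurable_Pair[OF assms] predictable_jointly_measurable[OF F X]]
  by (simp add: X0_def)

lemma Z0_measurable[measurable (raw)]:
  assumes "f \<in> borel_measurable N" "g \<in> measurable N M"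
  shows "(\<lambda>w. Z0 (f w) (g w)) \<in> borel_measurable N"
  using measurable_compose[OF measurable_Pair[OF assms] cadlag_jointly_measurable[OF Z_measurable Z_cadlag, of T]]
  by (simp add: Z0_def)

lemma X0_integrable: "\<omega> \<in> space M \<Longrightarrow> integrable lborel (\<lambda>\<tau>. X0 \<tau> \<omega>)"
  using X_int by (simp add: set_integrable_def X0_def)

lemma Z0_path_measurable: "\<omega> \<in> space M \<Longrightarrow> (\<lambda>\<tau>. Z0 \<tau> \<omega>) \<in> borel_measurable borel"
  by (rule Z0_measurable) auto

lemma Z0_bound:
  assumes "\<omega> \<in> space M"
  obtains B where "\<And>\<tau>. norm (Z0 \<tau> \<omega>) \<le> B * I \<tau>"
proof -
  obtain B where "\<And>s. s \<in> {0..T} \<Longrightarrow> norm (Z s \<omega>) \<le> B"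
    using cadlag_bounded[OF Z_cadlag[OF assms], of T] by metis
  then show ?thesis by (intro that[of B]) (auto simp: Z0_def indicator_def)
qed

lemma X_measurable: "t \<in> {0..T} \<Longrightarrow> X t \<in> borel_measurable M"
  using X0_measurable[of "\<lambda>_. t" M "\<lambda>\<omega>. \<omega>"] by (simp add: X0_def)

lemma X_eq_conv:
  assumes t: "t \<in> {0..T}" and \<xi>: "\<xi> \<in> adj_dom D A"
  shows "AE \<omega> in M. inner (X t \<omega>) \<xi> = (\<integral>\<tau>. \<alpha> (t - \<tau>) * inner (X0 \<tau> \<omega>) (adj_op D A \<xi>) \<partial>lborel) + inner (Z t \<omega>) \<xi>"
  using X_eq[OF t \<xi>] AE_space
proof eventually_elim
  case (elim \<omega>)
  have [measurable]: "(\<lambda>\<tau>. X0 \<tau> \<omega>) \<in> borel_measurable borel"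
    using borel_measurable_integrable[OF X0_integrable[OF elim(2)]] by simp
  have "(\<lambda>\<tau>. inner (X0 \<tau> \<omega>) (adj_op D A \<xi>)) \<in> borel_measurable borel" by measurable
  then have "(\<lambda>\<tau>. I \<tau> *\<^sub>R inner (X \<tau> \<omega>) (adj_op D A \<xi>)) \<in> borel_measurable borel" by (simp add: X0_def)
  from a_conv_eq[OF t this] elim(1) show ?case by (simp add: X0_def)
qed

lemma convolved_X_eq_weak:
  assumes r: "r \<in> {0..T}" and \<xi>: "\<xi> \<in> adj_dom D A"
  shows "AE \<omega> in M. inner (\<integral>\<tau>. I (r - \<tau>) *\<^sub>R X0 \<tau> \<omega> \<partial>lborel) \<xi> = inner (\<integral>\<tau>. Rz (r - \<tau>) (Z0 \<tau> \<omega>) \<partial>lborel) \<xi>"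
proof -
  define \<eta> where "\<eta> = adj_op D A \<xi>"
  \<comment> \<open>\<open>Rz\<close> stands in for \<open>R\<close>, with which it agrees on the
    relevant times, because its joint measurability makes \<open>?P\<close> a measurable condition
    on the pair of time and outcome.\<close>
  let ?P = "\<lambda>\<tau> \<omega>. \<tau> \<in> {0..r} \<longrightarrow> inner (Rz (r - \<tau>) (X0 \<tau> \<omega>)) \<xi>
      = (\<integral>\<sigma>. \<alpha> (\<tau> - \<sigma>) * inner (Rz (r - \<tau>) (X0 \<sigma> \<omega>)) \<eta> \<partial>lborel) + inner (Rz (r - \<tau>) (Z0 \<tau> \<omega>)) \<xi>"
  interpret P: pair_sigma_finite lborel M ..
  have each: "AE \<omega> in M. ?P \<tau> \<omega>" for \<tau>
  proof (cases "\<tau> \<in> {0..r}")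
    case True
    then have \<tau>: "\<tau> \<in> {0..T}" "0 \<le> r - \<tau>" "r - \<tau> \<in> {0..T}" using r by auto
    obtain y where y: "y \<in> adj_dom D A" "\<And>x. inner x y = inner (R (r - \<tau>) x) \<xi>"
      "\<And>x. inner x (adj_op D A y) = inner (R (r - \<tau>) x) \<eta>"
      unfolding \<eta>_def using resolvent_adjoint[OF A_op R_res \<tau>(2) \<xi>] by metis
    show ?thesis using X_eq_conv[OF \<tau>(1) y(1)] unfolding y(2,3)
      by (rule eventually_mono) (use \<tau> in \<open>simp add: X0_def Z0_def Rz_def\<close>)
  next
    case False
    then show ?thesis by (intro AE_I2) auto
  qed
  \<comment> \<open>At each time the equation holds almost surely, with a null set depending on the
    time; Fubini's theorem turns this into an equation at almost every time on almost every
    path.\<close>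
  have ae: "AE \<tau> in lborel. AE \<omega> in M. ?P \<tau> \<omega>" by (rule AE_I2, rule each)
  have "{x \<in> space (lborel \<Otimes>\<^sub>M M). ?P (fst x) (snd x)} \<in> sets (lborel \<Otimes>\<^sub>M M)" by measurable
  from P.AE_commute[where P="?P", OF this] ae
  have "AE \<omega> in M. AE \<tau> in lborel. ?P \<tau> \<omega>" by (rule iffD1)
  with AE_space show ?thesis
  proof eventually_elim
    case (elim \<omega>)
    obtain B where B: "\<And>\<tau>. norm (Z0 \<tau> \<omega>) \<le> B * I \<tau>" using Z0_bound[OF elim(1)] by blast
    have "AE \<tau> in lborel. \<tau> \<in> {0..r} \<longrightarrow> inner (R (r - \<tau>) (X0 \<tau> \<omega>)) \<xi>
      = (\<integral>\<sigma>. \<alpha> (\<tau> - \<sigma>) * inner (R (r - \<tau>) (X0 \<sigma> \<omega>)) (adj_op D A \<xi>) \<partial>lborel) + inner (R (r - \<tau>) (Z0 \<tau> \<omega>)) \<xi>"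
      using elim(2)
    proof eventually_elim
      case (elim \<tau>)
      show ?case
      proof
        assume "\<tau> \<in> {0..r}"
        then have "Rz (r - \<tau>) = R (r - \<tau>)" using r by (auto simp: Rz_def)
        then show "inner (R (r - \<tau>) (X0 \<tau> \<omega>)) \<xi>
          = (\<integral>\<sigma>. \<alpha> (\<tau> - \<sigma>) * inner (R (r - \<tau>) (X0 \<sigma> \<omega>)) (adj_op D A \<xi>) \<partial>lborel) + inner (R (r - \<tau>) (Z0 \<tau> \<omega>)) \<xi>"
          using elim \<open>\<tau> \<in> {0..r}\<close> by (simp add: \<eta>_def)
      qed
    qed
    then show ?case
      by (intro convolved_identity[OF \<xi> r X0_integrable[OF elim(1)] _ Z0_path_measurable[OF elim(1)] B])
        (auto simp: X0_def)
  qed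
qed

lemma countable_dense_adj_dom:
  obtains \<Xi> where "countable \<Xi>" "\<Xi> \<subseteq> adj_dom D A" "closure \<Xi> = UNIV"
proof -
  obtain \<Xi> where \<Xi>: "countable \<Xi>" "\<Xi> \<subseteq> adj_dom D A" "adj_dom D A \<subseteq> closure \<Xi>" using separable by blast
  then have "closure \<Xi> = UNIV" using adj_dom_dense[OF A_op] closure_minimal[OF \<Xi>(3)] by auto
  then show ?thesis using \<Xi> that by blast
qed

lemma convolved_X_eq:
  assumes r: "r \<le> T"
  shows "AE \<omega> in M. (\<integral>\<tau>. I (r - \<tau>) *\<^sub>R X0 \<tau> \<omega> \<partial>lborel) = (\<integral>\<tau>. Rz (r - \<tau>) (Z0 \<tau> \<omega>) \<partial>lborel)"
proof (cases "0 \<le> r")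
  case True
  obtain \<Xi> where \<Xi>: "countable \<Xi>" "\<Xi> \<subseteq> adj_dom D A" "closure \<Xi> = UNIV" by (rule countable_dense_adj_dom)
  have "AE \<omega> in M. \<forall>\<xi>\<in>\<Xi>. inner (\<integral>\<tau>. I (r - \<tau>) *\<^sub>R X0 \<tau> \<omega> \<partial>lborel) \<xi> = inner (\<integral>\<tau>. Rz (r - \<tau>) (Z0 \<tau> \<omega>) \<partial>lborel) \<xi>"
    using \<Xi>(1,2) r True by (intro AE_ball_countable' convolved_X_eq_weak) auto
  then show ?thesis by (rule eventually_mono) (auto intro!: inner_left_eq_if_dense[OF \<Xi>(3)])
next
  \<comment> \<open>Negative times occur as \<open>t - v\<close> when the identity is convolved with
    \<open>b0\<close>; there both integrands vanish.\<close>
  case False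
  have "I (r - \<tau>) *\<^sub>R X0 \<tau> \<omega> = 0" "Rz (r - \<tau>) (Z0 \<tau> \<omega>) = 0" for \<tau> \<omega>
    using False
    by (cases "\<tau> < 0"; simp add: X0_def Z0_def linear_simps[OF Rz_bounded_linear]; simp add: Rz_def indicator_def)+
  then show ?thesis by (simp only: simp_thms eventually_True)
qed

text \<open>The variation of constants formula, tested against the domain of the adjoint operator and integrated
  by parts.\<close>

lemma X_eq_K_conv:
  assumes t: "t \<in> {0..T}" and \<xi>: "\<xi> \<in> adj_dom D A"
  shows "AE \<omega> in M. inner (X t \<omega>) \<xi> = inner (Z t \<omega>) \<xi> + inner (\<integral>\<tau>. K (t - \<tau>) (Z0 \<tau> \<omega>) \<partial>lborel) (adj_op D A \<xi>)"
proof -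
  let ?P = "\<lambda>r \<omega>. r \<le> t \<longrightarrow> (\<integral>\<tau>. I (r - \<tau>) *\<^sub>R X0 \<tau> \<omega> \<partial>lborel) = (\<integral>\<tau>. Rz (r - \<tau>) (Z0 \<tau> \<omega>) \<partial>lborel)"
  interpret P: pair_sigma_finite lborel M ..
  have "AE \<omega> in M. ?P r \<omega>" for r
    using convolved_X_eq[of r] t by (cases "r \<le> t") auto
  then have ae: "AE r in lborel. AE \<omega> in M. ?P r \<omega>" by (rule AE_I2)
  have "{x \<in> space (lborel \<Otimes>\<^sub>M M). ?P (fst x) (snd x)} \<in> sets (lborel \<Otimes>\<^sub>M M)" by measurable
  from P.AE_commute[where P="?P", OF this] ae
  have "AE \<omega> in M. AE r in lborel. ?P r \<omega>" by (rule iffD1)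
  moreover have "AE \<omega> in M. (\<integral>\<tau>. I (t - \<tau>) *\<^sub>R X0 \<tau> \<omega> \<partial>lborel) = (\<integral>\<tau>. Rz (t - \<tau>) (Z0 \<tau> \<omega>) \<partial>lborel)"
    using t by (intro convolved_X_eq) simp
  ultimately show ?thesis using X_eq_conv[OF t \<xi>] AE_space
  proof eventually_elim
    case (elim \<omega>)
    obtain B where B: "\<And>\<tau>. norm (Z0 \<tau> \<omega>) \<le> B * I \<tau>" using Z0_bound[OF elim(4)] by blast
    have "(\<integral>\<tau>. \<alpha> (t - \<tau>) * inner (X0 \<tau> \<omega>) (adj_op D A \<xi>) \<partial>lborel)
        = (\<integral>\<tau>. inner (\<alpha> (t - \<tau>) *\<^sub>R X0 \<tau> \<omega>) (adj_op D A \<xi>) \<partial>lborel)" by simp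
    also have "\<dots> = inner (\<integral>\<tau>. \<alpha> (t - \<tau>) *\<^sub>R X0 \<tau> \<omega> \<partial>lborel) (adj_op D A \<xi>)"
      by (intro integral_inner_left \<alpha>_scaleR_integrable X0_integrable[OF elim(4)])
    also have "(\<integral>\<tau>. \<alpha> (t - \<tau>) *\<^sub>R X0 \<tau> \<omega> \<partial>lborel) = (\<integral>\<tau>. K (t - \<tau>) (Z0 \<tau> \<omega>) \<partial>lborel)"
      by (rule \<alpha>_conv_eq_K_conv[OF X0_integrable[OF elim(4)] Z0_path_measurable[OF elim(4)] B elim(2) elim(1)])
    finally show ?case using elim(3) by simp
  qed
qed

section \<open>Pathwise limits of the convolution sums\<close>

lemma reversed_path:
  assumes \<omega>: "\<omega> \<in> space M" and t: "0 < t" "t \<le> T"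
  obtains B where "\<And>u. u \<in> {0..t} \<Longrightarrow> norm (Z (t - u) \<omega>) \<le> B"
    "countable {u\<in>{0<..<t}. \<not> isCont (\<lambda>u. Z (t - u) \<omega>) u}"
proof -
  obtain B where B: "\<And>s. s \<in> {0..t} \<Longrightarrow> norm (Z s \<omega>) \<le> B"
    using cadlag_bounded[OF Z_cadlag[OF \<omega>], of t] by metis
  \<comment> \<open>The sums run backwards along the path, so the relevant function is
    \<open>\<lambda>u. Z (t - u) \<omega>\<close>, which is left continuous instead of right
    continuous. Its discontinuities are reflections of those of the path.\<close>
  have "{u\<in>{0<..<t}. \<not> isCont (\<lambda>u. Z (t - u) \<omega>) u} \<subseteq> (\<lambda>s. t - s) ` {s\<in>{0<..t}. \<not> isCont (\<lambda>s. Z s \<omega>) s}"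
  proof
    fix u assume u: "u \<in> {u\<in>{0<..<t}. \<not> isCont (\<lambda>u. Z (t - u) \<omega>) u}"
    have "\<not> isCont (\<lambda>s. Z s \<omega>) (t - u)"
    proof
      assume "isCont (\<lambda>s. Z s \<omega>) (t - u)"
      then have "isCont (\<lambda>u. Z (t - u) \<omega>) u" by (rule isCont_o2[rotated]) (intro continuous_intros)
      then show False using u by simp
    qed
    then show "u \<in> (\<lambda>s. t - s) ` {s\<in>{0<..t}. \<not> isCont (\<lambda>s. Z s \<omega>) s}"
      using u by (intro image_eqI[of _ _ "t - u"]) auto
  qed
  then have "countable {u\<in>{0<..<t}. \<not> isCont (\<lambda>u. Z (t - u) \<omega>) u}"
    by (rule countable_subset) (intro countable_image cadlag_countable_discontinuities Z_cadlag[OF \<omega>])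
  with B show ?thesis by (intro that[of B]) auto
qed

lemma K_path_eq:
  assumes "0 < t" "t \<le> T"
  shows "indicator {0..t} u *\<^sub>R K u (Z (t - u) \<omega>) = K u (Z0 (t - u) \<omega>)"
proof (cases "u \<in> {0..t}")
  case True
  then show ?thesis using assms by (simp add: Z0_def)
next
  case False
  then show ?thesis using K_neg[of u] by (cases "u < 0") (auto simp: Z0_def linear_simps[OF K_bounded_linear])
qed

text \<open>\<open>R_weak\<close> and \<open>Q_eq_integral_K\<close> write
  \<open>inner (R s x) \<xi>\<close> as \<open>inner x \<xi>\<close> plus the integral of the
  bounded kernel \<open>inner (K u x) \<eta>\<close>, the form that
  \<open>tagged_partition_sum_tendsto\<close> takes. The limit is the right-hand side of
  \<open>X_eq_K_conv\<close>.\<close>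

lemma conv_sum_weak_tendsto:
  assumes \<omega>: "\<omega> \<in> space M" and t: "0 < t" "t \<le> T" and \<xi>: "\<xi> \<in> adj_dom D A"
    and p: "\<And>m. tagged_partition t (\<delta> m) (n m) (p m) (s m)" "\<delta> \<longlonglongrightarrow> 0"
  shows "(\<lambda>m. inner (conv_sum R Z t (n m) (p m) (s m) \<omega>) \<xi>)
    \<longlonglongrightarrow> inner (Z t \<omega>) \<xi> + inner (\<integral>\<tau>. K (t - \<tau>) (Z0 \<tau> \<omega>) \<partial>lborel) (adj_op D A \<xi>)"
proof -
  define \<eta> where "\<eta> = adj_op D A \<xi>"
  obtain B where B: "\<And>u. u \<in> {0..t} \<Longrightarrow> norm (Z (t - u) \<omega>) \<le> B"
    and cnt: "countable {u\<in>{0<..<t}. \<not> isCont (\<lambda>u. Z (t - u) \<omega>) u}"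
    using reversed_path[OF \<omega> t] by metis
  have path: "indicator {0..t} u *\<^sub>R inner (K u (Z (t - u) \<omega>)) \<eta> = inner (K u (Z0 (t - u) \<omega>)) \<eta>" for u
    unfolding K_path_eq[OF t, symmetric] by simp
  have Kint: "integrable lborel (\<lambda>u. indicator {0..r} u *\<^sub>R K u x)" for r x
  proof (rule Bochner_Integration.integrable_bound)
    show "integrable lborel (\<lambda>u. Cb * CR * norm x * indicator {0..r} u :: real)"
      by (intro integrable_mult_right integrable_real_indicator) (auto simp: emeasure_lborel_Icc_eq)
    have "norm (indicator {0..r} u *\<^sub>R K u x) \<le> Cb * CR * norm x * indicator {0..r} u" for u
      using K_norm_le[of u x] by (simp add: indicator_def)
    then show "AE u in lborel. norm (indicator {0..r} u *\<^sub>R K u x) \<le> norm (Cb * CR * norm x * indicator {0..r} u :: real)"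
      unfolding real_norm_def by (intro AE_I2 order_trans[OF _ abs_ge_self])
  qed measurable
  have "(\<lambda>m. \<Sum>i=1..n m. inner (R (s m i) (Z (t - p m (i - 1)) \<omega> - Z (t - p m i) \<omega>)) \<xi>)
    \<longlonglongrightarrow> inner (Z (t - 0) \<omega>) \<xi> + (LINT u:{0..t}|lborel. inner (K u (Z (t - u) \<omega>)) \<eta>)"
  proof (rule tagged_partition_sum_tendsto[where k="\<lambda>u x. inner (K u x) \<eta>" and B="Cb * CR * norm \<eta>"
        and b=B and \<delta>=\<delta> and f="\<lambda>u. Z (t - u) \<omega>" and G="\<lambda>s x. inner (R s x) \<xi>" and H="\<lambda>x. inner x \<xi>"])
    show "bounded_linear (\<lambda>x. inner (K u x) \<eta>)" for u
      by (rule bounded_linear_compose[OF bounded_linear_inner_left K_bounded_linear])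
    show "norm (inner (K u x) \<eta>) \<le> Cb * CR * norm \<eta> * norm x" for u x
      using order_trans[OF Cauchy_Schwarz_ineq2 mult_right_mono[OF K_norm_le[of u x] norm_ge_zero[of \<eta>]]]
      by (simp add: mult_ac)
    show "linear (\<lambda>x. inner x \<xi>)" by (rule bounded_linear.linear[OF bounded_linear_inner_left])
    show "inner (R s x) \<xi> = inner x \<xi> + (LINT u:{0..s}|lborel. inner (K u x) \<eta>)" if "s \<in> {0..t}" for s x
    proof -
      have sT: "s \<in> {0..T}" "s \<le> T" using that t by auto
      have "inner (Q s x) \<eta> = (\<integral>u. inner (indicator {0..s} u *\<^sub>R K u x) \<eta> \<partial>lborel)"
        unfolding Q_eq_integral_K[OF sT(2)] set_lebesgue_integral_def by (intro integral_inner_left[symmetric] Kint)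
      then show ?thesis using R_weak[OF \<xi> sT(1), of x] by (simp add: set_lebesgue_integral_def \<eta>_def)
    qed
    show "(\<lambda>u. indicator {0..t} u *\<^sub>R inner (K u (Z (t - u) \<omega>)) \<eta>) \<in> borel_measurable lborel"
      unfolding path using measurable_compose[OF _ Z0_path_measurable[OF \<omega>]] by measurable
  qed (use t B cnt p Z_zero[OF \<omega>] in simp_all)
  moreover have "(LINT u:{0..t}|lborel. inner (K u (Z (t - u) \<omega>)) \<eta>) = inner (\<integral>\<tau>. K (t - \<tau>) (Z0 \<tau> \<omega>) \<partial>lborel) \<eta>"
  proof -
    obtain B where B: "\<And>\<tau>. norm (Z0 \<tau> \<omega>) \<le> B * I \<tau>" using Z0_bound[OF \<omega>] by blast
    have [measurable]: "(\<lambda>\<tau>. Z0 \<tau> \<omega>) \<in> borel_measurable borel" by (rule Z0_path_measurable[OF \<omega>])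
    have int: "integrable lborel (\<lambda>\<tau>. K (t - \<tau>) (Z0 \<tau> \<omega>))"
    proof (rule Bochner_Integration.integrable_bound)
      show "integrable lborel (\<lambda>\<tau>. (Cb * CR) * (B * I \<tau>))" using I_integrable by simp
      have "norm (K (t - \<tau>) (Z0 \<tau> \<omega>)) \<le> (Cb * CR) * (B * I \<tau>)" for \<tau>
        using order_trans[OF abs_ge_zero \<alpha>_bound] CR(1)
        by (intro order_trans[OF K_norm_le mult_left_mono[OF B]]) simp
      then show "AE \<tau> in lborel. norm (K (t - \<tau>) (Z0 \<tau> \<omega>)) \<le> norm ((Cb * CR) * (B * I \<tau>))"
        unfolding real_norm_def by (intro AE_I2 order_trans[OF _ abs_ge_self])
    qed measurable
    have "(LINT u:{0..t}|lborel. inner (K u (Z (t - u) \<omega>)) \<eta>) = (\<integral>u. inner (K u (Z0 (t - u) \<omega>)) \<eta> \<partial>lborel)"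
      unfolding set_lebesgue_integral_def path ..
    also have "\<dots> = (\<integral>\<tau>. inner (K (t - \<tau>) (Z0 (t - (t - \<tau>)) \<omega>)) \<eta> \<partial>lborel)"
      by (rule lborel_integral_reflect[symmetric])
    also have "\<dots> = inner (\<integral>\<tau>. K (t - \<tau>) (Z0 \<tau> \<omega>) \<partial>lborel) \<eta>" using int by simp
    finally show ?thesis .
  qed
  ultimately show ?thesis unfolding conv_sum_def inner_sum_left \<eta>_def by simp
qed

text \<open>Since \<open>A\<close> composed with \<open>P\<close> is bounded,
  \<open>K u (A (P x))\<close> is a bounded vector-valued kernel, and the sums converge in norm and
  not only against test vectors.\<close>

lemma conv_sum_approx_convergent:
  assumes \<omega>: "\<omega> \<in> space M" and t: "0 < t" "t \<le> T"
    and P: "bounded_linear P" "\<And>x. P x \<in> D" "bounded_linear (\<lambda>x. A (P x))"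
    and p: "\<And>m. tagged_partition t (\<delta> m) (n m) (p m) (s m)" "\<delta> \<longlonglongrightarrow> 0"
  shows "convergent (\<lambda>m. conv_sum (\<lambda>u x. R u (P x)) Z t (n m) (p m) (s m) \<omega>)"
proof -
  obtain B where B: "\<And>u. u \<in> {0..t} \<Longrightarrow> norm (Z (t - u) \<omega>) \<le> B"
    and cnt: "countable {u\<in>{0<..<t}. \<not> isCont (\<lambda>u. Z (t - u) \<omega>) u}"
    using reversed_path[OF \<omega> t] by metis
  obtain C where C: "\<And>x. norm (A (P x)) \<le> norm x * C"
    using bounded_linear.bounded[OF P(3)] by metis
  have CC: "0 \<le> Cb * CR" using order_trans[OF abs_ge_zero \<alpha>_bound] CR(1) by simp
  have [measurable]: "(\<lambda>x. A (P x)) \<in> borel_measurable borel"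
    by (intro borel_measurable_continuous_onI linear_continuous_on P)
  have path: "indicator {0..t} u *\<^sub>R K u (A (P (Z (t - u) \<omega>))) = indicator {0..t} u *\<^sub>R K u (A (P (Z0 (t - u) \<omega>)))" for u
    using t by (auto simp: Z0_def indicator_def)
  have "(\<lambda>m. \<Sum>i=1..n m. R (s m i) (P (Z (t - p m (i - 1)) \<omega> - Z (t - p m i) \<omega>)))
    \<longlonglongrightarrow> P (Z (t - 0) \<omega>) + (LINT u:{0..t}|lborel. K u (A (P (Z (t - u) \<omega>))))"
  proof (rule tagged_partition_sum_tendsto[where k="\<lambda>u x. K u (A (P x))" and B="Cb * CR * C"
        and b=B and \<delta>=\<delta> and f="\<lambda>u. Z (t - u) \<omega>" and G="\<lambda>s x. R s (P x)" and H=P])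
    show "bounded_linear (\<lambda>x. K u (A (P x)))" for u
      by (rule bounded_linear_compose[OF K_bounded_linear P(3)])
    show "norm (K u (A (P x))) \<le> Cb * CR * C * norm x" for u x
      using order_trans[OF K_norm_le mult_left_mono[OF C CC]] by (simp add: mult_ac)
    show "linear P" by (rule bounded_linear.linear[OF P(1)])
    show "R s (P x) = P x + (LINT u:{0..s}|lborel. K u (A (P x)))" if "s \<in> {0..t}" for s x
      using R_eq_Q[OF P(2), of s x] Q_eq_integral_K[of s "A (P x)"] that t by simp
    show "(\<lambda>u. indicator {0..t} u *\<^sub>R K u (A (P (Z (t - u) \<omega>)))) \<in> borel_measurable lborel"
      unfolding path using measurable_compose[OF _ Z0_path_measurable[OF \<omega>]] by measurable
  qed (use t B cnt p Z_zero[OF \<omega>] in simp_all)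
  then show ?thesis unfolding conv_sum_def convergent_def by blast
qed

end

section \<open>Norm convergence in probability of the convolution sums\<close>

lemma conv_sum_measurable:
  fixes Z :: "real \<Rightarrow> 'w \<Rightarrow> 'h::{real_normed_vector,second_countable_topology}"
  assumes p: "tagged_partition t \<delta> n p s"
    and Z: "\<And>u. 0 \<le> u \<Longrightarrow> Z u \<in> borel_measurable M"
    and L: "\<And>u. u \<in> {0..t} \<Longrightarrow> bounded_linear (L u)"
  shows "conv_sum L Z t n p s \<in> borel_measurable M"
  unfolding conv_sum_def
proof (rule borel_measurable_sum)
  fix i assume i: "i \<in> {1..n}"
  then have "i - 1 \<le> n" "i \<le> n" by auto
  then have [measurable]: "Z (t - p (i - 1)) \<in> borel_measurable M" "Z (t - p i) \<in> borel_measurable M"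
    using tagged_partition_points(2)[OF p] Z by auto
  have [measurable]: "L (s i) \<in> borel_measurable borel"
    using L[OF tagged_partition_points(3)[OF p i]] by (intro borel_measurable_continuous_onI linear_continuous_on)
  show "(\<lambda>\<omega>. L (s i) (Z (t - p (i - 1)) \<omega> - Z (t - p i) \<omega>)) \<in> borel_measurable M" by measurable
qed

context weak_solution
begin

text \<open>Settles time \<open>0\<close>, at which only the empty partition exists and the
  convolution sum is zero.\<close>

lemma X_zero: "AE \<omega> in M. X 0 \<omega> = 0"
proof -
  obtain \<Xi> where \<Xi>: "countable \<Xi>" "\<Xi> \<subseteq> adj_dom D A" "closure \<Xi> = UNIV" by (rule countable_dense_adj_dom)
  have "AE \<omega> in M. \<forall>\<xi>\<in>\<Xi>. inner (X 0 \<omega>) \<xi> = inner (Z 0 \<omega>) \<xi>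
      + inner (\<integral>\<tau>. K (0 - \<tau>) (Z0 \<tau> \<omega>) \<partial>lborel) (adj_op D A \<xi>)"
    using \<Xi>(1,2) T by (intro AE_ball_countable' X_eq_K_conv) auto
  with AE_space show ?thesis
  proof eventually_elim
    case (elim \<omega>)
    have "K (0 - \<tau>) (Z0 \<tau> \<omega>) = 0" for \<tau>
      using K_neg[of "0 - \<tau>"] Z_zero[OF elim(1)]
      by (cases "\<tau> > 0") (auto simp: Z0_def indicator_def linear_simps[OF K_bounded_linear])
    then show ?case using elim Z_zero[OF elim(1)] by (intro inner_left_eq_if_dense[OF \<Xi>(3)]) simp
  qed
qed

text \<open>One good member of each sequence of partitions with vanishing mesh suffices for a proof
  by contradiction. The sums \<open>S m\<close> split into \<open>SN m\<close>, which converge on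
  every path to \<open>L\<close>, and \<open>E m\<close>, which are small in probability uniformly
  in \<open>m\<close>. Against test vectors \<open>E m\<close> tends to \<open>X t - L\<close>, so
  this difference inherits the smallness of \<open>E m\<close>, and all three parts of
  \<open>S m - X t\<close> are controlled.\<close>

lemma conv_sum_in_prob:
  assumes t: "0 < t" "t \<le> T" and p: "\<And>m. tagged_partition t (\<delta> m) (n m) (p m) (s m)" "\<delta> \<longlonglongrightarrow> 0"
    and g: "0 < g"
  shows "\<exists>m. prob {\<omega>\<in>space M. g \<le> dist (conv_sum R Z t (n m) (p m) (s m) \<omega>) (X t \<omega>)} < g"
proof -
  \<comment> \<open>Each of the three error terms receives a quarter of \<open>g\<close>, in size
    and in probability. The bound \<open>g / 68\<close> makes
    \<open>prob B + 16 * e \<le> 17 * e\<close> at most \<open>g / 4\<close>;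
    \<open>1 / 1280\<close> is the threshold of \<open>indep_sum_second_moment_le\<close>.\<close>
  have "((\<lambda>e. 6 * CR * e + CR * sqrt e) \<longlongrightarrow> 6 * CR * 0 + CR * sqrt 0) (at_right 0)"
    by (intro tendsto_intros)
  then have "eventually (\<lambda>e. 6 * CR * e + CR * sqrt e < g / 4) (at_right 0)"
    using g by (intro order_tendstoD(2)) auto
  moreover have "eventually (\<lambda>e::real. 0 < e \<and> e < min (1 / 1280) (g / 68)) (at_right 0)"
    using eventually_at_right_real[of 0 "min (1 / 1280) (g / 68)"] g by simp
  ultimately have "eventually (\<lambda>e. 6 * CR * e + CR * sqrt e < g / 4 \<and> 0 < e \<and> e < min (1 / 1280) (g / 68)) (at_right 0)"
    by (rule eventually_conj)
  then obtain e where e: "6 * CR * e + CR * sqrt e < g / 4" "0 < e" "e < 1 / 1280" "e < g / 68"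
    using eventually_happens'[OF trivial_limit_at_right_real] by force
  obtain P where P: "\<And>N. bounded_linear (P N)" "\<And>N x. P N x \<in> D" "\<And>N. bounded_linear (\<lambda>x. A (P N x))"
    "\<And>N x. norm (x - P N x) \<le> norm x" "\<And>x. decseq (\<lambda>N. norm (x - P N x))" "\<And>x. (\<lambda>N. P N x) \<longlonglongrightarrow> x"
    using orthogonal_approximations[OF A_op] by metis
  obtain N B where B: "B \<in> events" "prob B \<le> e"
    "\<And>\<omega> s. \<omega> \<in> space M - B \<Longrightarrow> s \<in> {0..t} \<Longrightarrow> norm (Z s \<omega> - P N (Z s \<omega>)) \<le> e"
    using uniform_approx_event[OF Z_measurable Z_cadlag P(1,4,5,6) t(1) e(2) e(2)] by metis
  define W where "W s \<omega> = Z s \<omega> - P N (Z s \<omega>)" for s \<omega>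
  interpret PN: bounded_linear "P N" by (rule P(1))
  have W: "stationary_indep_increments M W"
    unfolding W_def by (rule stationary_indep_increments_linear[OF levy_process_increments[OF Z]])
      (intro bounded_linear_sub bounded_linear_ident P(1))
  define S where "S m = conv_sum R Z t (n m) (p m) (s m)" for m
  define SN where "SN m = conv_sum (\<lambda>u x. R u (P N x)) Z t (n m) (p m) (s m)" for m
  define E where "E m = conv_sum R W t (n m) (p m) (s m)" for m
  have Rbl: "bounded_linear (R u)" if "u \<in> {0..t}" for u using that by (intro R_bounded_linear) simp
  have Wm: "W u \<in> borel_measurable M" if "0 \<le> u" for u
    using W that by (simp add: stationary_indep_increments_def)
  have Sm[measurable]: "S m \<in> borel_measurable M" for m
    unfolding S_def by (rule conv_sum_measurable[OF p(1) Z_measurable Rbl])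
  have SNm[measurable]: "SN m \<in> borel_measurable M" for m
    unfolding SN_def by (rule conv_sum_measurable[OF p(1) Z_measurable bounded_linear_compose[OF Rbl P(1)]])
  have Em[measurable]: "E m \<in> borel_measurable M" for m
    unfolding E_def by (rule conv_sum_measurable[OF p(1) Wm Rbl])
  have Xm[measurable]: "X t \<in> borel_measurable M" using t by (intro X_measurable) simp
  have split: "S m \<omega> = SN m \<omega> + E m \<omega>" for m \<omega>
    unfolding S_def SN_def E_def conv_sum_def sum.distrib[symmetric]
  proof (rule sum.cong[OF refl])
    fix i assume i: "i \<in> {1..n m}"
    interpret Ri: bounded_linear "R (s m i)" by (rule Rbl[OF tagged_partition_points(3)[OF p(1) i]])
    show "R (s m i) (Z (t - p m (i - 1)) \<omega> - Z (t - p m i) \<omega>)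
      = R (s m i) (P N (Z (t - p m (i - 1)) \<omega> - Z (t - p m i) \<omega>)) + R (s m i) (W (t - p m (i - 1)) \<omega> - W (t - p m i) \<omega>)"
      by (simp add: W_def PN.diff Ri.diff)
  qed
  define L where "L \<omega> = lim (\<lambda>m. SN m \<omega>)" for \<omega>
  have lim: "(\<lambda>m. SN m \<omega>) \<longlonglongrightarrow> L \<omega>" if "\<omega> \<in> space M" for \<omega>
    unfolding L_def SN_def
    using conv_sum_approx_convergent[OF that t P(1,2,3) p] by (simp add: convergent_LIMSEQ_iff)
  have Lm[measurable]: "L \<in> borel_measurable M"
    by (rule borel_measurable_LIMSEQ_metric[OF SNm lim])
  have PE: "prob {\<omega>\<in>space M. norm (E m \<omega>) > g / 4} \<le> g / 4" for m
  proof -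
    have "prob {\<omega>\<in>space M. norm (E m \<omega>) > g / 4} \<le> prob {\<omega>\<in>space M. norm (E m \<omega>) > 6 * CR * e + CR * sqrt e}"
      using e(1) by (intro finite_measure_mono) auto
    also have "\<dots> \<le> prob B + 16 * e"
      unfolding E_def conv_sum_def
    proof (rule increment_sum_small[OF W t(1) e(2) CR(1) B(1) _ _ p(1)])
      show "prob B \<le> 1 / 1280" using B(2) e(3) by simp
      show "norm (W u \<omega>) \<le> e" if "\<omega> \<in> space M - B" "u \<in> {0..t}" for \<omega> u
        using B(3)[OF that] by (simp add: W_def)
      fix i assume i: "i \<in> {1..n m}"
      show "bounded_linear (R (s m i))" by (rule Rbl[OF tagged_partition_points(3)[OF p(1) i]])
      show "norm (R (s m i) x) \<le> CR * norm x" for x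
        using tagged_partition_points(3)[OF p(1) i] t by (intro CR(2)) auto
    qed
    also have "\<dots> \<le> g / 4" using B(2) e(4) by simp
    finally show ?thesis .
  qed
  obtain \<Xi> where \<Xi>: "countable \<Xi>" "\<Xi> \<subseteq> adj_dom D A" "closure \<Xi> = UNIV" by (rule countable_dense_adj_dom)
  have "prob {\<omega>\<in>space M. norm (X t \<omega> - L \<omega>) > g / 4} \<le> g / 4"
  proof (rule weak_limit_prob_le[where E=E, OF _ _ \<Xi>(3) _ _ PE])
    have "AE \<omega> in M. \<forall>\<xi>\<in>\<Xi>. inner (X t \<omega>) \<xi> = inner (Z t \<omega>) \<xi>
        + inner (\<integral>\<tau>. K (t - \<tau>) (Z0 \<tau> \<omega>) \<partial>lborel) (adj_op D A \<xi>)"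
      using \<Xi>(1,2) t by (intro AE_ball_countable' X_eq_K_conv) auto
    with AE_space show "AE \<omega> in M. \<forall>\<xi>\<in>\<Xi>. (\<lambda>m. inner (E m \<omega>) \<xi>) \<longlonglongrightarrow> inner (X t \<omega> - L \<omega>) \<xi>"
    proof eventually_elim
      case (elim \<omega>)
      show ?case
      proof
        fix \<xi> assume "\<xi> \<in> \<Xi>"
        then have "(\<lambda>m. inner (S m \<omega>) \<xi>) \<longlonglongrightarrow> inner (X t \<omega>) \<xi>"
          using conv_sum_weak_tendsto[OF elim(1) t _ p, of \<xi>] \<Xi>(2) elim(2) by (auto simp: S_def)
        moreover have "(\<lambda>m. inner (SN m \<omega>) \<xi>) \<longlonglongrightarrow> inner (L \<omega>) \<xi>" by (intro tendsto_intros lim elim(1))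
        ultimately have "(\<lambda>m. inner (S m \<omega>) \<xi> - inner (SN m \<omega>) \<xi>) \<longlonglongrightarrow> inner (X t \<omega>) \<xi> - inner (L \<omega>) \<xi>"
          by (rule tendsto_diff)
        then show "(\<lambda>m. inner (E m \<omega>) \<xi>) \<longlonglongrightarrow> inner (X t \<omega> - L \<omega>) \<xi>"
          by (simp add: split inner_add_left inner_diff_left)
      qed
    qed
  qed (use g in auto)
  moreover have "eventually (\<lambda>m. prob {\<omega>\<in>space M. norm (SN m \<omega> - L \<omega>) > g / 4} < g / 4) sequentially"
    using g by (intro order_tendstoD(2)[OF pointwise_limit_in_prob[OF SNm Lm lim]]) auto
  then obtain m where "prob {\<omega>\<in>space M. norm (SN m \<omega> - L \<omega>) > g / 4} < g / 4"
    by (auto simp: eventually_sequentially)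
  moreover have "prob {\<omega>\<in>space M. g \<le> dist (S m \<omega>) (X t \<omega>)}
      \<le> prob ({\<omega>\<in>space M. norm (SN m \<omega> - L \<omega>) > g / 4} \<union> {\<omega>\<in>space M. norm (E m \<omega>) > g / 4}
        \<union> {\<omega>\<in>space M. norm (X t \<omega> - L \<omega>) > g / 4})"
  proof (rule finite_measure_mono)
    show "{\<omega>\<in>space M. g \<le> dist (S m \<omega>) (X t \<omega>)} \<subseteq> {\<omega>\<in>space M. norm (SN m \<omega> - L \<omega>) > g / 4}
        \<union> {\<omega>\<in>space M. norm (E m \<omega>) > g / 4} \<union> {\<omega>\<in>space M. norm (X t \<omega> - L \<omega>) > g / 4}"
    proof
      fix \<omega> assume "\<omega> \<in> {\<omega>\<in>space M. g \<le> dist (S m \<omega>) (X t \<omega>)}"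
      then have \<omega>: "\<omega> \<in> space M" "g \<le> norm (S m \<omega> - X t \<omega>)" by (auto simp: dist_norm)
      have "S m \<omega> - X t \<omega> = (SN m \<omega> - L \<omega>) + E m \<omega> - (X t \<omega> - L \<omega>)" by (simp add: split)
      then have "norm (S m \<omega> - X t \<omega>) \<le> norm (SN m \<omega> - L \<omega>) + norm (E m \<omega>) + norm (X t \<omega> - L \<omega>)"
        using norm_triangle_ineq4[of "(SN m \<omega> - L \<omega>) + E m \<omega>" "X t \<omega> - L \<omega>"]
          norm_triangle_ineq[of "SN m \<omega> - L \<omega>" "E m \<omega>"] by simp
      then have "norm (SN m \<omega> - L \<omega>) > g / 4 \<or> norm (E m \<omega>) > g / 4 \<or> norm (X t \<omega> - L \<omega>) > g / 4"
        using \<omega>(2) g by linarith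
      then show "\<omega> \<in> {\<omega>\<in>space M. norm (SN m \<omega> - L \<omega>) > g / 4}
        \<union> {\<omega>\<in>space M. norm (E m \<omega>) > g / 4} \<union> {\<omega>\<in>space M. norm (X t \<omega> - L \<omega>) > g / 4}" using \<omega>(1) by blast
    qed
  qed measurable
  moreover have "\<dots> \<le> prob {\<omega>\<in>space M. norm (SN m \<omega> - L \<omega>) > g / 4} + prob {\<omega>\<in>space M. norm (E m \<omega>) > g / 4}
      + prob {\<omega>\<in>space M. norm (X t \<omega> - L \<omega>) > g / 4}"
    by (intro order_trans[OF measure_Un_le] add_right_mono measure_Un_le) measurable
  ultimately have "prob {\<omega>\<in>space M. g \<le> dist (S m \<omega>) (X t \<omega>)} < g" using PE[of m] g by linarith
  then show ?thesis unfolding S_def by blast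
qed

text \<open>If no mesh bound works for \<open>t > 0\<close>, choosing a bad partition for each bound
  \<open>1 / Suc m\<close> produces a sequence that \<open>conv_sum_in_prob\<close> excludes. At
  \<open>t = 0\<close> strict monotonicity of the partition points forces
  \<open>n = 0\<close>.\<close>

lemma stoch_conv_X:
  assumes t: "t \<in> {0..T}"
  shows "stoch_conv M R Z t (X t)"
  unfolding stoch_conv_def
proof (intro allI impI)
  fix g :: real assume g: "0 < g"
  show "\<exists>\<delta>>0. \<forall>n p s. tagged_partition t \<delta> n p s \<longrightarrow>
      prob {\<omega>\<in>space M. g \<le> dist (conv_sum R Z t n p s \<omega>) (X t \<omega>)} < g"
  proof (cases "t = 0")
    case True
    have "prob {\<omega>\<in>space M. g \<le> dist (conv_sum R Z t n p s \<omega>) (X t \<omega>)} < g" if "tagged_partition t 1 n p s" for n p s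
    proof -
      have "n = 0"
      proof (rule ccontr)
        assume "n \<noteq> 0"
        then have "p 0 < p 1" "p 1 \<le> p n"
          using that tagged_partition_points(1)[OF that, of 1 n]
          by (auto simp: tagged_partition_def dest!: bspec[where x=1])
        then show False using that True by (auto simp: tagged_partition_def)
      qed
      moreover have "AE \<omega> in M. \<not> g \<le> dist 0 (X 0 \<omega>)" using X_zero by (rule eventually_mono) (use g in auto)
      ultimately have "prob {\<omega>\<in>space M. g \<le> dist (conv_sum R Z t n p s \<omega>) (X t \<omega>)} = 0"
        using True X_measurable[of 0] t by (intro prob_eq_0_AE) (auto simp: conv_sum_def)
      then show ?thesis using g by simp
    qed
    then show ?thesis by (intro exI[of _ 1]) auto
  next
    case False
    then have t': "0 < t" "t \<le> T" using t by auto
    show ?thesis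
    proof (rule ccontr)
      assume "\<not> ?thesis"
      then have "\<forall>m. \<exists>n p s. tagged_partition t (1 / Suc m) n p s \<and>
          \<not> prob {\<omega>\<in>space M. g \<le> dist (conv_sum R Z t n p s \<omega>) (X t \<omega>)} < g"
        by (metis of_nat_0_less_iff zero_less_Suc zero_less_divide_1_iff)
      then obtain n p s where nps: "\<And>m. tagged_partition t (1 / Suc m) (n m) (p m) (s m)"
        "\<And>m. \<not> prob {\<omega>\<in>space M. g \<le> dist (conv_sum R Z t (n m) (p m) (s m) \<omega>) (X t \<omega>)} < g"
        unfolding choice_iff by blast
      have "(\<lambda>m. 1 / real (Suc m)) \<longlonglongrightarrow> 0" by (rule lim_1_over_n[THEN LIMSEQ_Suc])
      from conv_sum_in_prob[OF t' nps(1) this g] nps(2) show False by blast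
    qed
  qed
qed

end

theorem theorem6:
  fixes M :: "'w measure" and F :: "real \<Rightarrow> 'w measure"
    and D :: "'h::{real_inner,banach,second_countable_topology} set" and A :: "'h \<Rightarrow> 'h"
    and a :: "real \<Rightarrow> real" and R :: "real \<Rightarrow> 'h \<Rightarrow> 'h"
    and Z X :: "real \<Rightarrow> 'w \<Rightarrow> 'h" and T :: real
  assumes "prob_space M"
    and "filtration_of M F"
    and "closed_densely_defined D A"
    and "locally_integrable a"
    and "resolvent_family D A a R"
    and "levy_process M Z"
    and "adapted F Z"
    and "W11_loc a"
    and "T \<ge> 0"
    and "predictable M F T X"
    and "\<forall>\<omega>\<in>space M. set_integrable lborel {0..T} (\<lambda>s. X s \<omega>)"
    and "\<forall>t\<in>{0..T}. \<forall>\<xi>\<in>adj_dom D A. AE \<omega> in M.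
           inner (X t \<omega>) \<xi> =
             (LINT \<tau>:{0..t}|lborel. inner (a (t - \<tau>) *\<^sub>R X \<tau> \<omega>) (adj_op D A \<xi>))
             + inner (Z t \<omega>) \<xi>"
  shows "\<forall>t\<in>{0..T}. stoch_conv M R Z t (X t)"
proof -
  obtain c b where b: "locally_integrable b" "AE t in lborel. t \<ge> 0 \<longrightarrow> a t = c + (LINT s:{0..t}|lborel. b s)"
    using \<open>W11_loc a\<close> by (auto simp: W11_loc_def)
  interpret prob_space M by fact
  interpret weak_solution D A a b c T R M F Z X
    using assms b by unfold_locales auto
  show ?thesis using stoch_conv_X by blast
qed

end
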